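(* Let $S$ be a closed hyperbolic surface. For every $\delta>0$ one has $\dim_H \mathscr{G}_{\ge\delta}=0$. In particular, the typical geodesic has arbitrarily small self-intersection angles, i.e. the set $\{\alpha\in\mathscr{G} : a(\alpha)=0\}$ is typical. Moreover, for every $\delta>0$, the image of $\mathscr{G}_{\ge\delta}$ in $S$ (the union in $S$ of the projections of all geodesics in $\mathscr{G}_{\ge\delta}$) has Hausdorff dimension $1$.
   Context: $S$ is a closed hyperbolic surface; its hyperbolic structure identifies the universal cover with $\mathbb{H}^2$ and $\pi_1(S)$ with a group of orientation-preserving isometries of $\mathbb{H}^2$. $\mathscr{G}=(\partial\mathbb{H}^2\times\partial\mathbb{H}^2)\setminus\Delta$ ($\Delta$ the diagonal) is the set of complete oriented geodesics of $\mathbb{H}^2$, a geodesic $\alpha$ being identified with its pair of endpoints at $-\infty$ and $+\infty$. Identify $\partial\mathbb{H}^2$ with the unit circle in $\mathbb{C}$ and give $\mathscr{G}$ the metric equal to the sum of the Euclidean distances between the corresponding endpoints; $\dim_H A$ for $A\subseteq\mathscr{G}$ is Hausdorff dimension for this metric. Hausdorff dimension in $S$ is taken with respect to the hyperbolic metric. A $\pi_1(S)$-invariant set $A\subseteq\mathscr{G}$ is typical if $\dim_H(\mathscr{G}\setminus A)=0$. If two geodesics $\alpha,\beta$ intersect at a point $p$, $\angle_p(\alpha,\beta)\in[0,\pi/2]$ is their unoriented angle at $p$. For $\alpha\in\mathscr{G}$, $a(\alpha)=\inf_g \angle_{\alpha\cap g\alpha}(\alpha,g\alpha)$, where $g$ ranges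 over the elements of $\pi_1(S)$ such that $g\alpha$ and $\alpha$ are distinct as sets and intersect (necessarily at one point); the infimum over the empty set is $+\infty$. For $\delta>0$, $\mathscr{G}_{\ge\delta}=\{\alpha\in\mathscr{G}: a(\alpha)\ge\delta\}$, a $\pi_1(S)$-invariant set. *)

theory Defs
  imports "HOL-Analysis.Analysis" "HOL-Algebra.Bij"
begin

definition ediam :: "('a \<Rightarrow> 'a \<Rightarrow> real) \<Rightarrow> 'a set \<Rightarrow> ennreal" where
  "ediam d U = (SUP x\<in>U. SUP y\<in>U. ennreal (d x y))"

definition hausdorff_premeasure ::
  "'a set \<Rightarrow> ('a \<Rightarrow> 'a \<Rightarrow> real) \<Rightarrow> real \<Rightarrow> real \<Rightarrow> 'a set \<Rightarrow> ennreal" where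
  "hausdorff_premeasure M d s \<epsilon> A =
     (INF U \<in> {U :: nat \<Rightarrow> 'a set.
                 (\<forall>i. U i \<subseteq> M \<and> ediam d (U i) \<le> ennreal \<epsilon>) \<and> A \<subseteq> (\<Union>i. U i)}.
        (\<Sum>i. ennreal (enn2real (ediam d (U i)) powr s)))"

definition hausdorff_measure ::
  "'a set \<Rightarrow> ('a \<Rightarrow> 'a \<Rightarrow> real) \<Rightarrow> real \<Rightarrow> 'a set \<Rightarrow> ennreal" where
  "hausdorff_measure M d s A = (SUP \<epsilon>\<in>{0<..}. hausdorff_premeasure M d s \<epsilon> A)"

text \<open>
  Restricting to \<open>s > 0\<close> does not change the infimum, and it avoids the
  value \<open>0 powr 0 = 0\<close>, which is wrong for counting measure.
\<close>
definition hausdorff_dim :: "'a set \<Rightarrow> ('a \<Rightarrow> 'a \<Rightarrow> real) \<Rightarrow> 'a set \<Rightarrow> ereal" where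
  "hausdorff_dim M d A = (INF s\<in>{s. s > 0 \<and> hausdorff_measure M d s A = 0}. ereal s)"

definition hdisk :: "complex set" where
  "hdisk = ball 0 1"

definition hcircle :: "complex set" where
  "hcircle = sphere 0 1"

text \<open>Distance of the curvature \<open>-1\<close> metric \<open>2 |dz| / (1 - |z|^2)\<close> on the Poincare disk.\<close>
definition hdist :: "complex \<Rightarrow> complex \<Rightarrow> real" where
  "hdist z w = arcosh (1 + 2 * (cmod (z - w))\<^sup>2 / ((1 - (cmod z)\<^sup>2) * (1 - (cmod w)\<^sup>2)))"

text \<open>
  Isometries are taken extensional, i.e. as elements of \<open>BijGroup hdisk\<close>.
  The last conjunct says that the Jacobian determinant is positive.
\<close>
definition orientation_preserving_isometry :: "(complex \<Rightarrow> complex) \<Rightarrow> bool" where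
  "orientation_preserving_isometry g \<longleftrightarrow>
     g \<in> Bij hdisk \<and>
     (\<forall>z\<in>hdisk. \<forall>w\<in>hdisk. hdist (g z) (g w) = hdist z w) \<and>
     (\<forall>z\<in>hdisk. \<exists>A. (g has_derivative A) (at z) \<and>
        Re (A 1) * Im (A \<i>) - Im (A 1) * Re (A \<i>) > 0)"

text \<open>
  A closed hyperbolic surface is given by its group of deck transformations
  \<open>\<Gamma>\<close>: the surface is the quotient of the hyperbolic plane by
  \<open>\<Gamma>\<close>, which acts freely, properly discontinuously and cocompactly.
\<close>
definition closed_hyperbolic_surface :: "(complex \<Rightarrow> complex) set \<Rightarrow> bool" where
  "closed_hyperbolic_surface \<Gamma> \<longleftrightarrow>
     subgroup \<Gamma> (BijGroup hdisk) \<and>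
     (\<forall>g\<in>\<Gamma>. orientation_preserving_isometry g) \<and>
     (\<forall>g\<in>\<Gamma>. \<forall>z\<in>hdisk. g z = z \<longrightarrow> g = \<one>\<^bsub>BijGroup hdisk\<^esub>) \<and>
     (\<forall>K. compact K \<and> K \<subseteq> hdisk \<longrightarrow> finite {g \<in> \<Gamma>. g ` K \<inter> K \<noteq> {}}) \<and>
     (\<exists>K. compact K \<and> K \<subseteq> hdisk \<and> (\<Union>g\<in>\<Gamma>. g ` K) = hdisk)"

definition surface_proj :: "(complex \<Rightarrow> complex) set \<Rightarrow> complex \<Rightarrow> complex set" where
  "surface_proj \<Gamma> z = (\<lambda>g. g z) ` \<Gamma>"

definition surface :: "(complex \<Rightarrow> complex) set \<Rightarrow> complex set set" where
  "surface \<Gamma> = surface_proj \<Gamma> ` hdisk"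

text \<open>The distance on the quotient is the infimum of the distances between lifts.\<close>
definition surface_dist ::
  "(complex \<Rightarrow> complex) set \<Rightarrow> complex set \<Rightarrow> complex set \<Rightarrow> real" where
  "surface_dist \<Gamma> P Q = (INF (z, w)\<in>P \<times> Q. hdist z w)"

definition geodesics :: "(complex \<times> complex) set" where
  "geodesics = hcircle \<times> hcircle - {(\<xi>, \<eta>). \<xi> = \<eta>}"

definition geodesics_dist :: "complex \<times> complex \<Rightarrow> complex \<times> complex \<Rightarrow> real" where
  "geodesics_dist \<alpha> \<beta> = dist (fst \<alpha>) (fst \<beta>) + dist (snd \<alpha>) (snd \<beta>)"

definition unit_speed_param :: "complex \<times> complex \<Rightarrow> (real \<Rightarrow> complex) \<Rightarrow> bool" where
  "unit_speed_param \<alpha> c \<longleftrightarrow>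
     range c \<subseteq> hdisk \<and> (\<forall>s t. hdist (c s) (c t) = \<bar>s - t\<bar>) \<and>
     (c \<longlongrightarrow> fst \<alpha>) at_bot \<and> (c \<longlongrightarrow> snd \<alpha>) at_top"

definition geodesic_line :: "complex \<times> complex \<Rightarrow> complex set" where
  "geodesic_line \<alpha> = {c t | c t. unit_speed_param \<alpha> c}"

text \<open>
  The model is conformal, so Euclidean and hyperbolic angles agree. Unit speed
  parametrizations are unique up to translation, so the angle is well defined
  whenever \<open>p\<close> lies on both geodesics.
\<close>
definition geodesic_angle :: "complex \<Rightarrow> complex \<times> complex \<Rightarrow> complex \<times> complex \<Rightarrow> real" where
  "geodesic_angle p \<alpha> \<beta> =
     (THE \<theta>. \<exists>b c s t. unit_speed_param \<alpha> b \<and> unit_speed_param \<beta> c \<and> b s = p \<and> c t = p \<and>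
        (let u = vector_derivative b (at s); v = vector_derivative c (at t)
         in \<theta> = arccos (\<bar>inner u v\<bar> / (norm u * norm v))))"

text \<open>The group acts on the circle through the continuous extensions of its elements.\<close>
definition boundary_map :: "(complex \<Rightarrow> complex) \<Rightarrow> complex \<Rightarrow> complex" where
  "boundary_map g \<xi> = Lim (at \<xi> within hdisk) g"

definition geodesic_act :: "(complex \<Rightarrow> complex) \<Rightarrow> complex \<times> complex \<Rightarrow> complex \<times> complex" where
  "geodesic_act g \<alpha> = (boundary_map g (fst \<alpha>), boundary_map g (snd \<alpha>))"

definition self_intersection_angle ::
  "(complex \<Rightarrow> complex) set \<Rightarrow> complex \<times> complex \<Rightarrow> ereal" where
  "self_intersection_angle \<Gamma> \<alpha> =
     Inf {ereal (geodesic_angle p \<alpha> (geodesic_act g \<alpha>)) | g p.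
            g \<in> \<Gamma> \<and> geodesic_line (geodesic_act g \<alpha>) \<noteq> geodesic_line \<alpha> \<and>
            p \<in> geodesic_line \<alpha> \<inter> geodesic_line (geodesic_act g \<alpha>)}"

definition geodesics_angle_ge ::
  "(complex \<Rightarrow> complex) set \<Rightarrow> real \<Rightarrow> (complex \<times> complex) set" where
  "geodesics_angle_ge \<Gamma> \<delta> = {\<alpha>\<in>geodesics. self_intersection_angle \<Gamma> \<alpha> \<ge> ereal \<delta>}"

definition typical :: "(complex \<Rightarrow> complex) set \<Rightarrow> (complex \<times> complex) set \<Rightarrow> bool" where
  "typical \<Gamma> A \<longleftrightarrow>
     A \<subseteq> geodesics \<and> (\<forall>g\<in>\<Gamma>. geodesic_act g ` A = A) \<and>
     hausdorff_dim geodesics geodesics_dist (geodesics - A) = 0"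

definition surface_image ::
  "(complex \<Rightarrow> complex) set \<Rightarrow> (complex \<times> complex) set \<Rightarrow> complex set set" where
  "surface_image \<Gamma> A = surface_proj \<Gamma> ` (\<Union>\<alpha>\<in>A. geodesic_line \<alpha>)"

end

theory Submission
  imports Defs "HOL-Real_Asymp.Real_Asymp"
begin

text \<open>
  An oriented geodesic is encoded by a frame: a matrix \<open>M\<close> in \<open>SL\<^sub>2(\<real>)\<close>, acting on the disk through
  \<open>SU(1, 1)\<close>, stands for the geodesic with ends \<open>M(-1)\<close> and \<open>M 1\<close> and for its point \<open>M 0\<close>; the deck
  group acts on the left and the geodesic flow \<open>diag(e\<^sup>t\<^sup>/\<^sup>2, e\<^sup>-\<^sup>t\<^sup>/\<^sup>2)\<close> on the right. If
  \<open>Q = M\<^sup>-\<^sup>1 M'\<close> has entries \<open>p, q, r, s\<close>, then \<open>r\<close> and \<open>q\<close> measure the distances of the forward and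
  backward ends, and when the two geodesics cross, \<open>- q r = sin\<^sup>2 (\<theta> / 2)\<close> for the crossing angle \<open>\<theta>\<close>.

  Fix a geodesic with self-intersection angles at least \<open>\<delta>\<close>. Then \<open>- q r\<close> avoids an interval
  \<open>(0, \<eta>)\<close> for all frames of its lifts. Consider many lifts through a fundamental domain that are
  separated at time \<open>k\<close>, ordered by their forward ends, and call \<open>\<tau>\<close> the time at which a lift and its
  successor have diverged to a fixed small distance. Two such pairs with the same \<open>\<tau>\<close> which at time
  \<open>\<tau>\<close> look alike modulo the deck group cannot cross at small angles, so their backward ends interlace
  and are \<open>e\<^sup>-\<^sup>\<tau>\<close>-close; hence up to finitely many choices the same deck transformation brings both back,
  which is impossible as the pairs are disjoint at time \<open>0\<close>. So only linearly many (in \<open>k\<close>) deck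
  transformations occur as \<open>k\<close>-steps of the geodesic. Cutting a long geodesic segment into pieces of a
  fixed large length \<open>k\<close> yields covers of exponentially small mesh whose cardinality grows at an
  arbitrarily small exponential rate, and the Hausdorff dimension is \<open>0\<close>; with one more coordinate along
  the geodesic, the image in the surface has dimension at most \<open>1\<close>. It is at least \<open>1\<close> because the axis of
  a deck transformation of minimal displacement is a simple geodesic.
\<close>

section \<open>Real unimodular matrices acting on the disk\<close>

text \<open>The difficulty is uniformity: the set of \<open>k\<close>-steps depends on the geodesic,
  but one cover must serve all geodesics with the same \<open>\<delta>\<close>. In
  \<open>card_steps\<close> the constant \<open>C\<close> is therefore independent of the geodesic
  and of \<open>k\<close>. For fixed \<open>k\<close> all step sets are subsets of one finite ball
  in the deck group. Their number is enormous, but it does not depend on how long the coded segment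
  is and enters the covers as a constant factor only; what grows is the number of words over a
  single step set. Following a geodesic for time \<open>i * k\<close> in both directions takes at
  most \<open>(C * (k + 1)) ^ (2 * i)\<close> pairs of words and fixes both ends up to order
  \<open>exp (- i * k)\<close>, so the exponent is about \<open>2 * ln (C * (k + 1)) / k\<close>.
  Interlacing comes from a sign. For two frames whose forward ends differ by a small
  \<open>r > 0\<close>, a negative \<open>q\<close> would make \<open>- q r\<close> small and
  positive, which is forbidden. Hence \<open>q \<ge> 0\<close>: the order of the forward ends
  dictates that of the backward ends. Comparing the first frame of each pair with the second frame
  of the other traps the backward ends of the first frames.\<close>

typedef sl2 = "{(p, q, r, s). p * s - q * r = (1 :: real)}"
  by (rule exI[of _ "(1, 0, 0, 1)"]) simp

setup_lifting type_definition_sl2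

lift_definition e11 :: "sl2 \<Rightarrow> real" is "\<lambda>(p, q, r, s). p" .
lift_definition e12 :: "sl2 \<Rightarrow> real" is "\<lambda>(p, q, r, s). q" .
lift_definition e21 :: "sl2 \<Rightarrow> real" is "\<lambda>(p, q, r, s). r" .
lift_definition e22 :: "sl2 \<Rightarrow> real" is "\<lambda>(p, q, r, s). s" .

instantiation sl2 :: "{monoid_mult, inverse}"
begin

lift_definition one_sl2 :: sl2 is "(1, 0, 0, 1)" by simp

lift_definition times_sl2 :: "sl2 \<Rightarrow> sl2 \<Rightarrow> sl2" is
  "\<lambda>(p, q, r, s) (p', q', r', s').
     (p * p' + q * r', p * q' + q * s', r * p' + s * r', r * q' + s * s')"
proof clarsimp
  fix p q r s p' q' r' s' :: real
  assume "p * s - q * r = 1" "p' * s' - q' * r' = 1"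
  moreover have "(p * p' + q * r') * (r * q' + s * s') - (p * q' + q * s') * (r * p' + s * r')
      = (p * s - q * r) * (p' * s' - q' * r')"
    by (simp add: algebra_simps)
  ultimately show "(p * p' + q * r') * (r * q' + s * s') - (p * q' + q * s') * (r * p' + s * r') = 1"
    by simp
qed

lift_definition inverse_sl2 :: "sl2 \<Rightarrow> sl2" is "\<lambda>(p, q, r, s). (s, - q, - r, p)"
  by (auto simp: algebra_simps)

definition divide_sl2 :: "sl2 \<Rightarrow> sl2 \<Rightarrow> sl2" where
  "divide_sl2 m n = m * inverse n"

instance
  by standard (transfer; auto simp: algebra_simps)+

end

lemma sl2_det: "e11 m * e22 m - e12 m * e21 m = 1"
  by transfer auto

lemma sl2_eqI:
  "e11 m = e11 n \<Longrightarrow> e12 m = e12 n \<Longrightarrow> e21 m = e21 n \<Longrightarrow> e22 m = e22 n \<Longrightarrow> m = n"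
  by transfer auto

lemma sl2_exists:
  assumes "p * s - q * r = 1"
  obtains m where "e11 m = p" "e12 m = q" "e21 m = r" "e22 m = s"
  using assms by transfer (auto simp: split_paired_all)

lemma sl2_entries_mult [simp]:
  "e11 (m * n) = e11 m * e11 n + e12 m * e21 n"
  "e12 (m * n) = e11 m * e12 n + e12 m * e22 n"
  "e21 (m * n) = e21 m * e11 n + e22 m * e21 n"
  "e22 (m * n) = e21 m * e12 n + e22 m * e22 n"
  by (transfer; auto)+

lemma sl2_entries_one [simp]: "e11 1 = 1" "e12 1 = 0" "e21 1 = 0" "e22 1 = 1"
  by (transfer; simp)+

lemma sl2_entries_inverse [simp]:
  "e11 (inverse m) = e22 m" "e12 (inverse m) = - e12 m"
  "e21 (inverse m) = - e21 m" "e22 (inverse m) = e11 m"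
  by (transfer; auto)+

lemma sl2_inverse [simp]:
  fixes m n :: sl2
  shows "inverse m * m = 1" "m * inverse m = 1"
    "inverse m * (m * n) = n" "m * (inverse m * n) = n"
    "inverse (inverse m) = m" "inverse (m * n) = inverse n * inverse m" "inverse (1 :: sl2) = 1"
proof -
  show l: "inverse m * m = 1" and r: "m * inverse m = 1"
    using sl2_det[of m] by (auto intro!: sl2_eqI simp: algebra_simps)
  show "inverse m * (m * n) = n" "m * (inverse m * n) = n"
    by (simp_all add: l r flip: mult.assoc)
  show "inverse (inverse m) = m" "inverse (m * n) = inverse n * inverse m" "inverse (1 :: sl2) = 1"
    by (auto intro!: sl2_eqI simp: algebra_simps)
qed

lift_definition flow :: "real \<Rightarrow> sl2" is "\<lambda>t. (exp (t / 2), 0, 0, exp (- t / 2))"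
  by (simp flip: exp_add)

lift_definition rot :: "real \<Rightarrow> sl2" is "\<lambda>t. (cos t, - sin t, sin t, cos t)"
  by (auto simp: power2_eq_square[symmetric])

lemma sl2_entries_flow [simp]:
  "e11 (flow t) = exp (t / 2)" "e12 (flow t) = 0" "e21 (flow t) = 0" "e22 (flow t) = exp (- t / 2)"
  by (transfer; simp)+

lemma sl2_entries_rot [simp]:
  "e11 (rot t) = cos t" "e12 (rot t) = - sin t" "e21 (rot t) = sin t" "e22 (rot t) = cos t"
  by (transfer; simp)+

lemma flow_add: "flow s * flow t = flow (s + t)"
  by (auto intro!: sl2_eqI simp: add_divide_distrib diff_divide_distrib simp flip: exp_add)

lemma flow_0 [simp]: "flow 0 = 1"
  by (auto intro!: sl2_eqI)

lemma inverse_flow [simp]: "inverse (flow t) = flow (- t)"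
  by (auto intro!: sl2_eqI)

text \<open>With \<open>(x, y)\<close> read as \<open>v = x + \<i> y\<close>, the real matrix
  \<open>m\<close> acts as \<open>v \<mapsto> ca m * v + cb m * cnj v\<close>. In the coordinates
  \<open>(v, cnj v)\<close> it becomes an element of \<open>SU(1, 1)\<close> with first row
  \<open>ca m, cb m\<close>.\<close>

definition ca :: "sl2 \<Rightarrow> complex" where
  "ca m = Complex ((e11 m + e22 m) / 2) ((e21 m - e12 m) / 2)"

definition cb :: "sl2 \<Rightarrow> complex" where
  "cb m = Complex ((e11 m - e22 m) / 2) ((e21 m + e12 m) / 2)"

lemma ca_cb_norm: "(cmod (ca m))\<^sup>2 - (cmod (cb m))\<^sup>2 = 1"
  using sl2_det[of m] unfolding ca_def cb_def cmod_power2 complex.sel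
  by (simp add: field_simps power2_eq_square)

lemma ca_mult: "ca (m * n) = ca m * ca n + cb m * cnj (cb n)"
  by (simp add: ca_def cb_def complex_eq_iff field_simps)

lemma cb_mult: "cb (m * n) = ca m * cb n + cb m * cnj (ca n)"
  by (simp add: ca_def cb_def complex_eq_iff field_simps)

lemma ca_cb_inverse [simp]: "ca (inverse m) = cnj (ca m)" "cb (inverse m) = - cb m"
  by (simp_all add: ca_def cb_def complex_eq_iff field_simps)

lemma ca_cb_one [simp]: "ca 1 = 1" "cb 1 = 0"
  by (simp_all add: ca_def cb_def complex_eq_iff)

lemma ca_cb_rot [simp]: "ca (rot t) = cis t" "cb (rot t) = 0"
  by (simp_all add: ca_def cb_def complex_eq_iff)

lemma ca_cb_flow: "ca (flow t) = of_real (cosh (t / 2))" "cb (flow t) = of_real (sinh (t / 2))"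
  by (simp_all add: ca_def cb_def complex_eq_iff cosh_def sinh_def)

lemma ca_plus_cb: "ca m + cb m = Complex (e11 m) (e21 m)"
  by (simp add: ca_def cb_def complex_eq_iff field_simps)

lemma ca_minus_cb: "ca m - cb m = Complex (e22 m) (- e12 m)"
  by (simp add: ca_def cb_def complex_eq_iff field_simps)

lemma cb_less_ca: "cmod (cb m) < cmod (ca m)"
  using ca_cb_norm[of m] by (intro power2_less_imp_less[of "cmod (cb m)"]) auto

lemma ca_nonzero [simp]: "ca m \<noteq> 0"
  using cb_less_ca[of m] by (metis norm_zero norm_ge_zero not_le)

text \<open>The map \<open>v \<mapsto> ca m * v + cb m * cnj v\<close> has the singular values
  \<open>cmod (ca m) + cmod (cb m)\<close> and \<open>cmod (ca m) - cmod (cb m)\<close>, so this is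
  the Euclidean operator norm of the real matrix. It measures how far \<open>act m\<close> moves
  \<open>0\<close>, see \<open>hdist_0_act\<close>.\<close>

definition opnorm :: "sl2 \<Rightarrow> real" where
  "opnorm m = cmod (ca m) + cmod (cb m)"

text \<open>The product of the two singular values is the determinant.\<close>

lemma opnorm_diff: "cmod (ca m) - cmod (cb m) = 1 / opnorm m"
proof -
  have "(cmod (ca m) - cmod (cb m)) * opnorm m = 1"
    using ca_cb_norm[of m] by (simp add: opnorm_def algebra_simps power2_eq_square)
  moreover have "opnorm m \<noteq> 0"
    using calculation by force
  ultimately show ?thesis by (simp add: field_simps)
qed

lemma opnorm_ge_1: "opnorm m \<ge> 1"
proof -
  have "(cmod (ca m))\<^sup>2 \<ge> 1\<^sup>2" using ca_cb_norm[of m] by (smt (verit) zero_le_power2 one_power2)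
  then have "cmod (ca m) \<ge> 1" by (rule power2_le_imp_le) simp
  then show ?thesis by (simp add: opnorm_def add_increasing2)
qed

lemma opnorm_pos [simp]: "opnorm m > 0"
  using opnorm_ge_1[of m] by linarith

lemma opnorm_one [simp]: "opnorm 1 = 1"
  by (simp add: opnorm_def)

lemma opnorm_inverse [simp]: "opnorm (inverse m) = opnorm m"
  by (simp add: opnorm_def)

lemma opnorm_mult: "opnorm (m * n) \<le> opnorm m * opnorm n"
proof -
  have "cmod (ca (m * n)) \<le> cmod (ca m) * cmod (ca n) + cmod (cb m) * cmod (cb n)"
    unfolding ca_mult by (rule order_trans[OF norm_triangle_ineq]) (simp add: norm_mult)
  moreover have "cmod (cb (m * n)) \<le> cmod (ca m) * cmod (cb n) + cmod (cb m) * cmod (ca n)"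
    unfolding cb_mult by (rule order_trans[OF norm_triangle_ineq]) (simp add: norm_mult)
  ultimately show ?thesis by (simp add: opnorm_def algebra_simps)
qed

lemma opnorm_mult_le: "opnorm m \<le> R \<Longrightarrow> opnorm n \<le> R' \<Longrightarrow> opnorm (m * n) \<le> R * R'"
  by (rule order_trans[OF opnorm_mult mult_mono]) (auto intro: order_trans[of 0 1] less_imp_le opnorm_ge_1 order_trans[OF _ opnorm_ge_1]
      order_trans[OF less_imp_le[OF opnorm_pos]])

lemma opnorm_rot [simp]: "opnorm (rot t) = 1"
  by (simp add: opnorm_def)

lemma opnorm_flow: "opnorm (flow t) = exp (\<bar>t\<bar> / 2)"
proof -
  have "opnorm (flow t) = \<bar>cosh (t / 2)\<bar> + \<bar>sinh (t / 2)\<bar>"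
    unfolding opnorm_def ca_cb_flow norm_of_real ..
  then show ?thesis
    using cosh_plus_sinh[of "t / 2"] cosh_minus_sinh[of "t / 2"] cosh_real_pos[of "t / 2"]
    by (cases "t \<ge> 0") auto
qed

lemma col_le_opnorm: "cmod (Complex (e11 m) (e21 m)) \<le> opnorm m"
   "cmod (Complex (e22 m) (- e12 m)) \<le> opnorm m"
  unfolding opnorm_def ca_plus_cb[symmetric] ca_minus_cb[symmetric]
  by (rule norm_triangle_ineq, rule norm_triangle_ineq4)

lemma col_ge_opnorm: "cmod (Complex (e11 m) (e21 m)) \<ge> 1 / opnorm m"
   "cmod (Complex (e22 m) (- e12 m)) \<ge> 1 / opnorm m"
  unfolding opnorm_diff[symmetric] ca_plus_cb[symmetric] ca_minus_cb[symmetric]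
  using norm_triangle_ineq2[of "ca m" "- cb m"] norm_triangle_ineq2[of "ca m" "cb m"] by auto

lemma entry_le_opnorm:
  "\<bar>e11 m\<bar> \<le> opnorm m" "\<bar>e12 m\<bar> \<le> opnorm m" "\<bar>e21 m\<bar> \<le> opnorm m" "\<bar>e22 m\<bar> \<le> opnorm m"
  using col_le_opnorm[of m] abs_Re_le_cmod[of "Complex (e11 m) (e21 m)"] abs_Im_le_cmod[of "Complex (e11 m) (e21 m)"]
   abs_Re_le_cmod[of "Complex (e22 m) (- e12 m)"] abs_Im_le_cmod[of "Complex (e22 m) (- e12 m)"]
  by auto

lemma opnorm_le_entries: "opnorm m \<le> \<bar>e11 m\<bar> + \<bar>e12 m\<bar> + \<bar>e21 m\<bar> + \<bar>e22 m\<bar>"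
proof -
  have "cmod (ca m) \<le> (\<bar>e11 m + e22 m\<bar> + \<bar>e21 m - e12 m\<bar>) / 2"
    using cmod_le[of "ca m"] by (simp add: ca_def)
  moreover have "cmod (cb m) \<le> (\<bar>e11 m - e22 m\<bar> + \<bar>e21 m + e12 m\<bar>) / 2"
    using cmod_le[of "cb m"] by (simp add: cb_def)
  moreover have "\<bar>x + y\<bar> + \<bar>x - y\<bar> \<le> 2 * (\<bar>x\<bar> + \<bar>y\<bar>)" for x y :: real
    using abs_triangle_ineq[of x y] abs_triangle_ineq4[of x y] by simp
  from this[of "e11 m" "e22 m"] this[of "e21 m" "e12 m"]
  have "\<bar>e11 m + e22 m\<bar> + \<bar>e11 m - e22 m\<bar> + (\<bar>e21 m - e12 m\<bar> + \<bar>e21 m + e12 m\<bar>)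
      \<le> 2 * (\<bar>e11 m\<bar> + \<bar>e22 m\<bar> + \<bar>e21 m\<bar> + \<bar>e12 m\<bar>)" by simp
  ultimately show ?thesis unfolding opnorm_def by argo
qed

definition act :: "sl2 \<Rightarrow> complex \<Rightarrow> complex" where
  "act m z = (ca m * z + cb m) / (cnj (cb m) * z + cnj (ca m))"

text \<open>Its inverse square is the complex derivative of \<open>act m\<close>, hence its role in
  \<open>act_diff\<close> and \<open>act_norm\<close>.\<close>

definition den :: "sl2 \<Rightarrow> complex \<Rightarrow> complex" where
  "den m z = cnj (cb m) * z + cnj (ca m)"

lemma den_nonzero: "cmod z \<le> 1 \<Longrightarrow> den m z \<noteq> 0"
proof
  assume "cmod z \<le> 1" "den m z = 0"
  then have "cmod (ca m) = cmod (cb m) * cmod z"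
    by (metis add_eq_0_iff2 complex_mod_cnj den_def norm_minus_cancel norm_mult)
  also have "\<dots> \<le> cmod (cb m)" using \<open>cmod z \<le> 1\<close> by (simp add: mult_left_le)
  finally show False using cb_less_ca[of m] by simp
qed

lemma ca_cb_cnj: "ca m * cnj (ca m) - cb m * cnj (cb m) = 1"
proof -
  have "complex_of_real ((cmod (ca m))\<^sup>2 - (cmod (cb m))\<^sup>2) = 1" by (simp only: ca_cb_norm of_real_1)
  then show ?thesis by (simp only: of_real_diff complex_norm_square)
qed

lemma act_diff:
  assumes "cmod z \<le> 1" "cmod w \<le> 1"
  shows "act m z - act m w = (z - w) / (den m z * den m w)"
proof -
  have "(ca m * z + cb m) * den m w - (ca m * w + cb m) * den m z
     = (ca m * cnj (ca m) - cb m * cnj (cb m)) * (z - w)"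
    by (simp add: den_def algebra_simps)
  then show ?thesis
    using den_nonzero[OF assms(1), of m] den_nonzero[OF assms(2), of m]
    by (simp add: act_def ca_cb_cnj frac_eq_eq diff_frac_eq flip: den_def)
qed

lemma act_norm:
  assumes "cmod z \<le> 1"
  shows "1 - (cmod (act m z))\<^sup>2 = (1 - (cmod z)\<^sup>2) / (cmod (den m z))\<^sup>2"
proof -
  have "complex_of_real ((cmod (den m z))\<^sup>2 - (cmod (ca m * z + cb m))\<^sup>2)
      = (ca m * cnj (ca m) - cb m * cnj (cb m)) * of_real (1 - (cmod z)\<^sup>2)"
    unfolding of_real_diff complex_norm_square by (simp add: den_def algebra_simps)
  then have "(cmod (den m z))\<^sup>2 - (cmod (ca m * z + cb m))\<^sup>2 = 1 - (cmod z)\<^sup>2"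
    unfolding ca_cb_cnj by (simp only: mult_1 of_real_eq_iff)
  moreover have "cmod (act m z) = cmod (ca m * z + cb m) / cmod (den m z)"
    by (simp add: act_def norm_divide flip: den_def)
  then have "(cmod (act m z))\<^sup>2 = (cmod (ca m * z + cb m))\<^sup>2 / (cmod (den m z))\<^sup>2"
    by (simp add: power_divide)
  ultimately show ?thesis using den_nonzero[OF assms, of m]
    by (simp add: diff_divide_eq_iff eq_divide_eq algebra_simps)
qed

lemma act_hdisk [simp]: "z \<in> hdisk \<Longrightarrow> act m z \<in> hdisk"
proof -
  assume "z \<in> hdisk"
  then have z: "cmod z < 1" by (simp add: hdisk_def)
  then have "(cmod z)\<^sup>2 < 1" by (simp add: power_less_one_iff abs_square_less_1)
  then have "1 - (cmod (act m z))\<^sup>2 > 0"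
    using z den_nonzero[of z m] by (subst act_norm) auto
  then show ?thesis by (simp add: hdisk_def abs_square_less_1)
qed

lemma act_hcircle [simp]: "z \<in> hcircle \<Longrightarrow> act m z \<in> hcircle"
proof -
  assume "z \<in> hcircle"
  then have z: "cmod z = 1" by (simp add: hcircle_def)
  then have "1 - (cmod (act m z))\<^sup>2 = 0"
    using z by (subst act_norm) auto
  then have "(cmod (act m z))\<^sup>2 = 1" by simp
  then show ?thesis by (simp add: hcircle_def power2_eq_1_iff) (smt (verit) norm_ge_zero)
qed

lemma act_cball: "cmod z \<le> 1 \<Longrightarrow> cmod (act m z) \<le> 1"
  using act_hdisk[of z m] act_hcircle[of z m] by (force simp: hdisk_def hcircle_def)

lemma act_mult: 
  assumes "cmod z \<le> 1"
  shows "act (m * n) z = act m (act n z)"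
proof -
  have n: "den n z \<noteq> 0" and m: "den m (act n z) \<noteq> 0"
    using assms by (auto intro!: den_nonzero act_cball)
  have w: "act n z * den n z = ca n * z + cb n" using n by (simp add: act_def den_def)
  have "den (m * n) z = den m (act n z) * den n z"
    unfolding den_def[of m] distrib_right mult.assoc w by (simp add: den_def ca_mult cb_mult algebra_simps)
  moreover have "ca (m * n) * z + cb (m * n) = (ca m * act n z + cb m) * den n z"
    unfolding distrib_right mult.assoc w by (simp add: den_def ca_mult cb_mult algebra_simps)
  ultimately show ?thesis using n m
    by (simp add: act_def[of m] act_def[of "m * n"] flip: den_def)
qed

lemma act_one [simp]: "act 1 z = z"
  by (simp add: act_def)

lemma act_inverse [simp]:
  "cmod z \<le> 1 \<Longrightarrow> act m (act (inverse m) z) = z" "cmod z \<le> 1 \<Longrightarrow> act (inverse m) (act m z) = z"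
  by (simp_all flip: act_mult)

lemma act_0: "act m 0 = cb m / cnj (ca m)"
  by (simp add: act_def)

lemma act_flow_0: "act (flow t) 0 = of_real (tanh (t / 2))"
  by (simp add: act_0 ca_cb_flow tanh_def)

lemma act_rot: "act (rot t) z = cis (2 * t) * z"
proof -
  have "cis (2 * t) * cnj (cis t) = cis t"  by (simp add: cis_cnj cis_mult)
  then show ?thesis by (simp add: act_def field_simps)
qed

text \<open>Through \<open>v \<mapsto> v / cnj v\<close> the circle is the real projective line. The
  point \<open>1\<close> belongs to the first basis vector, so its image is read off the first
  column; in \<open>act_m1\<close> the second column appears, multiplied by
  \<open>- \<i>\<close>.\<close>

lemma act_1: "act m 1 = Complex (e11 m) (e21 m) / cnj (Complex (e11 m) (e21 m))"
  by (simp add: act_def add.commute flip: ca_plus_cb)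

lemma act_m1: "act m (-1) = - Complex (e22 m) (- e12 m) / cnj (Complex (e22 m) (- e12 m))"
  by (simp flip: ca_minus_cb add: act_def)

section \<open>Hyperbolic distance and unit speed geodesics\<close>

lemma hdisk_norm: "z \<in> hdisk \<longleftrightarrow> cmod z < 1"
  by (simp add: hdisk_def)

lemma zero_in_hdisk [simp]: "0 \<in> hdisk"
  by (simp add: hdisk_def)

lemma hdisk_cball: "z \<in> hdisk \<Longrightarrow> cmod z \<le> 1"
  by (simp add: hdisk_def)

lemma hdisk_square: "z \<in> hdisk \<Longrightarrow> 1 - (cmod z)\<^sup>2 > 0"
  by (simp add: hdisk_def abs_square_less_1)

lemma hdist_act:
  assumes "z \<in> hdisk" "w \<in> hdisk"
  shows "hdist (act m z) (act m w) = hdist z w"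
proof -
  define x y where "x = cmod (den m z)" and "y = cmod (den m w)"
  have xy: "x \<noteq> 0" "y \<noteq> 0"
    using assms den_nonzero by (auto simp: x_def y_def hdisk_cball)
  have "(cmod (act m z - act m w))\<^sup>2 = (cmod (z - w))\<^sup>2 / (x\<^sup>2 * y\<^sup>2)"
    using assms by (simp add: act_diff hdisk_cball norm_divide norm_mult power_divide power_mult_distrib x_def y_def)
  then show ?thesis
    using assms xy unfolding hdist_def
    by (simp add: act_norm hdisk_cball field_simps flip: x_def y_def)
qed

lemma hdist_commute: "hdist z w = hdist w z"
  unfolding hdist_def by (simp add: norm_minus_commute mult.commute)

lemma hdist_0: "hdist 0 w = arcosh (1 + 2 * (cmod w)\<^sup>2 / (1 - (cmod w)\<^sup>2))"
  by (simp add: hdist_def)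

lemma opnorm_cosh: "cosh (2 * ln (opnorm m)) = 1 + 2 * (cmod (cb m))\<^sup>2"
proof -
  have "2 * ln (opnorm m) = ln ((opnorm m)\<^sup>2)"
    by (simp add: ln_realpow less_imp_neq[symmetric])
  then have "cosh (2 * ln (opnorm m)) = ((opnorm m)\<^sup>2 + (1 / opnorm m)\<^sup>2) / 2"
    using opnorm_pos[of m] by (simp add: cosh_ln_real power_divide inverse_eq_divide del: opnorm_pos)
  also have "\<dots> = 1 + 2 * (cmod (cb m))\<^sup>2"
    using ca_cb_norm[of m] unfolding opnorm_diff[symmetric]
    by (simp add: opnorm_def power2_eq_square algebra_simps)
  finally show ?thesis .
qed

lemma act_0_norm: "(cmod (act m 0))\<^sup>2 = 1 - 1 / (cmod (ca m))\<^sup>2"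
  using ca_cb_norm[of m] by (simp add: act_0 norm_divide power_divide divide_simps)

lemma act_0_le:
  assumes "opnorm m \<le> R"
  shows "cmod (act m 0) \<le> sqrt (1 - 1 / R\<^sup>2)"
proof -
  have R: "R > 0" using assms opnorm_pos[of m] by linarith
  have "cmod (ca m) \<le> R" using assms norm_ge_zero[of "cb m"] unfolding opnorm_def by linarith
  then have "(cmod (ca m))\<^sup>2 \<le> R\<^sup>2" by (simp add: power_mono)
  then have "1 / R\<^sup>2 \<le> 1 / (cmod (ca m))\<^sup>2" using R by (intro divide_left_mono) auto
  then show ?thesis by (intro real_le_rsqrt) (simp add: act_0_norm)
qed

lemma opnorm_le_act_0:
  assumes "cmod (act m 0) \<le> r" "r < 1"
  shows "opnorm m \<le> 2 / sqrt (1 - r\<^sup>2)"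
proof -
  have r: "0 < 1 - r\<^sup>2"
    using assms order_trans[OF norm_ge_zero assms(1)] by (simp add: abs_square_less_1)
  have "(cmod (act m 0))\<^sup>2 \<le> r\<^sup>2" using assms(1) by (intro power_mono) auto
  then have "1 - r\<^sup>2 \<le> 1 / (cmod (ca m))\<^sup>2" by (simp add: act_0_norm)
  then have "(cmod (ca m))\<^sup>2 \<le> 1 / (1 - r\<^sup>2)" using r by (simp add: field_simps)
  then have "cmod (ca m) \<le> sqrt (1 / (1 - r\<^sup>2))" by (rule real_le_rsqrt)
  then show ?thesis
    using cb_less_ca[of m] by (simp add: opnorm_def real_sqrt_divide)
qed

lemma hdist_0_act: "hdist 0 (act m 0) = 2 * ln (opnorm m)"
proof -
  have n: "cmod (ca m) \<noteq> 0" by simp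
  have "(cmod (act m 0))\<^sup>2 = (cmod (cb m))\<^sup>2 / (cmod (ca m))\<^sup>2"
    by (simp add: act_0 norm_divide power_divide)
  moreover have "1 - (cmod (act m 0))\<^sup>2 = 1 / (cmod (ca m))\<^sup>2" by (simp add: act_0_norm)
  ultimately have "2 * (cmod (act m 0))\<^sup>2 / (1 - (cmod (act m 0))\<^sup>2) = 2 * (cmod (cb m))\<^sup>2"
    using n by simp
  then have "hdist 0 (act m 0) = arcosh (cosh (2 * ln (opnorm m)))"
    by (simp add: hdist_0 opnorm_cosh)
  then show ?thesis
    using opnorm_ge_1[of m] by (simp add: arcosh_cosh_real)
qed

lemma hdist_frames: "hdist (act M 0) (act M' 0) = 2 * ln (opnorm (inverse M * M'))"
proof -
  have "hdist (act M 0) (act M' 0) = hdist (act M 0) (act M (act (inverse M * M') 0))"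
    by (simp add: act_mult act_cball)
  also have "\<dots> = hdist 0 (act (inverse M * M') 0)"
    by (rule hdist_act) auto
  finally show ?thesis by (simp add: hdist_0_act)
qed

lemma tanh_half_surj:
  assumes "0 \<le> x" "x < (1 :: real)"
  obtains t where "x = tanh (t / 2)" "t \<ge> 0"
proof
  define t where "t = - ln ((1 - x) / (1 + x))"
  have "exp (- t) = (1 - x) / (1 + x)" using assms by (simp add: t_def)
  then have "x * (1 + exp (- t)) = 1 - exp (- t)" using assms by (simp add: field_simps)
  moreover have "1 + exp (- t) > 0" by (simp add: add_pos_pos)
  ultimately show "x = tanh (t / 2)" by (simp add: tanh_real_altdef eq_divide_eq)
  show "t \<ge> 0" using assms by (simp add: t_def)
qed

lemma rotate_to_positive:
  obtains t where "act (rot t) (of_real (cmod w)) = w"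
proof
  show "act (rot (Arg w / 2)) (of_real (cmod w)) = w"
    by (cases "w = 0") (auto simp: act_rot cis_Arg sgn_div_norm scaleR_conv_of_real)
qed

lemma frame_at:
  assumes "z \<in> hdisk"
  obtains M where "act M 0 = z"
proof -
  obtain t where t: "cmod z = tanh (t / 2)" "t \<ge> 0"
    using assms tanh_half_surj[of "cmod z"] by (auto simp: hdisk_norm)
  obtain \<theta> where \<theta>: "act (rot \<theta>) (of_real (cmod z)) = z" by (rule rotate_to_positive)
  have "act (flow t) 0 = of_real (cmod z)"
    using t by (simp add: act_flow_0)
  then have "act (rot \<theta> * flow t) 0 = z"
    using \<theta> by (simp add: act_mult)
  then show ?thesis by (rule that)
qed

lemma hdist_triangle:
  assumes "x \<in> hdisk" "y \<in> hdisk" "z \<in> hdisk"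
  shows "hdist x z \<le> hdist x y + hdist y z"
proof -
  obtain L M N where *: "x = act L 0" "y = act M 0" "z = act N 0"
    using assms frame_at by metis
  have "ln (opnorm (inverse L * N)) \<le> ln (opnorm (inverse L * M) * opnorm (inverse M * N))"
    using opnorm_mult[of "inverse L * M" "inverse M * N"]
    by (subst ln_le_cancel_iff) (auto simp: mult.assoc)
  then show ?thesis
    by (simp add: * hdist_frames ln_mult less_imp_neq[symmetric])
qed

lemma arcosh_inject: "1 \<le> x \<Longrightarrow> 1 \<le> y \<Longrightarrow> arcosh x = arcosh y \<longleftrightarrow> x = (y :: real)"
  by (metis cosh_arcosh_real)

lemma hdist_inject:
  assumes "z \<in> hdisk" "w \<in> hdisk" "z' \<in> hdisk" "w' \<in> hdisk" "hdist z w = hdist z' w'"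
  shows "(cmod (z - w))\<^sup>2 / ((1 - (cmod z)\<^sup>2) * (1 - (cmod w)\<^sup>2))
       = (cmod (z' - w'))\<^sup>2 / ((1 - (cmod z')\<^sup>2) * (1 - (cmod w')\<^sup>2))"
proof -
  define f where "f z w = (cmod (z - w))\<^sup>2 / ((1 - (cmod z)\<^sup>2) * (1 - (cmod w)\<^sup>2))" for z w
  have h: "hdist z w = arcosh (1 + 2 * f z w)" for z w by (simp add: hdist_def f_def)
  have "f z w \<ge> 0" "f z' w' \<ge> 0"
    using assms(1-4)[THEN hdisk_square] by (auto simp: f_def)
  then have "1 + 2 * f z w = 1 + 2 * f z' w'"
    using assms(5) arcosh_inject[of "1 + 2 * f z w" "1 + 2 * f z' w'"] unfolding h by linarith
  then show ?thesis by (simp add: f_def)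
qed

lemma hdist_0_inject:
  assumes "z \<in> hdisk" "w \<in> hdisk" "hdist 0 z = hdist 0 w"
  shows "cmod z = cmod w"
proof -
  have "(cmod z)\<^sup>2 / (1 - (cmod z)\<^sup>2) = (cmod w)\<^sup>2 / (1 - (cmod w)\<^sup>2)"
    using hdist_inject[OF _ assms(1) _ assms(2,3)] by simp
  then have "(cmod z)\<^sup>2 = (cmod w)\<^sup>2"
    using assms(1,2)[THEN hdisk_square] by (simp add: field_simps)
  then show ?thesis by simp
qed

text \<open>The distances to \<open>0\<close> and \<open>a\<close> determine a point up to the
  reflection in the line through \<open>0\<close> and \<open>a\<close>; the conclusion is what this
  reflection preserves.\<close>

lemma hdist_two_points:
  assumes "z \<in> hdisk" "w \<in> hdisk" "a \<in> hdisk"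
    and "hdist 0 z = hdist 0 w" "hdist a z = hdist a w"
  shows "cmod z = cmod w" "Re (z * cnj a) = Re (w * cnj a)"
proof -
  show n: "cmod z = cmod w" by (rule hdist_0_inject) fact+
  have "(cmod (a - z))\<^sup>2 = (cmod (a - w))\<^sup>2"
    using hdist_inject[OF assms(3,1,3,2,5)] assms(1-3)[THEN hdisk_square] by (simp add: n)
  then show "Re (z * cnj a) = Re (w * cnj a)"
    using arg_cong[OF n, of "\<lambda>x. x\<^sup>2"]
    unfolding cmod_power2 by (simp add: power2_eq_square algebra_simps)
qed

lemma two_point_frame:
  assumes "z \<in> hdisk" "w \<in> hdisk"
  obtains M where "act M 0 = z" "act M (of_real (tanh (hdist z w / 2))) = w"
proof -
  obtain M where M: "act M 0 = z" using assms frame_at by metis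
  define w' where "w' = act (inverse M) w"
  have w': "w' \<in> hdisk" "act M w' = w" using assms by (auto simp: w'_def hdisk_cball)
  obtain \<theta> where \<theta>: "act (rot \<theta>) (of_real (cmod w')) = w'" by (rule rotate_to_positive)
  have hd: "hdist z w = hdist 0 w'"
    using w' M hdist_act[of 0 w' M] by simp
  obtain t where t: "cmod w' = tanh (t / 2)" "t \<ge> 0"
    using w'(1) tanh_half_surj[of "cmod w'"] by (auto simp: hdisk_norm)
  have "hdist 0 w' = hdist 0 (act (flow t) 0)"
    using t by (simp add: hdist_0 act_flow_0)
  also have "\<dots> = t" using t by (simp add: hdist_0_act opnorm_flow)
  finally have *: "hdist z w = t" using hd by simp
  show ?thesis
  proof
    show "act (M * rot \<theta>) 0 = z" using M by (simp add: act_mult act_rot)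
    have "cmod (of_real (tanh (hdist z w / 2))) \<le> 1"
      using * t w'(1) by (simp add: hdisk_norm)
    then show "act (M * rot \<theta>) (of_real (tanh (hdist z w / 2))) = w"
      using * t w' \<theta> by (simp add: act_mult)
  qed
qed

section \<open>Frames and the geodesics that they carry\<close>

definition ends :: "sl2 \<Rightarrow> complex \<times> complex" where
  "ends M = (act M (-1), act M 1)"

lemma act_continuous: "continuous_on (cball 0 1) (act m)"
  unfolding act_def[abs_def]
  by (intro continuous_intros ballI) (use den_nonzero[of _ m] in \<open>auto simp: den_def\<close>)

lemma act_flow_pm1 [simp]: "act (flow t) 1 = 1" "act (flow t) (-1) = -1"
  by (auto simp: act_1 act_m1 complex_eq_iff complex_eq_cancel_iff2 complex_of_real_def[symmetric])

lemma ends_flow [simp]: "ends (M * flow t) = ends M"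
  by (simp add: ends_def act_mult)

lemma ends_geodesic: "ends M \<in> geodesics"
proof -
  have "act M (-1) - act M 1 \<noteq> 0"
    using den_nonzero[of 1 M] den_nonzero[of "-1" M] by (subst act_diff) auto
  moreover have "1 \<in> hcircle" "- 1 \<in> hcircle" by (auto simp: hcircle_def)
  ultimately show ?thesis by (auto simp: ends_def geodesics_def)
qed

lemma tanh_complex_at_top: "((\<lambda>t. complex_of_real (tanh (t / 2))) \<longlongrightarrow> 1) at_top"
proof -
  have "((\<lambda>t :: real. tanh (t / 2)) \<longlongrightarrow> 1) at_top"
    by (rule filterlim_compose[OF tanh_real_at_top]) real_asymp
  from tendsto_of_real[OF this] show ?thesis by simp
qed

lemma tanh_complex_at_bot: "((\<lambda>t. complex_of_real (tanh (t / 2))) \<longlongrightarrow> -1) at_bot"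
proof -
  have "((\<lambda>t :: real. tanh (t / 2)) \<longlongrightarrow> -1) at_bot"
    by (rule filterlim_compose[OF tanh_real_at_bot]) real_asymp
  from tendsto_of_real[OF this] show ?thesis by simp
qed

lemma cmod_tanh_less_1: "cmod (of_real (tanh t)) < 1"
  using tanh_real_abs[of t] tanh_real_lt_1[of "\<bar>t\<bar>"] by simp

lemma frame_unit_speed: "unit_speed_param (ends M) (\<lambda>t. act (M * flow t) 0)"
proof -
  have eq: "act (M * flow t) 0 = act M (of_real (tanh (t / 2)))" for t
    by (simp add: act_mult act_flow_0)
  have "((\<lambda>t. act M (of_real (tanh (t / 2)))) \<longlongrightarrow> act M (-1)) at_bot"
    by (rule continuous_on_tendsto_compose[OF act_continuous tanh_complex_at_bot])
      (auto simp: less_imp_le[OF cmod_tanh_less_1] simp del: norm_of_real)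
  moreover have "((\<lambda>t. act M (of_real (tanh (t / 2)))) \<longlongrightarrow> act M 1) at_top"
    by (rule continuous_on_tendsto_compose[OF act_continuous tanh_complex_at_top])
      (auto simp: less_imp_le[OF cmod_tanh_less_1] simp del: norm_of_real)
  moreover have "hdist (act (M * flow s) 0) (act (M * flow t) 0) = \<bar>s - t\<bar>" for s t
    by (simp add: hdist_frames mult.assoc flow_add opnorm_flow)
  ultimately show ?thesis
    by (auto simp: unit_speed_param_def ends_def simp flip: eq)
qed

text \<open>Choose a frame that matches \<open>c\<close> at the times \<open>0\<close> and
  \<open>1\<close>. Each \<open>c t\<close> has the same distances to these two points as the flow
  orbit, and as the orbit lies on the line through them, the reflection ambiguity disappears. From
  here on geodesics can be treated as flow orbits of matrices.\<close>

lemma unit_speed_param_iff: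
  "unit_speed_param \<alpha> c \<longleftrightarrow> (\<exists>M. ends M = \<alpha> \<and> c = (\<lambda>t. act (M * flow t) 0))"
proof
  assume u: "unit_speed_param \<alpha> c"
  then have r: "c t \<in> hdisk" and d: "hdist (c s) (c t) = \<bar>s - t\<bar>" for s t
    by (auto simp: unit_speed_param_def)
  obtain M where M: "act M 0 = c 0" "act M (of_real (tanh (hdist (c 0) (c 1) / 2))) = c 1"
    using two_point_frame[OF r r] by metis
  define a :: complex where "a = of_real (tanh (1 / 2))"
  have a: "act M a = c 1" "a \<in> hdisk" "a \<noteq> 0"
    using M(2) cmod_tanh_less_1[of "1 / 2"] by (auto simp: d a_def hdisk_norm simp del: norm_of_real)
  have c: "c t = act (M * flow t) 0" for t
  proof -
    define w where "w = act (inverse M) (c t)"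
    define w' where "w' = act (flow t) 0"
    have w: "w \<in> hdisk" "act M w = c t" using r by (auto simp: w_def hdisk_cball)
    have w': "w' \<in> hdisk" by (simp add: w'_def)
    have "hdist 0 w = hdist (c 0) (c t)" "hdist a w = hdist (c 1) (c t)"
      using hdist_act[of 0 w M] hdist_act[of a w M] w a M by auto
    moreover have "a = act (flow 1) 0" by (simp add: a_def act_flow_0)
    then have "hdist 0 w' = \<bar>t\<bar>" "hdist a w' = \<bar>1 - t\<bar>"
      using hdist_frames[of 1 "flow t"] hdist_frames[of "flow 1" "flow t"]
      by (auto simp: w'_def opnorm_flow flow_add)
    ultimately have eq: "cmod w = cmod w'" "Re (w * cnj a) = Re (w' * cnj a)"
      using hdist_two_points[OF w(1) w' a(2)] by (auto simp: d)
    from a eq(2) have "Re w = Re w'" by (auto simp: a_def)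
    moreover have "Im w' = 0" by (simp add: w'_def act_flow_0)
    ultimately have "Im w = 0" using arg_cong[OF eq(1), of "\<lambda>x. x\<^sup>2"] by (simp add: cmod_power2)
    with \<open>Re w = Re w'\<close> \<open>Im w' = 0\<close> have "w = w'" by (simp add: complex_eq_iff)
    then show ?thesis using w by (simp add: w'_def act_mult)
  qed
  then have "c = (\<lambda>t. act (M * flow t) 0)" by auto
  moreover from this u frame_unit_speed[of M] have "fst \<alpha> = fst (ends M)" "snd \<alpha> = snd (ends M)"
    unfolding unit_speed_param_def by (auto intro: tendsto_unique[rotated] simp: trivial_limit_at_bot_linorder trivial_limit_at_top_linorder)
  ultimately show "\<exists>M. ends M = \<alpha> \<and> c = (\<lambda>t. act (M * flow t) 0)"
    by (auto simp: prod_eq_iff)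
qed (auto simp: frame_unit_speed)

lemma geodesic_line_eq: "geodesic_line \<alpha> = {act M 0 | M. ends M = \<alpha>}"
proof -
  have "\<exists>N t. ends N = ends M \<and> act M 0 = act (N * flow t) 0" for M
    by (rule exI[of _ M], rule exI[of _ 0]) simp
  then show ?thesis
    by (force simp: geodesic_line_def unit_speed_param_iff)
qed

text \<open>Square roots of the two ends serve as columns, since \<open>v / cnj v = v * v\<close>
  for unit vectors. They are independent because the ends differ, and scaling the first column by
  \<open>1 / k\<close> makes the determinant \<open>1\<close>.\<close>

lemma frame_exists:
  assumes "\<alpha> \<in> geodesics"
  obtains M where "ends M = \<alpha>"
proof -
  define v w where "v = csqrt (snd \<alpha>)" and "w = \<i> * csqrt (fst \<alpha>)"
  have \<alpha>: "cmod (fst \<alpha>) = 1" "cmod (snd \<alpha>) = 1" "fst \<alpha> \<noteq> snd \<alpha>"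
    using assms by (auto simp: geodesics_def hcircle_def)
  have sq: "z / cnj z = z\<^sup>2" if "cmod z = 1" for z :: complex
    using that complex_norm_square[of z] by (auto simp: power2_eq_square divide_simps)
  have nv: "cmod v = 1" "cmod (csqrt (fst \<alpha>)) = 1" using \<alpha> by (auto simp: v_def)
  have v: "v / cnj v = snd \<alpha>" using sq[of v] nv by (simp add: v_def)
  have f: "csqrt (fst \<alpha>) / cnj (csqrt (fst \<alpha>)) = fst \<alpha>" using sq[of "csqrt (fst \<alpha>)"] nv by simp
  have w0: "w \<noteq> 0" using nv by (auto simp: w_def)
  have w: "w / cnj w = - fst \<alpha>" using f by (simp add: w_def)
  define k where "k = Re (v * cnj w)"
  have "k \<noteq> 0"
  proof
    assume "k = 0"
    then have "v * cnj w = - (cnj v * w)"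
      by (simp add: k_def complex_eq_iff)
    then have "v / cnj v = - (w / cnj w)"
      using nv w0 by (auto simp: divide_simps mult.commute)
    then show False using v w \<alpha> by simp
  qed
  then have "Re v / k * Re w - (- Im w) * (Im v / k) = 1"
    by (simp add: k_def divide_simps mult.commute)
  then obtain M where M: "e11 M = Re v / k" "e12 M = - Im w" "e21 M = Im v / k" "e22 M = Re w"
    by (rule sl2_exists)
  have "Complex (e11 M) (e21 M) = of_real (1 / k) * v" "Complex (e22 M) (- e12 M) = w"
    by (simp_all add: M complex_eq_iff)
  then have "act M 1 = v / cnj v" "act M (-1) = - (w / cnj w)"
    using \<open>k \<noteq> 0\<close> by (simp_all add: act_1 act_m1)
  then have "ends M = \<alpha>" by (simp add: ends_def v w)
  then show ?thesis by (rule that)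
qed

section \<open>Crossing geodesics and their angle\<close>

lemma act_has_field_derivative:
  assumes "cmod z \<le> 1"
  shows "(act m has_field_derivative 1 / (den m z)\<^sup>2) (at z)"
proof -
  have n: "den m z \<noteq> 0" by (rule den_nonzero) fact
  have "(act m has_field_derivative
      (ca m * den m z - (ca m * z + cb m) * cnj (cb m)) / (den m z * den m z)) (at z)"
    using n unfolding act_def[abs_def] den_def by (auto intro!: derivative_eq_intros)
  also have "ca m * den m z - (ca m * z + cb m) * cnj (cb m) = 1"
    using ca_cb_cnj[of m] by (simp add: den_def algebra_simps)
  finally show ?thesis by (simp add: power2_eq_square)
qed

text \<open>At \<open>0\<close> the map \<open>act M\<close> has derivative
  \<open>1 / (cnj (ca M))\<^sup>2\<close>, and the flow leaves \<open>0\<close> with Euclidean speed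
  \<open>1 / 2\<close>.\<close>

definition velocity :: "sl2 \<Rightarrow> complex" where
  "velocity M = 1 / (2 * (cnj (ca M))\<^sup>2)"

lemma frame_velocity:
  "vector_derivative (\<lambda>t. act (M * flow t) 0) (at s) = velocity (M * flow s)"
proof -
  define N where "N = M * flow s"
  have eq: "act (M * flow t) 0 = (act N \<circ> (\<lambda>t. of_real (tanh ((t - s) / 2)))) t" for t
  proof -
    have "M * flow t = N * flow (t - s)" by (simp add: N_def mult.assoc flow_add)
    then show ?thesis by (simp add: act_mult act_flow_0)
  qed
  have "((\<lambda>t. tanh ((t - s) / 2)) has_real_derivative 1 / 2) (at s)"
    by (rule derivative_eq_intros refl | simp)+
  then have "((\<lambda>t. complex_of_real (tanh ((t - s) / 2))) has_vector_derivative of_real (1 / 2)) (at s)"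
    by (rule has_vector_derivative_of_real)
  then have "((\<lambda>t. complex_of_real (tanh ((t - s) / 2))) has_vector_derivative 1 / 2) (at s)"
    by simp
  moreover have "(act N has_field_derivative 1 / (cnj (ca N))\<^sup>2) (at (complex_of_real (tanh ((s - s) / 2))))"
    using act_has_field_derivative[of 0 N] by (simp add: den_def)
  ultimately have "((act N \<circ> (\<lambda>t. of_real (tanh ((t - s) / 2)))) has_vector_derivative
      1 / 2 * (1 / (cnj (ca N))\<^sup>2)) (at s)"
    by (rule field_vector_diff_chain_at)
  then have "((\<lambda>t. act (M * flow t) 0) has_vector_derivative velocity N) (at s)"
    by (simp add: eq[abs_def] o_def velocity_def)
  then show ?thesis unfolding N_def by (rule vector_derivative_at)
qed

lemma cb_eq_0_iff: "cb Q = 0 \<longleftrightarrow> act Q 0 = 0"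
  by (simp add: act_0)

lemma inverse_act_eq_iff:
  assumes "cmod z \<le> 1" "cmod w \<le> 1"
  shows "act (inverse M * M') z = w \<longleftrightarrow> act M' z = act M w"
  by (metis act_cball act_inverse act_mult assms)

text \<open>Such frames differ by a sign only, and \<open>velocity\<close> is quadratic in
  \<open>ca\<close>.\<close>

lemma velocity_unique:
  assumes "ends M = ends M'" "act M 0 = act M' 0"
  shows "velocity M = velocity M'"
proof -
  define Q where "Q = inverse M * M'"
  have M': "M' = M * Q" by (simp add: Q_def)
  have b: "cb Q = 0"
    using assms(2) by (simp add: cb_eq_0_iff Q_def inverse_act_eq_iff)
  have "act Q 1 = 1"
    using assms(1) by (simp add: ends_def Q_def inverse_act_eq_iff)
  then have "ca Q = cnj (ca Q)" using b by (simp add: act_def)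
  moreover have "ca Q * cnj (ca Q) = 1" using ca_cb_cnj[of Q] b by simp
  ultimately have "(cnj (ca Q))\<^sup>2 = 1" by (simp add: power2_eq_square)
  then show ?thesis
    using b by (simp add: velocity_def M' ca_mult power_mult_distrib)
qed

text \<open>When the base points agree, \<open>inverse M * M'\<close> is a rotation matrix through
  some \<open>\<phi>\<close>. Then \<open>ca\<close> is \<open>cis \<phi>\<close>, while tangent
  vectors turn by \<open>2 * \<phi>\<close>; this is why the square of \<open>ca\<close>
  occurs.\<close>

lemma geodesic_angle_frames:
  assumes "act M 0 = act M' 0"
  shows "geodesic_angle (act M 0) (ends M) (ends M')
     = arccos \<bar>Re ((ca (inverse M * M'))\<^sup>2)\<bar>"
proof -
  define Q where "Q = inverse M * M'"
  have M': "M' = M * Q" by (simp add: Q_def)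
  have b: "cb Q = 0"
    using assms by (simp add: cb_eq_0_iff Q_def inverse_act_eq_iff)
  have u: "cmod (ca Q) = 1"
    using ca_cb_norm[of Q] b by (simp add: power2_eq_1_iff) (smt (verit) norm_ge_zero)
  define k where "k = 2 * (cmod (ca M))\<^sup>2"
  have k: "k > 0" by (simp add: k_def)
  have nv: "cmod (velocity M) = 1 / k" "cmod (velocity M') = 1 / k"
    using u b by (simp_all add: velocity_def k_def norm_divide norm_mult norm_power M' ca_mult)
  have "velocity M * cnj (velocity M') = (1 / of_real k)\<^sup>2 * (1 / (ca Q)\<^sup>2)"
    using b unfolding k_def of_real_mult of_real_power[symmetric] complex_norm_square
    by (simp add: velocity_def M' ca_mult power_mult_distrib field_simps)
  also have "1 / (ca Q)\<^sup>2 = (cnj (ca Q))\<^sup>2"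
    using u complex_norm_square[of "ca Q"] by (simp add: divide_simps power_mult_distrib[symmetric] mult.commute)
  finally have *: "velocity M * cnj (velocity M') = of_real ((1 / k)\<^sup>2) * (cnj (ca Q))\<^sup>2" by (simp add: power_divide)
  have "inner (velocity M) (velocity M') = Re (velocity M * cnj (velocity M'))"
    by (simp add: inner_complex_def)
  also have "\<dots> = (1 / k)\<^sup>2 * Re ((ca Q)\<^sup>2)"
    unfolding * by (simp add: Re_power2 del: of_real_power of_real_divide)
  finally have "\<bar>inner (velocity M) (velocity M')\<bar> = (1 / k)\<^sup>2 * \<bar>Re ((ca Q)\<^sup>2)\<bar>"
    by (simp add: abs_mult)
  then have ang: "\<bar>inner (velocity M) (velocity M')\<bar> / (norm (velocity M) * norm (velocity M')) = \<bar>Re ((ca Q)\<^sup>2)\<bar>"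
    using k by (simp add: nv power2_eq_square)
  show ?thesis unfolding geodesic_angle_def Q_def[symmetric]
  proof (rule the_equality)
    show "\<exists>b c s t. unit_speed_param (ends M) b \<and> unit_speed_param (ends M') c \<and>
       b s = act M 0 \<and> c t = act M 0 \<and>
        (let u = vector_derivative b (at s); v = vector_derivative c (at t)
         in arccos \<bar>Re ((ca Q)\<^sup>2)\<bar> = arccos (\<bar>inner u v\<bar> / (norm u * norm v)))"
      using assms
      by (intro exI[of _ "\<lambda>t. act (M * flow t) 0"] exI[of _ "\<lambda>t. act (M' * flow t) 0"] exI[of _ 0])
        (auto simp: frame_unit_speed frame_velocity ang)
  next
    fix \<theta>
    assume "\<exists>b c s t. unit_speed_param (ends M) b \<and> unit_speed_param (ends M') c \<and>
       b s = act M 0 \<and> c t = act M 0 \<and>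
        (let u = vector_derivative b (at s); v = vector_derivative c (at t)
         in \<theta> = arccos (\<bar>inner u v\<bar> / (norm u * norm v)))"
    then obtain L L' s t where L: "ends L = ends M"
        "ends L' = ends M'"
        "act (L * flow s) 0 = act M 0" "act (L' * flow t) 0 = act M' 0"
      and \<theta>: "\<theta> = arccos (\<bar>inner (velocity (L * flow s)) (velocity (L' * flow t))\<bar> /
           (norm (velocity (L * flow s)) * norm (velocity (L' * flow t))))"
      using assms unfolding unit_speed_param_iff Let_def
      by (elim exE conjE) (simp add: frame_velocity)
    have "velocity (L * flow s) = velocity M" "velocity (L' * flow t) = velocity M'"
      using L by (auto intro!: velocity_unique)
    then show "\<theta> = arccos \<bar>Re ((ca Q)\<^sup>2)\<bar>" using \<theta> ang by simp
  qed
qed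

text \<open>In terms of endpoints this is the cross ratio that equals \<open>sin\<^sup>2 (\<theta> / 2)\<close> when the
  geodesics of the two frames cross at an oriented angle \<open>\<theta>\<close>.\<close>

definition crossing :: "sl2 \<Rightarrow> sl2 \<Rightarrow> real" where
  "crossing M M' = - e12 (inverse M * M') * e21 (inverse M * M')"

lemma crossing_mult_left [simp]: "crossing (g * M) (g * M') = crossing M M'"
  by (simp only: crossing_def sl2_inverse mult.assoc)

text \<open>The products \<open>e11 * e22\<close> and \<open>e12 * e21\<close> are preserved, so
  \<open>crossing\<close> does not depend on the base points of the frames.\<close>

lemma flow_conj_entries:
  "e11 (flow s * (Q * flow t)) = exp ((s + t) / 2) * e11 Q"
  "e12 (flow s * (Q * flow t)) = exp ((s - t) / 2) * e12 Q"
  "e21 (flow s * (Q * flow t)) = exp ((t - s) / 2) * e21 Q"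
  "e22 (flow s * (Q * flow t)) = exp (- (s + t) / 2) * e22 Q"
proof -
  have *: "exp (x / 2) * (c * exp (y / 2)) = exp ((x + y) / 2) * c" for x y c :: real
    by (simp add: add_divide_distrib exp_add)
  show "e11 (flow s * (Q * flow t)) = exp ((s + t) / 2) * e11 Q"
    "e12 (flow s * (Q * flow t)) = exp ((s - t) / 2) * e12 Q"
    "e21 (flow s * (Q * flow t)) = exp ((t - s) / 2) * e21 Q"
    "e22 (flow s * (Q * flow t)) = exp (- (s + t) / 2) * e22 Q"
    using *[of s "e11 Q" t] *[of s "e12 Q" "- t"] *[of "- s" "e21 Q" t] *[of "- s" "e22 Q" "- t"]
    by (simp_all add: algebra_simps)
qed

lemma crossing_flow [simp]: "crossing (M * flow s) (M' * flow t) = crossing M M'"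
proof -
  have "crossing (M * flow s) (M' * flow t)
      = - (exp ((- s - t) / 2) * exp ((t + s) / 2)) * (e12 (inverse M * M') * e21 (inverse M * M'))"
    unfolding crossing_def sl2_inverse inverse_flow mult.assoc[of "flow (- s)"]
      mult.assoc[of "inverse M" M', symmetric]
    using flow_conj_entries(2,3)[of "- s" "inverse M * M'" t]
    by (simp only: mult.assoc) (simp add: algebra_simps)
  moreover have "exp ((- s - t) / 2) * exp ((t + s) / 2) = 1"
    unfolding exp_add[symmetric] add_divide_distrib[symmetric] by simp
  ultimately show ?thesis by (simp only: crossing_def)
qed

text \<open>As \<open>e11 * e22\<close> and \<open>- e12 * e21\<close> are both positive, flows on
  the two sides can make the diagonal entries equal and the other two opposite. The relative matrix
  is then a rotation, which means that the base points coincide.\<close>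

lemma crossing_frames:
  assumes "0 < crossing M M'" "crossing M M' < 1"
  obtains s t where "act (M * flow s) 0 = act (M' * flow t) 0"
    "Re ((ca (inverse (M * flow s) * (M' * flow t)))\<^sup>2) = 1 - 2 * crossing M M'"
proof -
  define Q where "Q = inverse M * M'"
  define p q r s where "p = e11 Q" and "q = e12 Q" and "r = e21 Q" and "s = e22 Q"
  have X: "crossing M M' = - q * r" by (simp add: crossing_def Q_def q_def r_def)
  have det: "p * s - q * r = 1" using sl2_det[of Q] by (simp add: p_def q_def r_def s_def)
  have qr: "q \<noteq> 0" "r \<noteq> 0" "- q / r > 0" 
    using assms X by (auto simp: divide_simps mult_less_0_iff zero_less_mult_iff)
  have "p * s > 0" using assms X det by simp
  then have ps: "p \<noteq> 0" "s \<noteq> 0" "s / p > 0" by (auto simp: zero_less_mult_iff divide_simps)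
  \<comment> \<open>\<open>x\<close> and \<open>y\<close> solve \<open>x + y = a\<close> and
    \<open>y - x = b\<close>; \<open>exp a\<close> and \<open>exp b\<close> are the ratios that
    balance the off-diagonal and the diagonal entries.\<close>
  define a where "a = ln (- q / r)"
  define b where "b = ln (s / p)"
  define x y where "x = (a - b) / 2" and "y = (a + b) / 2"
  define Q' where "Q' = inverse (M * flow x) * (M' * flow y)"
  have Q': "Q' = flow (- x) * (Q * flow y)" by (simp add: Q'_def Q_def mult.assoc)
  have e: "e11 Q' = exp (b / 2) * p" "e12 Q' = exp (- (a / 2)) * q"
      "e21 Q' = exp (a / 2) * r" "e22 Q' = exp (- (b / 2)) * s"
  proof -
    have "- x + y = b" "- x - y = - a" "y - - x = a"
      by (simp_all add: x_def y_def diff_divide_distrib add_divide_distrib)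
    then have "(- x + y) / 2 = b / 2" "(- x - y) / 2 = - (a / 2)" "(y - - x) / 2 = a / 2"
      "- (- x + y) / 2 = - (b / 2)"
      by simp_all
    then show "e11 Q' = exp (b / 2) * p" "e12 Q' = exp (- (a / 2)) * q"
      "e21 Q' = exp (a / 2) * r" "e22 Q' = exp (- (b / 2)) * s"
      unfolding Q' flow_conj_entries p_def q_def r_def s_def by simp_all
  qed
  have "exp (b / 2) * exp (b / 2) = s / p" "exp (a / 2) * exp (a / 2) = - q / r"
    using ps qr by (simp_all add: a_def b_def flip: exp_add)
  then have sym: "e22 Q' = e11 Q'" "e12 Q' = - e21 Q'"
    using ps(1) qr(2) unfolding e exp_minus by (auto simp: field_simps)
  have b0: "cb Q' = 0" using sym by (simp add: cb_def complex_eq_iff)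
  have "- e12 Q' * e21 Q' = - q * r" by (simp add: e exp_minus)
  then have sq: "(e21 Q')\<^sup>2 = - q * r" using sym by (simp add: power2_eq_square)
  have "(e11 Q')\<^sup>2 = 1 - (e21 Q')\<^sup>2" using sl2_det[of Q'] sym by (simp add: power2_eq_square)
  then have "Re ((ca Q')\<^sup>2) = 1 - 2 * (e21 Q')\<^sup>2"
    using sym by (simp add: Re_power2 ca_def)
  moreover have "act (M * flow x) 0 = act (M' * flow y) 0"
    using b0 by (simp add: cb_eq_0_iff Q'_def inverse_act_eq_iff del: sl2_inverse)
  ultimately show ?thesis
    using sq that[of x y] unfolding X Q'_def by simp
qed

text \<open>Fixing \<open>1\<close> and \<open>-1\<close> forces the relative matrix to be
  \<open>diag(p, 1 / p)\<close>. As \<open>p\<close> may be negative, the flow time is the logarithm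
  of its square.\<close>

lemma same_ends:
  assumes "ends M = ends N"
  obtains t where "act N 0 = act (M * flow t) 0"
proof -
  define Q where "Q = inverse M * N"
  have N: "N = M * Q" by (simp add: Q_def)
  have det: "e11 Q * e22 Q - e12 Q * e21 Q = 1" by (rule sl2_det)
  have "act Q 1 = 1" "act Q (-1) = -1"
    using assms by (simp_all add: ends_def Q_def inverse_act_eq_iff)
  moreover have "Im z = 0" if "z / cnj z = 1" for z
  proof -
    have "z = cnj z" using that by (cases "z = 0") auto
    then show ?thesis by (simp add: complex_eq_iff)
  qed
  note this[of "Complex (e11 Q) (e21 Q)"] this[of "Complex (e22 Q) (- e12 Q)"]
  ultimately have "e21 Q = 0" "e12 Q = 0"
    unfolding act_1 act_m1 by simp_all
  then have ps: "e11 Q * e22 Q = 1" and "cb Q = of_real ((e11 Q - e22 Q) / 2)"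
      "ca Q = of_real ((e11 Q + e22 Q) / 2)"
    using det by (auto simp: ca_def cb_def complex_eq_iff)
  then have Q: "act Q 0 = of_real ((e11 Q - e22 Q) / (e11 Q + e22 Q))"
  proof -
    have "x / 2 / (y / 2) = x / y" for x y :: real by simp
    then show ?thesis
      by (simp only: act_0 \<open>cb Q = _\<close> \<open>ca Q = _\<close> complex_cnj_complex_of_real of_real_divide[symmetric])
  qed
  define t where "t = ln ((e11 Q)\<^sup>2)"
  have p0: "e11 Q \<noteq> 0" using ps by auto
  have e: "exp t = (e11 Q)\<^sup>2" using p0 by (simp add: t_def)
  have s: "e22 Q = 1 / e11 Q" using ps p0 by (simp add: field_simps)
  have "(e11 Q - e22 Q) / (e11 Q + e22 Q) = ((e11 Q)\<^sup>2 - 1) / ((e11 Q)\<^sup>2 + 1)"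
    unfolding s using p0 by (simp add: divide_simps power2_eq_square)
  also have "\<dots> = tanh (t / 2)"
    using p0 by (simp add: tanh_real_altdef exp_minus e divide_simps)
  finally have "act N 0 = act (M * flow t) 0"
    by (simp add: N act_mult act_cball Q act_flow_0)
  then show ?thesis by (rule that)
qed

text \<open>If the lines agreed as sets, the point one unit along \<open>M'\<close> would lie on the
  line of \<open>M\<close>, which seen from \<open>M\<close> is the real diameter. Then
  \<open>(ca Q)\<^sup>2\<close> would be real and of modulus \<open>1\<close>, against the
  assumption.\<close>

lemma geodesic_lines_distinct:
  assumes "act M 0 = act M' 0" "\<bar>Re ((ca (inverse M * M'))\<^sup>2)\<bar> < 1"
  shows "geodesic_line (ends M) \<noteq> geodesic_line (ends M')"
proof
  assume "geodesic_line (ends M) = geodesic_line (ends M')"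
  moreover have "act (M' * flow 1) 0 \<in> geodesic_line (ends M')"
    unfolding geodesic_line_eq using ends_flow by blast
  ultimately have "act (M' * flow 1) 0 \<in> geodesic_line (ends M)" by simp
  then obtain N where N: "ends M = ends N" "act N 0 = act (M' * flow 1) 0"
    unfolding geodesic_line_eq by (smt (verit) mem_Collect_eq)
  obtain t where "act N 0 = act (M * flow t) 0" by (rule same_ends[OF N(1)])
  then have "act (M' * flow 1) 0 = act (M * flow t) 0" by (simp add: N)
  then have eq: "act M' (of_real (tanh (1 / 2))) = act M (of_real (tanh (t / 2)))"
    by (simp add: act_mult act_flow_0)
  define Q where "Q = inverse M * M'"
  have b: "cb Q = 0"
    using assms by (simp add: cb_eq_0_iff Q_def inverse_act_eq_iff)
  have "act Q (of_real (tanh (1 / 2))) = of_real (tanh (t / 2))"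
    using eq cmod_tanh_less_1 unfolding Q_def by (subst inverse_act_eq_iff) (auto intro: less_imp_le simp del: norm_of_real)
  then have "ca Q * of_real (tanh (1 / 2)) * (1 / cnj (ca Q)) = of_real (tanh (t / 2))"
    using b by (simp add: act_def)
  moreover have u: "ca Q * cnj (ca Q) = 1" using ca_cb_cnj[of Q] b by simp
  then have "1 / cnj (ca Q) = ca Q" by (metis nonzero_eq_divide_eq mult_zero_right zero_neq_one)
  ultimately have "(ca Q)\<^sup>2 * of_real (tanh (1 / 2)) = of_real (tanh (t / 2))"
    by (simp only: power2_eq_square mult_ac)
  then have "Im ((ca Q)\<^sup>2 * of_real (tanh (1 / 2))) = 0" by simp
  then have "Im ((ca Q)\<^sup>2) = 0" by simp
  moreover have "cmod ((ca Q)\<^sup>2) = 1"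
    using arg_cong[OF u, of cmod] by (simp add: norm_mult norm_power power2_eq_square)
  ultimately have "\<bar>Re ((ca Q)\<^sup>2)\<bar> = 1" by (simp add: cmod_eq_Re)
  then show False using assms(2) by (simp add: Q_def)
qed

lemma angle_of_crossing:
  assumes "0 < crossing M M'" "crossing M M' < 1"
  obtains p where "p \<in> geodesic_line (ends M) \<inter> geodesic_line (ends M')"
    "geodesic_line (ends M') \<noteq> geodesic_line (ends M)"
    "geodesic_angle p (ends M) (ends M') = arccos \<bar>1 - 2 * crossing M M'\<bar>"
proof -
  obtain s t where st: "act (M * flow s) 0 = act (M' * flow t) 0"
    "Re ((ca (inverse (M * flow s) * (M' * flow t)))\<^sup>2) = 1 - 2 * crossing M M'"
    using crossing_frames[OF assms] .
  show ?thesis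
  proof
    show "act (M * flow s) 0 \<in> geodesic_line (ends M) \<inter> geodesic_line (ends M')"
      unfolding geodesic_line_eq using ends_flow st(1) by blast
    show "geodesic_angle (act (M * flow s) 0) (ends M) (ends M') = arccos \<bar>1 - 2 * crossing M M'\<bar>"
      using geodesic_angle_frames[OF st(1)] st(2) by simp
    show "geodesic_line (ends M') \<noteq> geodesic_line (ends M)"
      using geodesic_lines_distinct[OF st(1)] st(2) assms by (simp add: abs_less_iff del: sl2_inverse)
  qed
qed

section \<open>The deck group as a group of matrices\<close>

lemma has_derivative_act_cnj:
  "((\<lambda>z. act M (cnj z)) has_derivative (\<lambda>h. 1 / (den M 0)\<^sup>2 * cnj h)) (at 0)"
proof -
  have "(act M has_derivative (*) (1 / (den M 0)\<^sup>2)) (at (cnj 0))"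
    using act_has_field_derivative[of 0 M] by (simp add: has_field_derivative_def)
  moreover have "(cnj has_derivative cnj) (at 0)"
    by (rule bounded_linear_imp_has_derivative[OF bounded_linear_cnj])
  ultimately show ?thesis by (rule has_derivative_compose[rotated])
qed

text \<open>After composition with a frame the isometry fixes \<open>0\<close> and a real point
  \<open>a\<close>, so it preserves moduli and real parts. The test point \<open>\<i> / 2\<close> is
  then fixed or conjugated, and this decides between identity and conjugation everywhere;
  conjugation has negative Jacobian.\<close>

lemma orientation_preserving_isometry_act:
  assumes "orientation_preserving_isometry g"
  obtains m where "g = restrict (act m) hdisk"
proof -
  have gB: "g \<in> Bij hdisk" and iso: "\<And>z w. z \<in> hdisk \<Longrightarrow> w \<in> hdisk \<Longrightarrow> hdist (g z) (g w) = hdist z w"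
    and ex: "\<exists>A. (g has_derivative A) (at 0) \<and> Re (A 1) * Im (A \<i>) - Im (A 1) * Re (A \<i>) > 0"
    using assms by (auto simp: orientation_preserving_isometry_def)
  have gd: "g z \<in> hdisk" if "z \<in> hdisk" for z
    using Bij_imp_funcset[OF gB] that by auto
  define a :: complex where "a = of_real (tanh (1 / 2))"
  have a: "a \<in> hdisk" "a \<noteq> 0" "hdist 0 a = 1"
    using cmod_tanh_less_1[of "1 / 2"] hdist_0_act[of "flow 1"]
    by (auto simp: a_def hdisk_norm act_flow_0 opnorm_flow simp del: norm_of_real)
  obtain M where M: "act M 0 = g 0" "act M a = g a"
    using two_point_frame[OF gd gd, of 0 a] a iso[of 0 a] by (auto simp: a_def)
  define f where "f z = act (inverse M) (g z)" for z
  have fd: "f z \<in> hdisk" and gf: "g z = act M (f z)" if "z \<in> hdisk" for z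
    using gd[OF that] by (auto simp: f_def hdisk_cball)
  have fiso: "hdist (f z) (f w) = hdist z w" if "z \<in> hdisk" "w \<in> hdisk" for z w
    using that gd by (simp add: f_def hdist_act iso)
  have f0: "f 0 = 0" "f a = a" using M a by (simp_all add: f_def hdisk_cball flip: M)
  have f1: "cmod (f z) = cmod z" "Re (f z) = Re z" if z: "z \<in> hdisk" for z
  proof -
    have h: "hdist 0 (f z) = hdist 0 z" "hdist a (f z) = hdist a z"
      using fiso[of 0 z] fiso[of a z] a f0 z by auto
    show "cmod (f z) = cmod z" "Re (f z) = Re z"
      using hdist_two_points[OF fd[OF z] z a(1) h] a by (auto simp: a_def)
  qed
  define b :: complex where "b = \<i> / 2"
  have b: "b \<in> hdisk" "cnj b \<in> hdisk" by (auto simp: b_def hdisk_norm norm_divide)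
  have "(Im (f b))\<^sup>2 = (Im b)\<^sup>2"
    using f1[OF b(1)] unfolding cmod_power2 by (metis add_left_cancel cmod_power2)
  then consider "f b = b" | "f b = cnj b"
    using f1(2)[OF b(1)] by (auto simp: complex_eq_iff power2_eq_iff)
  then show ?thesis
  proof cases
    case 1
    have "g z = act M z" if z: "z \<in> hdisk" for z
    proof -
      have h: "hdist 0 (f z) = hdist 0 z" "hdist b (f z) = hdist b z"
        using fiso[of 0 z] fiso[of b z] b f0 z 1 by auto
      have "Im (f z) = Im z"
        using hdist_two_points(2)[OF fd[OF z] z b(1) h] by (auto simp: b_def)
      then show ?thesis using f1(2)[OF z] gf[OF z] by (metis complex_eq_iff)
    qed
    then have "g = restrict (act M) hdisk"
      using Bij_imp_extensional[OF gB] by (auto simp: extensional_def)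
    then show ?thesis by (rule that)
  next
    case 2
    have eq: "g z = act M (cnj z)" if z: "z \<in> hdisk" for z
    proof -
      have z': "cnj z \<in> hdisk" using z by (simp add: hdisk_norm)
      have hc: "hdist (cnj v) (cnj w) = hdist v w" for v w
        unfolding hdist_def by (simp flip: complex_cnj_diff)
      have h: "hdist 0 (f z) = hdist 0 (cnj z)" "hdist (cnj b) (f z) = hdist (cnj b) (cnj z)"
        using fiso[of 0 z] fiso[of b z] b f0 z 2 hc[of 0 z] by (auto simp: hc)
      have "Im (f z) = Im (cnj z)"
        using hdist_two_points(2)[OF fd[OF z] z' b(2) h] by (auto simp: b_def)
      then show ?thesis using f1(2)[OF z] gf[OF z] by (metis complex_eq_iff cnj.sel(1))
    qed
    define d where "d = 1 / (den M 0)\<^sup>2"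
    obtain A where A: "(g has_derivative A) (at 0)" "Re (A 1) * Im (A \<i>) - Im (A 1) * Re (A \<i>) > 0"
      using ex by blast
    have "(g has_derivative (\<lambda>h. d * cnj h)) (at 0)"
      unfolding d_def
      by (rule has_derivative_transform_within_open[OF has_derivative_act_cnj, of hdisk]) (auto simp: eq hdisk_def)
    then have "A = (\<lambda>h. d * cnj h)" using A(1) has_derivative_unique by blast
    then have "Re (A 1) * Im (A \<i>) - Im (A 1) * Re (A \<i>) = - (Re d * Re d + Im d * Im d)"
      by simp
    also have "\<dots> \<le> 0" by simp
    finally show ?thesis using A(2) by simp
  qed
qed

text \<open>\<open>rot pi\<close> is the matrix \<open>- 1\<close>, the only other matrix that acts
  trivially.\<close>

lemma trivial_act:
  assumes "act Q 0 = 0" "act Q (1 / 2) = 1 / 2"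
  shows "Q = 1 \<or> Q = rot pi"
proof -
  have b: "cb Q = 0" using assms(1) by (simp add: cb_eq_0_iff)
  have u: "ca Q * cnj (ca Q) = 1" using ca_cb_cnj[of Q] b by simp
  have "ca Q = cnj (ca Q)" using assms(2) b by (simp add: act_def)
  then have "ca Q * ca Q = 1" using u by simp
  then have "ca Q = 1 \<or> ca Q = -1" by (simp add: square_eq_1_iff)
  then show ?thesis
    using b by (auto intro!: sl2_eqI simp: ca_def cb_def complex_eq_iff)
qed

lemma boundary_map_act:
  assumes "\<xi> \<in> hcircle"
  shows "boundary_map (restrict (act m) hdisk) \<xi> = act m \<xi>"
proof -
  have "\<xi> islimpt hdisk" using assms by (simp add: hdisk_def islimpt_ball hcircle_def)
  then have nt: "\<not> trivial_limit (at \<xi> within hdisk)" by (simp add: trivial_limit_within)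
  have "(act m \<longlongrightarrow> act m \<xi>) (at \<xi> within cball 0 1)"
    using act_continuous[of m] assms by (auto simp: continuous_on_def hcircle_def)
  then have "(act m \<longlongrightarrow> act m \<xi>) (at \<xi> within hdisk)"
    by (rule tendsto_within_subset) (auto simp: hdisk_def)
  then have "(restrict (act m) hdisk \<longlongrightarrow> act m \<xi>) (at \<xi> within hdisk)"
    by (rule Lim_transform_within[of _ _ _ _ 1]) auto
  then show ?thesis unfolding boundary_map_def using nt by (intro tendsto_Lim)
qed

lemma geodesic_act_frame:
  "geodesic_act (restrict (act m) hdisk) (ends M) = ends (m * M)"
proof -
  have "1 \<in> hcircle" "-1 \<in> hcircle" by (auto simp: hcircle_def)
  then show ?thesis by (simp add: geodesic_act_def ends_def boundary_map_act act_mult)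
qed

locale surface_group =
  fixes \<Gamma> :: "(complex \<Rightarrow> complex) set"
  assumes surface: "closed_hyperbolic_surface \<Gamma>"
begin

text \<open>The full preimage of the deck group, thus closed under sign change. Triviality of a deck
  transformation therefore reads \<open>m \<in> {1, rot pi}\<close>.\<close>

definition G :: "sl2 set" where
  "G = {m. restrict (act m) hdisk \<in> \<Gamma>}"

lemma Gamma_eq: "\<Gamma> = (\<lambda>m. restrict (act m) hdisk) ` G"
proof -
  have "\<exists>m\<in>G. g = restrict (act m) hdisk" if "g \<in> \<Gamma>" for g
    using surface orientation_preserving_isometry_act[of g] that
    unfolding closed_hyperbolic_surface_def G_def by (metis mem_Collect_eq)
  then show ?thesis by (auto simp: G_def)
qed

lemma subgroup_Gamma: "subgroup \<Gamma> (BijGroup hdisk)"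
  using surface by (simp add: closed_hyperbolic_surface_def)

lemma restrict_act_Bij: "m \<in> G \<Longrightarrow> restrict (act m) hdisk \<in> Bij hdisk"
  using subgroup.subset[OF subgroup_Gamma] by (auto simp: G_def BijGroup_def)

lemma one_G [simp]: "1 \<in> G"
  using subgroup.one_closed[OF subgroup_Gamma] by (simp add: G_def BijGroup_def restrict_def cong: if_cong)

lemma compose_act:
  "compose hdisk (restrict (act m) hdisk) (restrict (act n) hdisk) = restrict (act (m * n)) hdisk"
  by (auto simp: compose_def act_mult hdisk_cball fun_eq_iff)

lemma mult_G [simp]: "m \<in> G \<Longrightarrow> n \<in> G \<Longrightarrow> m * n \<in> G"
  using subgroup.m_closed[OF subgroup_Gamma, of "restrict (act m) hdisk" "restrict (act n) hdisk"]
    restrict_act_Bij[of m] restrict_act_Bij[of n]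
  by (simp add: G_def BijGroup_def compose_act)

lemma inverse_G [simp]:
  assumes "m \<in> G"
  shows "inverse m \<in> G"
proof -
  interpret B: group "BijGroup hdisk" by (rule group_BijGroup)
  let ?r = "\<lambda>m. restrict (act m) hdisk"
  have Bij: "?r (inverse m) \<in> Bij hdisk"
  proof -
    have "bij_betw (?r (inverse m)) hdisk hdisk"
      by (rule bij_betwI[where g = "act m"]) (auto simp: hdisk_cball)
    then show ?thesis by (simp add: Bij_def)
  qed
  have "inv\<^bsub>BijGroup hdisk\<^esub> ?r m = ?r (inverse m)"
    using Bij restrict_act_Bij[OF assms]
    by (intro B.inv_equality) (auto simp: BijGroup_def compose_act)
  then show ?thesis
    using subgroup.m_inv_closed[OF subgroup_Gamma, of "?r m"] assms by (simp add: G_def)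
qed

text \<open>The norm bound keeps \<open>act m 0\<close> in a fixed compact disk about
  \<open>0\<close>, so this disk meets its image. Proper discontinuity leaves finitely many deck
  transformations, each with at most two matrices.\<close>

lemma finite_G: "finite {m \<in> G. opnorm m \<le> R}"
proof -
  let ?r = "\<lambda>m. restrict (act m) hdisk"
  define k where "k = sqrt (1 - 1 / R\<^sup>2)"
  define F where "F = {g \<in> \<Gamma>. g ` cball 0 k \<inter> cball 0 k \<noteq> {}}"
  have fiber: "finite {m. ?r m = g}" for g
  proof (cases "\<exists>m. ?r m = g")
    case True
    then obtain m where m: "?r m = g" by blast
    have "n = m \<or> n = m * rot pi" if n: "?r n = g" for n
    proof -
      have eq: "act m z = act n z" if "z \<in> hdisk" for z
      proof -
        have "?r m z = ?r n z" by (simp only: m n)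
        then show ?thesis using that by simp
      qed
      have "act (inverse m * n) 0 = 0" "act (inverse m * n) (1 / 2) = 1 / 2"
        by (subst inverse_act_eq_iff; simp add: eq hdisk_norm norm_divide)+
      then have "inverse m * n = 1 \<or> inverse m * n = rot pi" by (rule trivial_act)
      then show ?thesis by (metis mult.right_neutral sl2_inverse(4))
    qed
    then have "{m. ?r m = g} \<subseteq> {m, m * rot pi}" by blast
    then show ?thesis by (rule finite_subset) simp
  qed auto
  show ?thesis
  proof (cases "R \<ge> 1")
    case True
    have k: "0 \<le> k" "k < 1" using True by (auto simp: k_def)
    have "compact (cball (0 :: complex) k)" "cball 0 k \<subseteq> hdisk" using k by (auto simp: hdisk_norm)
    then have fin: "finite F"
      using surface unfolding closed_hyperbolic_surface_def F_def by blast
    have "?r m \<in> F" if m: "m \<in> G" "opnorm m \<le> R" for m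
    proof -
      have "cmod (act m 0) \<le> k" unfolding k_def by (rule act_0_le[OF m(2)])
      then have "?r m 0 \<in> ?r m ` cball 0 k \<inter> cball 0 k" using k by auto
      then show ?thesis using m(1) by (auto simp: F_def G_def)
    qed
    then have "{m \<in> G. opnorm m \<le> R} \<subseteq> (\<Union>g\<in>F. {m. ?r m = g})" by blast
    then show ?thesis by (rule finite_subset) (use fin fiber in auto)
  next
    case False
    then have "{m \<in> G. opnorm m \<le> R} = {}" using opnorm_ge_1 by (auto simp: not_le intro: less_le_trans)
    then show ?thesis by (metis finite.emptyI)
  qed
qed

text \<open>Cocompactness in terms of frames. Only the base point has to be brought back: the
  direction costs nothing, as rotations have norm \<open>1\<close>.\<close>

lemma cocompact_G:
  obtains \<rho> where "\<rho> \<ge> 1" "\<And>M. \<exists>m\<in>G. opnorm (inverse m * M) \<le> \<rho>"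
proof -
  obtain K where K: "compact K" "K \<subseteq> hdisk" "(\<Union>g\<in>\<Gamma>. g ` K) = hdisk"
    using surface by (auto simp: closed_hyperbolic_surface_def)
  have "K \<noteq> {}" using K(3) zero_in_hdisk by blast
  then obtain w where w: "w \<in> K" "\<And>z. z \<in> K \<Longrightarrow> cmod z \<le> cmod w"
    using continuous_attains_sup[OF K(1) _ continuous_on_norm_id] by blast
  define r where "r = cmod w"
  have r: "0 \<le> r" "r < 1" using w(1) K(2) by (simp_all add: r_def flip: hdisk_norm) blast
  then have r2: "0 < 1 - r\<^sup>2" "1 - r\<^sup>2 \<le> 1" by (simp_all add: abs_square_less_1)
  define \<rho> where "\<rho> = 2 / sqrt (1 - r\<^sup>2)"
  show ?thesis
  proof
    have s: "sqrt (1 - r\<^sup>2) \<le> 1" "0 < sqrt (1 - r\<^sup>2)" using r2 by simp_all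
    have "1 = sqrt (1 - r\<^sup>2) / sqrt (1 - r\<^sup>2)" using s(2) by (metis divide_self_if less_irrefl)
    also have "\<dots> \<le> 2 / sqrt (1 - r\<^sup>2)"
      by (rule divide_right_mono) (use s in linarith)+
    finally show "\<rho> \<ge> 1" by (simp only: \<rho>_def)
    fix M
    have "act M 0 \<in> (\<Union>g\<in>\<Gamma>. g ` K)" using K(3) by simp
    then obtain g z where g: "g \<in> \<Gamma>" "z \<in> K" "act M 0 = g z" by blast
    from g(1) obtain m where "m \<in> G" "g = restrict (act m) hdisk" using Gamma_eq by blast
    with g K(2) have m: "m \<in> G" "z \<in> K" "act M 0 = act m z" by (simp_all add: subset_iff)
    define Q where "Q = inverse m * M"
    have "cmod (act Q 0) \<le> r"
      using m K(2) w(2) by (simp add: Q_def act_mult hdisk_cball subset_iff r_def)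
    then have "opnorm Q \<le> \<rho>" unfolding \<rho>_def using r(2) by (rule opnorm_le_act_0)
    then show "\<exists>m\<in>G. opnorm (inverse m * M) \<le> \<rho>" using m(1) Q_def by blast
  qed
qed

lemma G_fixed_point:
  assumes "m \<in> G" "z \<in> hdisk" "act m z = z"
  shows "m = 1 \<or> m = rot pi"
proof -
  have "restrict (act m) hdisk = \<one>\<^bsub>BijGroup hdisk\<^esub>"
    using surface assms unfolding closed_hyperbolic_surface_def G_def by auto
  then have eq: "restrict (act m) hdisk = (\<lambda>x\<in>hdisk. x)" by (simp only: BijGroup_def monoid.simps)
  have "act m w = w" if "w \<in> hdisk" for w
    using fun_cong[OF eq, of w] that by (simp only: restrict_apply if_True)
  then show ?thesis by (intro trivial_act) (auto simp: hdisk_norm)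
qed

end

section \<open>Squeezing nearly parallel geodesics\<close>

text \<open>\<open>e21 (rel M N)\<close> is the determinant of the two first columns, and
  \<open>e12 (rel M N)\<close> is minus that of the second columns. They vanish exactly when the
  forward, respectively backward, ends agree.\<close>

definition rel :: "sl2 \<Rightarrow> sl2 \<Rightarrow> sl2" where
  "rel M N = inverse M * N"

lemma rel_left [simp]: "rel (g * M) (g * N) = rel M N"
  by (simp only: rel_def sl2_inverse mult.assoc)

lemma rel_self [simp]: "rel M M = 1"
  by (simp add: rel_def)

lemma rel_mult: "rel M N = inverse (rel L M) * rel L N"
  by (simp add: rel_def mult.assoc)

lemma rel_swap: "\<bar>e21 (rel M N)\<bar> = \<bar>e21 (rel N M)\<bar>"
  using sl2_entries_inverse(3)[of "rel N M"] by (simp add: rel_def abs_minus_commute mult.commute)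

lemma crossing_rel: "crossing M N = - e12 (rel M N) * e21 (rel M N)"
  by (simp add: crossing_def rel_def)

lemma opnorm_rel: "opnorm M \<le> R \<Longrightarrow> opnorm N \<le> R' \<Longrightarrow> opnorm (rel M N) \<le> R * R'"
  unfolding rel_def by (intro opnorm_mult_le) auto

text \<open>Under the simultaneous flow one off-diagonal entry expands by \<open>exp t\<close> and
  the other contracts by \<open>exp (- t)\<close>; all growth estimates rest on this.\<close>

lemma rel_flow_entries:
  "e11 (rel (M * flow t) (N * flow t)) = e11 (rel M N)"
  "e12 (rel (M * flow t) (N * flow t)) = exp (- t) * e12 (rel M N)"
  "e21 (rel (M * flow t) (N * flow t)) = exp t * e21 (rel M N)"
  "e22 (rel (M * flow t) (N * flow t)) = e22 (rel M N)"
proof -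
  have eq: "rel (M * flow t) (N * flow t) = flow (- t) * (rel M N * flow t)"
    by (simp add: rel_def mult.assoc)
  show "e11 (rel (M * flow t) (N * flow t)) = e11 (rel M N)"
    "e12 (rel (M * flow t) (N * flow t)) = exp (- t) * e12 (rel M N)"
    "e21 (rel (M * flow t) (N * flow t)) = exp t * e21 (rel M N)"
    "e22 (rel (M * flow t) (N * flow t)) = e22 (rel M N)"
    unfolding eq flow_conj_entries by simp_all
qed

text \<open>In forward time only \<open>e21\<close> can grow, so frames stay at bounded distance as
  long as this entry is controlled.\<close>

lemma opnorm_rel_flow:
  assumes "opnorm M \<le> R" "opnorm N \<le> R" "R \<ge> 1" "0 \<le> t" "exp t * \<bar>e21 (rel M N)\<bar> \<le> c"
  shows "opnorm (rel (M * flow t) (N * flow t)) \<le> 3 * R\<^sup>2 + c"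
proof -
  have R: "opnorm (rel M N) \<le> R\<^sup>2" using opnorm_rel[OF assms(1,2)] by (simp add: power2_eq_square)
  have "exp (- t) * \<bar>e12 (rel M N)\<bar> \<le> 1 * \<bar>e12 (rel M N)\<bar>"
    using assms(4) by (intro mult_right_mono) auto
  then show ?thesis
    using opnorm_le_entries[of "rel (M * flow t) (N * flow t)"] entry_le_opnorm[of "rel M N"] R assms(5)
    unfolding rel_flow_entries abs_mult by simp
qed

lemma opnorm_rel_flow_back:
  assumes "opnorm M \<le> R" "opnorm N \<le> R" "R \<ge> 1" "0 \<le> t" "exp t * \<bar>e12 (rel M N)\<bar> \<le> c"
  shows "opnorm (rel (M * flow (- t)) (N * flow (- t))) \<le> 3 * R\<^sup>2 + c"
proof -
  have R: "opnorm (rel M N) \<le> R\<^sup>2" using opnorm_rel[OF assms(1,2)] by (simp add: power2_eq_square)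
  have "exp (- t) * \<bar>e21 (rel M N)\<bar> \<le> 1 * \<bar>e21 (rel M N)\<bar>"
    using assms(4) by (intro mult_right_mono) auto
  then show ?thesis
    using opnorm_le_entries[of "rel (M * flow (- t)) (N * flow (- t))"] entry_le_opnorm[of "rel M N"] R assms(5)
    unfolding rel_flow_entries abs_mult by simp
qed

definition close_frames :: "real \<Rightarrow> sl2 set \<Rightarrow> bool" where
  "close_frames e U \<longleftrightarrow> (\<forall>M\<in>U. \<forall>N\<in>U. \<bar>e21 (rel M N)\<bar> \<le> e \<and> \<bar>e12 (rel M N)\<bar> \<le> e)"

text \<open>Boxes of side \<open>z\<close> in the space of entries. Finitely many of them meet a
  norm ball, and this pigeonhole takes the place of compactness of the unit tangent bundle.\<close>

definition cell :: "real \<Rightarrow> sl2 \<Rightarrow> int \<times> int \<times> int \<times> int" where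
  "cell z M = (\<lfloor>e11 M / z\<rfloor>, \<lfloor>e12 M / z\<rfloor>, \<lfloor>e21 M / z\<rfloor>, \<lfloor>e22 M / z\<rfloor>)"

lemma floor_eq_close:
  assumes "z > 0" "\<lfloor>x / z\<rfloor> = \<lfloor>y / z\<rfloor>"
  shows "\<bar>x - y\<bar> \<le> (z :: real)"
proof -
  have "\<bar>x / z - y / z\<bar> \<le> 1" using assms(2) by linarith
  then have "\<bar>x - y\<bar> / z \<le> 1" using assms(1) by (simp flip: diff_divide_distrib)
  then show ?thesis using assms(1) by simp
qed

lemma cell_close:
  assumes "z > 0" "cell z M = cell z N"
  shows "\<bar>e11 M - e11 N\<bar> \<le> z" "\<bar>e12 M - e12 N\<bar> \<le> z" "\<bar>e21 M - e21 N\<bar> \<le> z" "\<bar>e22 M - e22 N\<bar> \<le> z"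
  using assms by (auto simp: cell_def intro!: floor_eq_close)

lemma finite_cells: "finite (cell z ` {M. opnorm M \<le> R})"
proof -
  have "\<lfloor>x / z\<rfloor> \<in> {- \<lceil>R / \<bar>z\<bar>\<rceil> .. \<lceil>R / \<bar>z\<bar>\<rceil>}" if "\<bar>x\<bar> \<le> R" for x
  proof -
    have "\<bar>x / z\<bar> \<le> R / \<bar>z\<bar>" using that by (simp add: abs_divide divide_right_mono)
    then have "x / z \<le> R / \<bar>z\<bar>" "- (R / \<bar>z\<bar>) \<le> x / z" by linarith+
    moreover have "- \<lceil>w\<rceil> \<le> \<lfloor>y\<rfloor> \<and> \<lfloor>y\<rfloor> \<le> \<lceil>w\<rceil>" if "y \<le> w" "- w \<le> y" for y w :: real
      using that by linarith
    ultimately show ?thesis unfolding atLeastAtMost_iff by blast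
  qed
  then have "cell z ` {M. opnorm M \<le> R} \<subseteq>
     (let I = {- \<lceil>R / \<bar>z\<bar>\<rceil> .. \<lceil>R / \<bar>z\<bar>\<rceil>} in I \<times> I \<times> I \<times> I)"
    unfolding cell_def Let_def
    by (auto simp del: atLeastAtMost_iff intro!: order_trans[OF entry_le_opnorm(1)]
        order_trans[OF entry_le_opnorm(2)] order_trans[OF entry_le_opnorm(3)] order_trans[OF entry_le_opnorm(4)])
  then show ?thesis by (rule finite_subset) (simp add: Let_def)
qed

lemma bilinear_close:
  fixes a b :: real
  assumes "\<bar>a\<bar> \<le> R" "\<bar>b\<bar> \<le> R" "\<bar>x - x'\<bar> \<le> z" "\<bar>y - y'\<bar> \<le> z"
  shows "\<bar>(a * x + b * y) - (a * x' + b * y')\<bar> \<le> 2 * R * z"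
proof -
  have "\<bar>a * (x - x')\<bar> \<le> R * z" "\<bar>b * (y - y')\<bar> \<le> R * z"
    using assms abs_ge_zero[of a] unfolding abs_mult by (intro mult_mono; linarith)+
  then show ?thesis by (simp add: algebra_simps abs_le_iff)
qed

lemma rel_cell_right:
  assumes "z > 0" "cell z M = cell z N" "opnorm L \<le> R"
  shows "\<bar>e11 (rel L M) - e11 (rel L N)\<bar> \<le> 2 * R * z" "\<bar>e12 (rel L M) - e12 (rel L N)\<bar> \<le> 2 * R * z"
    "\<bar>e21 (rel L M) - e21 (rel L N)\<bar> \<le> 2 * R * z" "\<bar>e22 (rel L M) - e22 (rel L N)\<bar> \<le> 2 * R * z"
proof -
  note L = entry_le_opnorm[of "inverse L", unfolded opnorm_inverse, THEN order_trans, OF assms(3)]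
  note c = cell_close[OF assms(1,2)]
  show "\<bar>e11 (rel L M) - e11 (rel L N)\<bar> \<le> 2 * R * z" "\<bar>e12 (rel L M) - e12 (rel L N)\<bar> \<le> 2 * R * z"
    "\<bar>e21 (rel L M) - e21 (rel L N)\<bar> \<le> 2 * R * z" "\<bar>e22 (rel L M) - e22 (rel L N)\<bar> \<le> 2 * R * z"
    unfolding rel_def sl2_entries_mult
    by (rule bilinear_close[OF L(1,2) c(1,3)] bilinear_close[OF L(1,2) c(2,4)]
        bilinear_close[OF L(3,4) c(1,3)] bilinear_close[OF L(3,4) c(2,4)])+
qed

text \<open>Two pairs of frames that are close at time \<open>0\<close>, each of them spread by about \<open>\<sigma>\<close> at
  the forward end and by at most \<open>\<epsilon>\<close> at the backward end. Since the crosswise geodesics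
  cannot meet at a small angle, the backward ends interlace.\<close>

lemma squeeze:
  assumes nc: "\<not> (0 < crossing D E' \<and> crossing D E' < \<eta>)" "\<not> (0 < crossing E D' \<and> crossing E D' < \<eta>)"
    and R: "opnorm D \<le> R" "opnorm D' \<le> R" "opnorm E \<le> R" "opnorm E' \<le> R"
    and z: "z > 0" "2 * R * z \<le> \<sigma> / 28" "\<sigma> \<le> 1" "2 * R\<^sup>2 * \<sigma> < \<eta>"
    and cells: "cell z D = cell z E" "cell z D' = cell z E'"
    and fwd: "\<sigma> / 3 \<le> e21 (rel D D')" "e21 (rel D D') \<le> \<sigma>" "\<sigma> / 3 \<le> e21 (rel E E')" "e21 (rel E E') \<le> \<sigma>"
    and bwd: "\<bar>e12 (rel D D')\<bar> \<le> \<epsilon>" "\<bar>e12 (rel E E')\<bar> \<le> \<epsilon>"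
    and diag: "1 / 2 \<le> e22 (rel D D')" 
  shows "\<bar>e12 (rel D E)\<bar> \<le> 4 * \<epsilon>"
proof -
  have "R \<ge> 1" using opnorm_ge_1[of D] R(1) by linarith
  then have "2 * R * z > 0" using z(1) by simp
  then have \<sigma>: "\<sigma> > 0" using z(2) by linarith
  \<comment> \<open>The forbidden interval becomes a sign condition: \<open>- e12 * e21\<close> is
    below \<open>\<eta>\<close> because \<open>e21 \<le> 2 * \<sigma>\<close>, so it cannot be
    positive, and \<open>e21 > 0\<close> leaves \<open>e12 \<ge> 0\<close>.\<close>
  have pos: "e12 (rel A B) \<ge> 0"
    if nc: "\<not> (0 < crossing A B \<and> crossing A B < \<eta>)" and AB: "opnorm A \<le> R" "opnorm B \<le> R"
      and r: "0 < e21 (rel A B)" "e21 (rel A B) \<le> 2 * \<sigma>" for A B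
  proof (rule ccontr)
    assume neg: "\<not> e12 (rel A B) \<ge> 0"
    have "\<bar>e12 (rel A B)\<bar> \<le> R\<^sup>2"
      using opnorm_rel[OF AB] entry_le_opnorm(2)[of "rel A B"] by (simp add: power2_eq_square)
    then have "- e12 (rel A B) * e21 (rel A B) \<le> R\<^sup>2 * (2 * \<sigma>)"
      using r neg by (intro mult_mono) auto
    moreover have "- e12 (rel A B) * e21 (rel A B) > 0" using neg r by (intro mult_pos_pos) auto
    ultimately show False using nc z(4) by (simp add: crossing_rel)
  qed
  define q1 s1 q2 s2 q3 s3 where "q1 = e12 (rel D E)" and "s1 = e22 (rel D E)"
    and "q2 = e12 (rel D E')" and "s2 = e22 (rel D E')" and "q3 = e12 (rel D D')" and "s3 = e22 (rel D D')"
  have "e21 (rel D E') \<ge> \<sigma> / 3 - \<sigma> / 28" "e21 (rel D E') \<le> \<sigma> + \<sigma> / 28" "s2 \<ge> s3 - \<sigma> / 28"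
    using rel_cell_right[OF z(1) cells(2) R(1)] fwd(1,2) z(2) unfolding s2_def s3_def by linarith+
  then have q2: "q2 \<ge> 0" and s2: "s2 \<ge> 1 / 4"
    using pos[OF nc(1) R(1,4)] \<sigma> z(3) diag by (simp_all add: q2_def s3_def)
  have "\<bar>e21 (rel E D') - e21 (rel E E')\<bar> \<le> 2 * R * z"
    using rel_cell_right(3)[OF z(1) cells(2) R(3)] .
  then have "e21 (rel E D') \<ge> \<sigma> / 3 - \<sigma> / 28" "e21 (rel E D') \<le> \<sigma> + \<sigma> / 28"
    using fwd(3,4) z(2) by linarith+
  then have ED: "e12 (rel E D') \<ge> 0"
    using pos[OF nc(2) R(3,2)] \<sigma> by simp
  have s1: "\<bar>s1 - 1\<bar> \<le> 1 / 28"
  proof -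
    have "\<bar>1 - s1\<bar> \<le> 2 * R * z"
      using rel_cell_right(4)[OF z(1) cells(1) R(1)] by (simp add: s1_def)
    then show ?thesis using z(2,3) by linarith
  qed
  then have s1': "\<bar>s1\<bar> \<le> 2" "0 \<le> s1" by linarith+
  \<comment> \<open>Nonnegativity of \<open>e12 (rel E D')\<close> bounds \<open>q1\<close> from
    above, and that of \<open>q2\<close> bounds it from below; \<open>bwd\<close> supplies the size
    of both bounds.\<close>
  have "e12 (rel E D') = s1 * q3 - q1 * s3"
    unfolding rel_mult[of E D' D] sl2_entries_mult sl2_entries_inverse s1_def q1_def q3_def s3_def by simp
  with ED have "q1 * s3 \<le> s1 * q3" by simp
  also have "\<dots> \<le> 2 * \<epsilon>"
  proof -
    have "\<bar>s1 * q3\<bar> \<le> 2 * \<epsilon>" unfolding abs_mult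
      using s1' bwd(1) by (intro mult_mono) (auto simp: q3_def)
    then show ?thesis by simp
  qed
  finally have up: "q1 * s3 \<le> 2 * \<epsilon>" .
  have "e12 (rel E E') = s1 * q2 - q1 * s2"
    unfolding rel_mult[of E E' D] sl2_entries_mult sl2_entries_inverse s1_def q1_def q2_def s2_def by simp
  moreover have "s1 * q2 \<ge> 0" using s1' q2 by (intro mult_nonneg_nonneg) auto
  ultimately have low: "q1 * s2 \<ge> - \<epsilon>" using bwd(2) by linarith
  have e: "\<epsilon> \<ge> 0" using bwd(1) by linarith
  have "q1 \<le> 4 * \<epsilon>"
  proof (cases "q1 \<le> 0")
    case False
    then have "q1 * (1 / 2) \<le> q1 * s3" using diag by (intro mult_left_mono) (auto simp: s3_def)
    then show ?thesis using up by simp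
  qed (use e in linarith)
  moreover have "q1 \<ge> - 4 * \<epsilon>"
  proof (cases "q1 \<ge> 0")
    case False
    then have "q1 * s2 \<le> q1 * (1 / 4)" using s2 by (intro mult_left_mono_neg) auto
    then show ?thesis using low by simp
  qed (use e in linarith)
  ultimately show ?thesis by (simp add: q1_def abs_le_iff)
qed

lemma card_le_fibers:
  assumes "finite A" "finite B" "\<And>a. a \<in> A \<Longrightarrow> f a \<in> B"
    and "\<And>b. b \<in> B \<Longrightarrow> card {a \<in> A. f a = b} \<le> c"
  shows "card A \<le> c * card B"
proof -
  have "A = (\<Union>b\<in>B. {a \<in> A. f a = b})" using assms(3) by auto
  then have "card A = card (\<Union>b\<in>B. {a \<in> A. f a = b})" by (rule arg_cong)
  also have "\<dots> \<le> (\<Sum>b\<in>B. card {a \<in> A. f a = b})" by (rule card_UN_le[OF assms(2)])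
  also have "\<dots> \<le> (\<Sum>b\<in>B. c)" by (intro sum_mono assms)
  finally show ?thesis by (simp add: mult.commute)
qed

section \<open>Linear growth of the number of combinatorial types\<close>

lemma successor_exists:
  fixes u :: "'a \<Rightarrow> 'b :: linorder"
  assumes "finite V" "\<exists>y\<in>V. u x < u y"
  obtains y where "y \<in> V" "u x < u y" "\<And>w. w \<in> V \<Longrightarrow> u x < u w \<Longrightarrow> u y \<le> u w"
proof -
  let ?A = "{y \<in> V. u x < u y}"
  have A: "finite ?A" "?A \<noteq> {}" using assms by auto
  have "arg_min_on u ?A \<in> ?A" by (rule arg_min_if_finite(1)[OF A])
  moreover have "u (arg_min_on u ?A) \<le> u w" if "w \<in> V" "u x < u w" for w
    using arg_min_least[OF A, of w u] that by simp
  ultimately show ?thesis using that by blast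
qed

lemma maximal_separated:
  assumes "finite U"
  obtains W where "W \<subseteq> U" "\<And>x y. x \<in> W \<Longrightarrow> y \<in> W \<Longrightarrow> x \<noteq> y \<Longrightarrow> \<not> near x y"
    "\<And>x. x \<in> U \<Longrightarrow> \<exists>w\<in>W. w = x \<or> near w x \<or> near x w"
proof -
  define S where "S = {W. W \<subseteq> U \<and> (\<forall>x\<in>W. \<forall>y\<in>W. x \<noteq> y \<longrightarrow> \<not> near x y)}"
  have "finite S" by (rule finite_subset[of _ "Pow U"]) (use assms in \<open>auto simp: S_def\<close>)
  moreover have "S \<noteq> {}" by (auto simp: S_def)
  ultimately obtain W where W: "W \<in> S" "\<And>W'. W' \<in> S \<Longrightarrow> W \<subseteq> W' \<Longrightarrow> W = W'"
    by (rule finite_has_maximal[THEN bexE]) blast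
  show ?thesis
  proof
    show "W \<subseteq> U" "\<And>x y. x \<in> W \<Longrightarrow> y \<in> W \<Longrightarrow> x \<noteq> y \<Longrightarrow> \<not> near x y" using W(1) by (auto simp: S_def)
    fix x assume x: "x \<in> U"
    show "\<exists>w\<in>W. w = x \<or> near w x \<or> near x w"
    proof (rule ccontr)
      assume neg: "\<not> ?thesis"
      then have "insert x W \<in> S" using W(1) x by (auto simp: S_def)
      then have "W = insert x W" by (rule W(2)) auto
      then show False using neg by blast
    qed
  qed
qed

context surface_group
begin

text \<open>What is needed of the set of frames of all lifts of a geodesic whose self-intersection angles
  are bounded below.\<close>

definition frame_family :: "real \<Rightarrow> sl2 set \<Rightarrow> bool" where
  "frame_family \<eta> F \<longleftrightarrow> (\<forall>m\<in>G. \<forall>M\<in>F. m * M \<in> F) \<and> (\<forall>M\<in>F. \<forall>t. M * flow t \<in> F) \<and>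
     (\<forall>M\<in>F. \<forall>M'\<in>F. \<not> (0 < crossing M M' \<and> crossing M M' < \<eta>))"

text \<open>The factors of the bound are the number of deck transformations by which pairs with
  equal labels can differ, the \<open>k + 1\<close> separation times, and the cells of both frames
  of a pair at that time. The summand \<open>1\<close> is the frame with the last forward end, which
  has no successor.\<close>

lemma cluster_bound:
  assumes F: "frame_family \<eta> F" and "V \<subseteq> F" "finite V"
    and R: "R \<ge> 1" "\<And>M. \<exists>m\<in>G. opnorm (inverse m * M) \<le> R"
    and V: "\<And>M. M \<in> V \<Longrightarrow> opnorm M \<le> R"
    and z: "z > 0" "2 * (4 * R ^ 3) * z \<le> \<sigma> / 28" "\<sigma> \<le> 1" "2 * (4 * R ^ 3)\<^sup>2 * \<sigma> < \<eta>"
    and cells: "\<And>M N. M \<in> V \<Longrightarrow> N \<in> V \<Longrightarrow> cell z M = cell z N"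
    and sep: "\<And>M N. M \<in> V \<Longrightarrow> N \<in> V \<Longrightarrow> M \<noteq> N \<Longrightarrow> \<bar>e21 (rel M N)\<bar> > \<sigma> * exp (- real k)"
  shows "card V \<le> 1 + card {m \<in> G. opnorm m \<le> 7 * R ^ 4} *
      ((k + 1) * (card (cell z ` {M. opnorm M \<le> 4 * R ^ 3}))\<^sup>2)"
proof (cases "V = {}")
  case False
  then obtain L where L: "L \<in> V" by blast
  \<comment> \<open>Bounds the successor frame at the separation time:
    \<open>R * (3 * R\<^sup>2 + \<sigma>) \<le> R * (4 * R\<^sup>2)\<close>, see
    \<open>D'R\<close>.\<close>
  define R1 where "R1 = 4 * R ^ 3"
  have RR1: "R \<le> R1" using R(1) self_le_power[of R 3] by (simp add: R1_def)
  have "2 * R1 * z > 0" using z(1) RR1 R(1) by simp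
  then have \<sigma>: "\<sigma> > 0" using z(2) unfolding R1_def by linarith
  have small: "2 * R * z \<le> \<sigma> / 28"
  proof -
    have "2 * R * z \<le> 2 * R1 * z" using RR1 z(1) by (intro mult_right_mono) auto
    then show ?thesis using z(2) unfolding R1_def by linarith
  qed
  have diag: "1 / 2 \<le> e11 (rel M N)" "e11 (rel M N) \<le> 3 / 2" "1 / 2 \<le> e22 (rel M N)"
     and fwd: "\<bar>e21 (rel M N)\<bar> \<le> \<sigma>" if MN: "M \<in> V" "N \<in> V" for M N
  proof -
    have "\<bar>1 - e11 (rel M N)\<bar> \<le> 2 * R * z" "\<bar>1 - e22 (rel M N)\<bar> \<le> 2 * R * z"
      "\<bar>e21 (rel M N)\<bar> \<le> 2 * R * z"
      using rel_cell_right[OF z(1) cells[OF MN] V[OF MN(1)]] by simp_all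
    then show "1 / 2 \<le> e11 (rel M N)" "e11 (rel M N) \<le> 3 / 2" "1 / 2 \<le> e22 (rel M N)"
      "\<bar>e21 (rel M N)\<bar> \<le> \<sigma>"
      using small z(3) \<sigma> by linarith+
  qed
  \<comment> \<open>The slope of the first column of \<open>rel L M\<close>, an affine coordinate of
    the forward end seen from \<open>L\<close>. As \<open>e11\<close> lies between
    \<open>1 / 2\<close> and \<open>3 / 2\<close>, differences of slopes agree with
    \<open>e21\<close> up to the factors \<open>1 / 4\<close> and \<open>9 / 4\<close>.\<close>
  define u where "u M = e21 (rel L M) / e11 (rel L M)" for M
  have u: "e21 (rel M N) = e11 (rel L M) * e11 (rel L N) * (u N - u M)" if MN: "M \<in> V" "N \<in> V" for M N
    unfolding rel_mult[of M N L] u_def using diag[OF L MN(1)] diag[OF L MN(2)]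
    by (simp add: divide_simps)
  have u_lower: "(u N - u M) / 4 \<le> e21 (rel M N)" and u_upper: "e21 (rel M N) \<le> 9 / 4 * (u N - u M)"
    if MN: "M \<in> V" "N \<in> V" "u M \<le> u N" for M N
  proof -
    have "1 / 2 * (1 / 2) \<le> e11 (rel L M) * e11 (rel L N)" "e11 (rel L M) * e11 (rel L N) \<le> 3 / 2 * (3 / 2)"
      using diag[OF L MN(1)] diag[OF L MN(2)] by (intro mult_mono; simp)+
    then have "1 / 4 * (u N - u M) \<le> e11 (rel L M) * e11 (rel L N) * (u N - u M)"
      "e11 (rel L M) * e11 (rel L N) * (u N - u M) \<le> 9 / 4 * (u N - u M)"
      using MN(3) by (intro mult_right_mono; simp)+
    then show "(u N - u M) / 4 \<le> e21 (rel M N)" "e21 (rel M N) \<le> 9 / 4 * (u N - u M)"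
      by (simp_all add: u[OF MN(1,2)])
  qed
  have inj: "u M \<noteq> u N" if "M \<in> V" "N \<in> V" "M \<noteq> N" for M N
  proof
    assume "u M = u N"
    then have "e21 (rel M N) = 0" using u that by simp
    moreover have "\<sigma> * exp (- real k) > 0" using \<sigma> by simp
    ultimately show False using sep[OF that] by simp
  qed
  define V' where "V' = {M \<in> V. \<exists>N\<in>V. u M < u N}"
  have V': "V' \<subseteq> V" "finite V'" using \<open>finite V\<close> by (auto simp: V'_def)
  have "M = N" if "M \<in> V - V'" "N \<in> V - V'" for M N
  proof -
    have "u M \<le> u N" "u N \<le> u M" using that by (auto simp: V'_def not_less)
    then show ?thesis using inj[of M N] that by force
  qed
  then have "card (V - V') \<le> 1"
    using \<open>finite V\<close> card_le_Suc0_iff_eq[of "V - V'"] by auto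
  moreover have "card V = card (V - V') + card V'"
    using card_Diff_subset[OF V'(2,1)] card_mono[OF \<open>finite V\<close> V'(1)] by simp
  ultimately have cardV: "card V \<le> 1 + card V'" by simp
  have ex: "\<exists>N. N \<in> V \<and> u M < u N \<and> (\<forall>w\<in>V. u M < u w \<longrightarrow> u N \<le> u w)" if "M \<in> V'" for M
  proof -
    have "\<exists>N\<in>V. u M < u N" using that by (simp add: V'_def)
    from successor_exists[OF \<open>finite V\<close> this] show ?thesis by metis
  qed
  define nx where "nx M = (SOME N. N \<in> V \<and> u M < u N \<and> (\<forall>w\<in>V. u M < u w \<longrightarrow> u N \<le> u w))" for M
  have nx: "nx M \<in> V" "u M < u (nx M)" "\<And>w. w \<in> V \<Longrightarrow> u M < u w \<Longrightarrow> u (nx M) \<le> u w"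
    if "M \<in> V'" for M
    using someI_ex[OF ex[OF that], folded nx_def] by auto
  define g where "g M = e21 (rel M (nx M))" for M
  have g: "g M > \<sigma> * exp (- real k)" "g M \<le> \<sigma>" "g M > 0" if M: "M \<in> V'" for M
  proof -
    have MV: "M \<in> V" using M V' by auto
    show pos: "g M > 0" using u_lower[OF MV nx(1)[OF M]] nx(2)[OF M] by (simp add: g_def)
    have "M \<noteq> nx M" using nx(2)[OF M] by (metis less_irrefl)
    then show "g M > \<sigma> * exp (- real k)" using sep[OF MV nx(1)[OF M]] pos by (auto simp: g_def)
    show "g M \<le> \<sigma>" using fwd[OF MV nx(1)[OF M]] by (simp add: g_def)
  qed
  \<comment> \<open>The gap reaches \<open>\<sigma>\<close> exactly at time
    \<open>ln (\<sigma> / g M)\<close>. Rounding down loses at most the factor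
    \<open>exp 1 \<le> 3\<close>, hence the window from \<open>\<sigma> / 3\<close> to
    \<open>\<sigma>\<close>; the separation hypothesis \<open>sep\<close> keeps the time at most
    \<open>k\<close>.\<close>
  define \<tau> where "\<tau> M = nat \<lfloor>ln (\<sigma> / g M)\<rfloor>" for M
  have \<tau>: "\<tau> M \<le> k" "\<sigma> / 3 \<le> exp (real (\<tau> M)) * g M" "exp (real (\<tau> M)) * g M \<le> \<sigma>" if M: "M \<in> V'" for M
  proof -
    define t where "t = ln (\<sigma> / g M)"
    have et: "exp t * g M = \<sigma>" using g[OF M] \<sigma> by (simp add: t_def)
    have t0: "t \<ge> 0" using g[OF M] \<sigma> by (simp add: t_def)
    have "\<sigma> / g M < exp (real k)" using g[OF M] by (simp add: exp_minus field_simps)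
    then have "ln (\<sigma> / g M) < ln (exp (real k))" using g[OF M] \<sigma> by (subst ln_less_cancel_iff) auto
    then have tk: "t < real k" by (simp add: t_def)
    have \<tau>t: "real (\<tau> M) \<le> t" "t \<le> real (\<tau> M) + 1" using t0 unfolding \<tau>_def t_def by linarith+
    show "\<tau> M \<le> k" using \<tau>t(1) tk by linarith
    have "exp (real (\<tau> M)) * g M \<le> exp t * g M" using \<tau>t g[OF M] by (intro mult_right_mono) auto
    then show "exp (real (\<tau> M)) * g M \<le> \<sigma>" using et by simp
    have "exp t * g M \<le> exp (real (\<tau> M) + 1) * g M" using \<tau>t g[OF M] by (intro mult_right_mono) auto
    also have "\<dots> = exp 1 * (exp (real (\<tau> M)) * g M)" by (simp add: exp_add)
    also have "\<dots> \<le> 3 * (exp (real (\<tau> M)) * g M)" using exp_le g[OF M] by (intro mult_right_mono) auto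
    finally show "\<sigma> / 3 \<le> exp (real (\<tau> M)) * g M" using et by simp
  qed
  have "\<exists>n. n \<in> G \<and> opnorm (inverse n * (M * flow (real (\<tau> M)))) \<le> R" for M using R(2) by blast
  then obtain n where n: "\<And>M. n M \<in> G" "\<And>M. opnorm (inverse (n M) * (M * flow (real (\<tau> M)))) \<le> R"
    by metis
  \<comment> \<open>A pair at its separation time, both frames being moved by the deck
    transformation that brings back the first one.\<close>
  define D where "D M = inverse (n M) * (M * flow (real (\<tau> M)))" for M
  define D' where "D' M = inverse (n M) * (nx M * flow (real (\<tau> M)))" for M
  have DR: "opnorm (D M) \<le> R" for M using n(2) by (simp add: D_def)
  have relDD': "rel (D M) (D' M) = rel (M * flow (real (\<tau> M))) (nx M * flow (real (\<tau> M)))" for M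
    by (simp add: D_def D'_def)
  have e21D: "e21 (rel (D M) (D' M)) = exp (real (\<tau> M)) * g M" for M
    by (simp add: relDD' rel_flow_entries g_def)
  have D'R: "opnorm (D' M) \<le> R1" if M: "M \<in> V'" for M
  proof -
    have MV: "M \<in> V" using M V' by auto
    have "opnorm (rel (D M) (D' M)) \<le> 3 * R\<^sup>2 + \<sigma>" unfolding relDD'
      using \<tau>(3)[OF M] g(3)[OF M] by (intro opnorm_rel_flow V MV nx(1) M R(1)) (auto simp: g_def)
    also have "\<dots> \<le> 4 * R\<^sup>2" using z(3) one_le_power[OF R(1), of 2] by simp
    finally have "opnorm (D M * rel (D M) (D' M)) \<le> R * (4 * R\<^sup>2)"
      by (rule opnorm_mult_le[OF DR])
    then show ?thesis by (simp add: rel_def R1_def power3_eq_cube power2_eq_square)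
  qed
  have DF: "D M \<in> F" "D' M \<in> F" if M: "M \<in> V'" for M
  proof -
    have "M \<in> F" "nx M \<in> F" using M V' \<open>V \<subseteq> F\<close> nx(1) by auto
    then show "D M \<in> F" "D' M \<in> F" using F n(1) unfolding frame_family_def D_def D'_def by auto
  qed
  define C where "C = cell z ` {M. opnorm M \<le> R1}"
  have finC: "finite C" unfolding C_def by (rule finite_cells)
  define h where "h M = (\<tau> M, cell z (D M), cell z (D' M))" for M
  define F4 where "F4 = {m \<in> G. opnorm m \<le> 7 * R ^ 4}"
  have finF4: "finite F4" unfolding F4_def by (rule finite_G)
  have "card V' \<le> card F4 * card ({..k} \<times> C \<times> C)"
  proof (rule card_le_fibers[where f = h])
    show "finite V'" by fact
    show "finite ({..k} \<times> C \<times> C)" using finC by simp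
    show "h M \<in> {..k} \<times> C \<times> C" if "M \<in> V'" for M
      using \<tau>(1)[OF that] order_trans[OF DR RR1] D'R[OF that] by (auto simp: h_def C_def)
    fix b
    define A where "A = {M \<in> V'. h M = b}"
    show "card {M \<in> V'. h M = b} \<le> card F4"
    proof (cases "A = {}")
      case True
      then show ?thesis unfolding A_def by (metis card.empty zero_le)
    next
      case False
      then obtain J where J: "J \<in> A" by blast
      have AV: "M \<in> V'" "M \<in> V" if "M \<in> A" for M using that V' by (auto simp: A_def)
      have same: "\<tau> M = \<tau> N" "cell z (D M) = cell z (D N)" "cell z (D' M) = cell z (D' N)"
        if "M \<in> A" "N \<in> A" for M N
      proof -
        have "h M = h N" using that by (simp add: A_def)
        then show "\<tau> M = \<tau> N" "cell z (D M) = cell z (D N)" "cell z (D' M) = cell z (D' N)"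
          by (auto simp: h_def)
      qed
      \<comment> \<open>By \<open>squeeze\<close> the backward ends of \<open>D J\<close> and
        \<open>D M\<close> are close to order \<open>exp (- t)\<close>, so the frames stay at
        bounded distance when they flow back for time \<open>t\<close>. There they are
        \<open>J\<close> and \<open>M\<close> again, up to \<open>n J\<close> and
        \<open>n M\<close>, and these have norm at most \<open>R\<close>; hence
        \<open>R * (7 * R\<^sup>2) * R\<close>.\<close>
      have 1: "n J * inverse (n M) \<in> F4" if M: "M \<in> A" for M
      proof -
        note JV = AV[OF J] and MV = AV[OF M]
        define t where "t = real (\<tau> J)"
        have tM: "real (\<tau> M) = t" using same(1)[OF M J] by (simp add: t_def)
        have bwd: "\<bar>e12 (rel (D N) (D' N))\<bar> \<le> exp (- t) * R\<^sup>2" if N: "N \<in> A" for N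
        proof -
          have "real (\<tau> N) = t" using same(1)[OF N J] by (simp add: t_def)
          then have "\<bar>e12 (rel (D N) (D' N))\<bar> = exp (- t) * \<bar>e12 (rel N (nx N))\<bar>"
            unfolding relDD' rel_flow_entries by (simp add: abs_mult)
          also have "\<dots> \<le> exp (- t) * (R * R)"
            using opnorm_rel[OF V V, of N "nx N"] entry_le_opnorm(2)[of "rel N (nx N)"] AV[OF N] nx(1)
            by (intro mult_left_mono) (auto intro: order_trans)
          finally show ?thesis by (simp add: power2_eq_square)
        qed
        have diagD: "1 / 2 \<le> e22 (rel (D J) (D' J))"
          unfolding relDD' rel_flow_entries using diag(3)[OF JV(2) nx(1)[OF JV(1)]] .
        have "\<bar>e12 (rel (D J) (D M))\<bar> \<le> 4 * (exp (- t) * R\<^sup>2)"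
        proof (rule squeeze[where D' = "D' J" and E' = "D' M" and R = R1 and z = z and \<sigma> = \<sigma> and \<eta> = \<eta>])
          show "\<not> (0 < crossing (D J) (D' M) \<and> crossing (D J) (D' M) < \<eta>)"
            "\<not> (0 < crossing (D M) (D' J) \<and> crossing (D M) (D' J) < \<eta>)"
            using F DF[OF JV(1)] DF[OF MV(1)] by (simp_all only: frame_family_def) blast+
          show "opnorm (D J) \<le> R1" "opnorm (D M) \<le> R1" by (rule order_trans[OF DR RR1])+
          show "opnorm (D' J) \<le> R1" "opnorm (D' M) \<le> R1" by (rule D'R JV MV)+
          show "z > 0" "2 * R1 * z \<le> \<sigma> / 28" "\<sigma> \<le> 1" "2 * R1\<^sup>2 * \<sigma> < \<eta>"
            using z by (simp_all add: R1_def)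
          show "cell z (D J) = cell z (D M)" "cell z (D' J) = cell z (D' M)" by (rule same[OF J M])+
          show "\<sigma> / 3 \<le> e21 (rel (D J) (D' J))" "e21 (rel (D J) (D' J)) \<le> \<sigma>"
            "\<sigma> / 3 \<le> e21 (rel (D M) (D' M))" "e21 (rel (D M) (D' M)) \<le> \<sigma>"
            unfolding e21D by (rule \<tau> JV MV)+
          show "\<bar>e12 (rel (D J) (D' J))\<bar> \<le> exp (- t) * R\<^sup>2" "\<bar>e12 (rel (D M) (D' M))\<bar> \<le> exp (- t) * R\<^sup>2"
            by (rule bwd J M)+
          show "1 / 2 \<le> e22 (rel (D J) (D' J))" by (rule diagD)
        qed
        then have "exp t * \<bar>e12 (rel (D J) (D M))\<bar> \<le> exp t * (4 * (exp (- t) * R\<^sup>2))"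
          by (intro mult_left_mono) auto
        also have "\<dots> = 4 * R\<^sup>2" by (simp add: exp_minus)
        finally have "opnorm (rel (D J * flow (- t)) (D M * flow (- t))) \<le> 3 * R\<^sup>2 + 4 * R\<^sup>2"
          by (intro opnorm_rel_flow_back DR R(1)) (auto simp: t_def)
        then have "opnorm (rel (D J * flow (- t)) (D M * flow (- t))) \<le> 7 * R\<^sup>2" by simp
        then have "opnorm (J * (rel (D J * flow (- t)) (D M * flow (- t)) * inverse M)) \<le> R * (7 * R\<^sup>2 * R)"
          by (intro opnorm_mult_le[OF V[OF JV(2)]] opnorm_mult_le) (simp_all add: V MV)
        moreover have "J * (rel (D J * flow (- t)) (D M * flow (- t)) * inverse M) = n J * inverse (n M)"
        proof -
          have fl: "flow t * flow (- t) = 1" by (simp add: flow_add)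
          have "D J * flow (- t) = inverse (n J) * J" "D M * flow (- t) = inverse (n M) * M"
            using fl tM by (simp_all add: D_def mult.assoc t_def)
          then show ?thesis by (simp add: rel_def mult.assoc)
        qed
        ultimately have "opnorm (n J * inverse (n M)) \<le> 7 * R ^ 4"
          by (simp add: power4_eq_xxxx power2_eq_square mult.assoc)
        then show ?thesis using n(1) by (simp add: F4_def)
      qed
      \<comment> \<open>If \<open>n M = n N\<close>, the forward end of \<open>N\<close> is not
        before that of the successor of \<open>M\<close>, so the gap from \<open>M\<close> to
        \<open>N\<close> is at least \<open>g M / 9\<close> and has grown to
        \<open>\<sigma> / 27\<close> at the separation time. Frames in one cell allow at most
        \<open>\<sigma> / 28\<close>, which is the origin of the constant \<open>28\<close>.\<close>
      have 2: "\<not> (u M < u N \<and> n M = n N)" if MN: "M \<in> A" "N \<in> A" for M N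
      proof
        assume *: "u M < u N \<and> n M = n N"
        note MV = AV[OF MN(1)] and NV = AV[OF MN(2)]
        have "u (nx M) \<le> u N" using nx(3)[OF MV(1) NV(2)] * by simp
        then have "9 / 4 * (u (nx M) - u M) \<le> 9 / 4 * (u N - u M)" by (intro mult_left_mono) simp_all
        moreover have "g M \<le> 9 / 4 * (u (nx M) - u M)"
          using u_upper[OF MV(2) nx(1)[OF MV(1)]] nx(2)[OF MV(1)] by (simp add: g_def)
        ultimately have "g M \<le> 9 / 4 * (u N - u M)" by (rule order_trans[rotated])
        then have "g M / 9 \<le> (u N - u M) / 4" by simp
        also have "\<dots> \<le> e21 (rel M N)"
          using u_lower[OF MV(2) NV(2)] * by simp
        finally have "g M / 9 \<le> e21 (rel M N)" .
        then have "exp (real (\<tau> M)) * (g M / 9) \<le> exp (real (\<tau> M)) * e21 (rel M N)"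
          by (intro mult_left_mono) auto
        also have "\<dots> = e21 (rel (D M) (D N))"
          using * same(1)[OF MN] by (simp add: D_def rel_flow_entries)
        also have "\<dots> \<le> 2 * R * z"
          using rel_cell_right(3)[OF z(1) same(2)[OF MN] DR[of M]] by simp
        finally show False using \<tau>(2)[OF MV(1)] small \<sigma> by simp
      qed
      have "inj_on n A"
      proof (rule inj_onI)
        fix M N assume MN: "M \<in> A" "N \<in> A" "n M = n N"
        then have "u M = u N" using 2[OF MN(1,2)] 2[OF MN(2,1)] by auto
        then show "M = N" using inj AV MN(1,2) by blast
      qed
      moreover have "n ` A \<subseteq> (\<lambda>f. inverse f * n J) ` F4"
      proof
        fix x assume "x \<in> n ` A"
        then obtain M where M: "M \<in> A" "x = n M" by blast
        have "n M = inverse (n J * inverse (n M)) * n J" by (simp add: mult.assoc)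
        then show "x \<in> (\<lambda>f. inverse f * n J) ` F4" using 1[OF M(1)] M(2) by blast
      qed
      ultimately have "card A \<le> card ((\<lambda>f. inverse f * n J) ` F4)"
        using finF4 by (metis card_image card_mono finite_imageI)
      also have "\<dots> \<le> card F4" by (rule card_image_le[OF finF4])
      finally show ?thesis by (simp add: A_def)
    qed
  qed
  then show ?thesis using cardV
    by (simp add: card_cartesian_product F4_def C_def R1_def power2_eq_square)
qed simp

end

section \<open>Coding of flow orbits by words in the deck group\<close>

fun words :: "sl2 set \<Rightarrow> nat \<Rightarrow> sl2 set" where
  "words S 0 = {1}"
| "words S (Suc i) = (\<lambda>(m, s). m * s) ` (words S i \<times> S)"

lemma finite_words: "finite S \<Longrightarrow> finite (words S i)"
  by (induction i) auto

text \<open>After each time \<open>u\<close> one letter of \<open>S\<close> is split off to return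
  to the norm ball, so the position at time \<open>i * u\<close> is known up to that ball from
  \<open>i\<close> letters.\<close>

lemma words_coding:
  assumes step: "\<And>B. B \<in> F \<Longrightarrow> opnorm B \<le> R \<Longrightarrow> \<exists>s\<in>S. \<exists>B'\<in>F. opnorm B' \<le> R \<and> B * flow u = s * B'"
    and M: "M \<in> F" "opnorm M \<le> R"
  shows "\<exists>m\<in>words S i. \<exists>B\<in>F. opnorm B \<le> R \<and> M * flow (real i * u) = m * B"
proof (induction i)
  case (Suc i)
  then obtain m B where m: "m \<in> words S i" "B \<in> F" "opnorm B \<le> R" "M * flow (real i * u) = m * B"
    by blast
  obtain s B' where s: "s \<in> S" "B' \<in> F" "opnorm B' \<le> R" "B * flow u = s * B'"
    using step[OF m(2,3)] by blast
  have "M * flow (real (Suc i) * u) = M * flow (real i * u) * flow u"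
    by (simp add: mult.assoc flow_add algebra_simps)
  also have "\<dots> = (m * s) * B'" unfolding m(4) by (simp add: mult.assoc s(4))
  finally have "M * flow (real (Suc i) * u) = (m * s) * B'" .
  moreover have "m * s \<in> words S (Suc i)" using m(1) s(1) by auto
  ultimately show ?case using s(2,3) by blast
qed (use M in auto)

lemma card_words: "finite S \<Longrightarrow> card (words S i) \<le> card S ^ i"
proof (induction i)
  case (Suc i)
  have "card (words S (Suc i)) \<le> card (words S i \<times> S)"
    using Suc.prems by (simp only: words.simps) (intro card_image_le finite_cartesian_product finite_words)
  also have "\<dots> \<le> card S ^ i * card S" using Suc by (simp add: card_cartesian_product)
  finally show ?case by (simp add: mult.commute)
qed simp

context surface_group
begin

definition steps :: "real \<Rightarrow> nat \<Rightarrow> sl2 set \<Rightarrow> sl2 set" where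
  "steps R k F = {m \<in> G. \<exists>M\<in>F. \<exists>B. opnorm M \<le> R \<and> opnorm B \<le> R \<and> M * flow (real k) = m * B}"

text \<open>The bound does not involve \<open>F\<close>, so for fixed \<open>k\<close> only finitely
  many sets can occur as step sets.\<close>

lemma steps_bounded:
  "steps R k F \<subseteq> {m \<in> G. opnorm m \<le> R * exp (real k / 2) * R}"
proof
  fix m assume "m \<in> steps R k F"
  then obtain M B where m: "m \<in> G" "opnorm M \<le> R" "opnorm B \<le> R" "M * flow (real k) = m * B"
    by (auto simp: steps_def)
  have "m * B * inverse B = M * flow (real k) * inverse B" by (simp only: m(4))
  then have "m = M * flow (real k) * inverse B" by (simp add: mult.assoc)
  moreover have "opnorm (flow (real k)) \<le> exp (real k / 2)" by (simp add: opnorm_flow)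
  ultimately have "opnorm m \<le> R * exp (real k / 2) * R"
    using m(2,3) by (auto intro!: opnorm_mult_le)
  then show "m \<in> {m \<in> G. opnorm m \<le> R * exp (real k / 2) * R}" using m(1) by simp
qed

lemma finite_steps: "finite (steps R k F)"
  by (rule finite_subset[OF steps_bounded finite_G])

text \<open>Each step is represented by a starting frame. A maximal separated set of these frames
  accounts for all steps up to a bounded multiplicity, and \<open>cluster_bound\<close> counts it
  cell by cell.\<close>

lemma card_steps:
  assumes "\<eta> > 0" and R: "R \<ge> 1" "\<And>M. \<exists>m\<in>G. opnorm (inverse m * M) \<le> R"
  obtains C where "\<And>F k. frame_family \<eta> F \<Longrightarrow> card (steps R k F) \<le> C * (k + 1)"
proof
  define R1 where "R1 = 4 * R ^ 3"
  \<comment> \<open>The factor \<open>4\<close> instead of \<open>2\<close> makes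
    \<open>2 * R1\<^sup>2 * \<sigma> < \<eta>\<close> strict. In \<open>z\<close> the constant is
    \<open>56 = 2 * 28\<close>.\<close>
  define \<sigma> where "\<sigma> = min 1 (\<eta> / (4 * R1\<^sup>2))"
  define z where "z = \<sigma> / (56 * R1)"
  have R1: "R1 \<ge> 1" using one_le_power[OF R(1), of 3] by (simp add: R1_def)
  have \<sigma>: "\<sigma> > 0" "\<sigma> \<le> 1" using assms(1) R1 by (auto simp: \<sigma>_def)
  have z: "z > 0" "2 * R1 * z \<le> \<sigma> / 28" using \<sigma> R1 by (auto simp: z_def)
  have "\<sigma> \<le> \<eta> / (4 * R1\<^sup>2)" by (simp add: \<sigma>_def)
  then have "\<sigma> * (4 * R1\<^sup>2) \<le> \<eta>" using R1 by (simp add: pos_le_divide_eq)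
  then have s\<eta>: "2 * R1\<^sup>2 * \<sigma> < \<eta>" using assms(1) by (simp add: mult.commute mult.left_commute)
  \<comment> \<open>Starting frames that are near each other are still at bounded distance at time
    \<open>k\<close>, so their steps differ by an element of this finite set.\<close>
  define F5 where "F5 = {m \<in> G. opnorm m \<le> R * (4 * R\<^sup>2) * R}"
  define K0 where "K0 = cell z ` {M. opnorm M \<le> R}"
  define c where "c = card {m \<in> G. opnorm m \<le> 7 * R ^ 4} * (card (cell z ` {M. opnorm M \<le> R1}))\<^sup>2"
  have fin5: "finite F5" unfolding F5_def by (rule finite_G)
  have finK: "finite K0" unfolding K0_def by (rule finite_cells)
  fix F k assume F: "frame_family \<eta> F"
  define S where "S = steps R k F"
  have "\<exists>M B. M \<in> F \<and> opnorm M \<le> R \<and> opnorm B \<le> R \<and> M * flow (real k) = m * B" if "m \<in> S" for m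
    using that by (auto simp: S_def steps_def)
  then obtain M B where MB: "M m \<in> F" "opnorm (M m) \<le> R" "opnorm (B m) \<le> R"
    "M m * flow (real k) = m * B m" if "m \<in> S" for m by metis
  define near where "near x y \<longleftrightarrow> \<bar>e21 (rel x y)\<bar> \<le> \<sigma> * exp (- real k)" for x y
  have "finite (M ` S)" unfolding S_def by (intro finite_imageI finite_steps)
  then obtain W where W: "W \<subseteq> M ` S" "\<And>x y. x \<in> W \<Longrightarrow> y \<in> W \<Longrightarrow> x \<noteq> y \<Longrightarrow> \<not> near x y"
      "\<And>x. x \<in> M ` S \<Longrightarrow> \<exists>w\<in>W. w = x \<or> near w x \<or> near x w"
    using maximal_separated[of "M ` S" near] by metis
  have finW: "finite W" using W(1) \<open>finite (M ` S)\<close> by (rule finite_subset)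
  have near_refl: "near x x" for x using \<sigma> by (simp add: near_def)
  have near_sym: "near x y \<Longrightarrow> near y x" for x y by (simp add: near_def rel_swap)
  have "\<exists>w\<in>W. near w (M m)" if "m \<in> S" for m
    using W(3)[of "M m"] that near_refl near_sym by blast
  then obtain w where w: "w m \<in> W" "near (w m) (M m)" if "m \<in> S" for m by metis
  have "card S \<le> card F5 * card W"
  proof (rule card_le_fibers[where f = w])
    show "finite S" unfolding S_def by (rule finite_steps)
    show "finite W" by fact
    show "w m \<in> W" if "m \<in> S" for m using w that by simp
    fix v assume "v \<in> W"
    then obtain l where l: "l \<in> S" "M l = v" using W(1) by auto
    have "inverse l * m \<in> F5" if m: "m \<in> S" "w m = v" for m
    proof -
      have "exp (real k) * \<bar>e21 (rel (M l) (M m))\<bar> \<le> exp (real k) * (\<sigma> * exp (- real k))"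
        using w(2)[OF m(1)] m(2) l by (intro mult_left_mono) (auto simp: near_def)
      also have "\<dots> = \<sigma>" by (simp add: exp_minus)
      finally have "opnorm (rel (M l * flow (real k)) (M m * flow (real k))) \<le> 3 * R\<^sup>2 + \<sigma>"
        using MB l m R(1) by (intro opnorm_rel_flow) auto
      also have "\<dots> \<le> 4 * R\<^sup>2" using \<sigma> one_le_power[OF R(1), of 2] by simp
      finally have "opnorm (B l * rel (M l * flow (real k)) (M m * flow (real k)) * inverse (B m)) \<le> R * (4 * R\<^sup>2) * R"
        using MB l m by (auto intro!: opnorm_mult_le)
      also have "B l * rel (M l * flow (real k)) (M m * flow (real k)) * inverse (B m) = inverse l * m"
        unfolding MB(4)[OF l(1)] MB(4)[OF m(1)] by (simp add: rel_def mult.assoc)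
      finally show ?thesis using l m by (simp add: F5_def S_def steps_def)
    qed
    then have "{m \<in> S. w m = v} \<subseteq> (\<lambda>f. l * f) ` F5"
      by (auto intro!: image_eqI[where x = "inverse l * _"])
    then have "card {m \<in> S. w m = v} \<le> card ((\<lambda>f. l * f) ` F5)"
      using fin5 by (intro card_mono) auto
    also have "\<dots> \<le> card F5" by (rule card_image_le[OF fin5])
    finally show "card {m \<in> S. w m = v} \<le> card F5" .
  qed
  also have "card W \<le> (1 + (k + 1) * c) * card K0"
  proof (rule card_le_fibers[where f = "cell z"])
    show "finite W" "finite K0" by fact+
    show "cell z x \<in> K0" if "x \<in> W" for x using that W(1) MB(2) by (auto simp: K0_def)
    fix b
    define V where "V = {x \<in> W. cell z x = b}"
    have VW: "x \<in> W" "x \<in> F" "opnorm x \<le> R" if "x \<in> V" for x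
      using that W(1) MB by (auto simp: V_def)
    have "card V \<le> 1 + card {m \<in> G. opnorm m \<le> 7 * R ^ 4} *
      ((k + 1) * (card (cell z ` {M. opnorm M \<le> 4 * R ^ 3}))\<^sup>2)"
    proof (rule cluster_bound[OF F])
      show "V \<subseteq> F" "finite V" using VW finW by (auto simp: V_def)
      show "z > 0" "2 * (4 * R ^ 3) * z \<le> \<sigma> / 28" "\<sigma> \<le> 1" "2 * (4 * R ^ 3)\<^sup>2 * \<sigma> < \<eta>"
        using z \<sigma> s\<eta> by (simp_all only: R1_def)
      show "cell z x = cell z y" if "x \<in> V" "y \<in> V" for x y using that by (simp add: V_def)
      show "\<bar>e21 (rel x y)\<bar> > \<sigma> * exp (- real k)" if "x \<in> V" "y \<in> V" "x \<noteq> y" for x y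
        using W(2)[of x y] VW that by (simp add: near_def)
    qed (use R VW in auto)
    then show "card {x \<in> W. cell z x = b} \<le> 1 + (k + 1) * c"
      by (simp add: V_def c_def R1_def algebra_simps)
  qed
  finally have "card S \<le> card F5 * ((1 + (k + 1) * c) * card K0)" by simp
  also have "\<dots> \<le> card F5 * (((k + 1) * (1 + c)) * card K0)"
    by (intro mult_le_mono) auto
  finally show "card (steps R k F) \<le> card F5 * card K0 * (1 + c) * (k + 1)"
    by (simp add: S_def algebra_simps)
qed

lemma forward_step:
  assumes F: "frame_family \<eta> F" and R: "\<And>M. \<exists>m\<in>G. opnorm (inverse m * M) \<le> R"
    and B: "B \<in> F" "opnorm B \<le> R"
  shows "\<exists>s\<in>steps R k F. \<exists>B'\<in>F. opnorm B' \<le> R \<and> B * flow (real k) = s * B'"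
proof -
  obtain s where s: "s \<in> G" "opnorm (inverse s * (B * flow (real k))) \<le> R" using R by blast
  define B' where "B' = inverse s * (B * flow (real k))"
  have eq: "B * flow (real k) = s * B'" by (simp add: B'_def)
  have "s \<in> steps R k F" using s B eq unfolding steps_def B'_def[symmetric] by blast
  moreover have "B' \<in> F" using F B(1) s(1) by (simp add: frame_family_def B'_def)
  ultimately show ?thesis using s(2) eq unfolding B'_def[symmetric] by blast
qed

text \<open>A backward step is the inverse of the forward step that starts at the frame reached. So
  one step set serves both directions.\<close>

lemma backward_step:
  assumes F: "frame_family \<eta> F" and R: "\<And>M. \<exists>m\<in>G. opnorm (inverse m * M) \<le> R"
    and B: "B \<in> F" "opnorm B \<le> R"
  shows "\<exists>s\<in>inverse ` steps R k F. \<exists>B'\<in>F. opnorm B' \<le> R \<and> B * flow (- real k) = s * B'"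
proof -
  obtain s where s: "s \<in> G" "opnorm (inverse s * (B * flow (- real k))) \<le> R" using R by blast
  define B' where "B' = inverse s * (B * flow (- real k))"
  have eq: "B * flow (- real k) = s * B'" by (simp add: B'_def)
  have B': "B' \<in> F" using F B(1) s(1) by (simp add: frame_family_def B'_def)
  have "B' * flow (real k) = inverse s * B" by (simp add: B'_def mult.assoc flow_add)
  then have "inverse s \<in> steps R k F" using s B(2) B' unfolding steps_def B'_def[symmetric] by auto
  then have "s \<in> inverse ` steps R k F" by (metis image_eqI sl2_inverse(5))
  then show ?thesis using s(2) eq B' unfolding B'_def[symmetric] by blast
qed

definition sparse_frames :: "real \<Rightarrow> real \<Rightarrow> sl2 set" where
  "sparse_frames \<eta> R = {M. opnorm M \<le> R \<and> (\<exists>F. frame_family \<eta> F \<and> M \<in> F)}"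

text \<open>The covering sets are indexed by a step set, a word for the future and a word for the
  past. Frames with the same index are at bounded distance at the times \<open>i * k\<close> and
  \<open>- (i * k)\<close>, which makes both off-diagonal entries of their relative matrix
  small.\<close>

lemma sparse_frames_cover:
  assumes "\<eta> > 0" "s > 0" and R: "R \<ge> 1" "\<And>M. \<exists>m\<in>G. opnorm (inverse m * M) \<le> R"
  obtains k c P where "k > 0" "(real P)\<^sup>2 * exp (- (s * real k)) < 1"
    "\<And>i. \<exists>\<U>. finite \<U> \<and> card \<U> \<le> c * P ^ (2 * i) \<and> sparse_frames \<eta> R \<subseteq> \<Union>\<U> \<and>
       (\<forall>U\<in>\<U>. U \<subseteq> sparse_frames \<eta> R \<and> close_frames (R\<^sup>2 * exp (- real (i * k))) U)"
proof -
  obtain C where C: "\<And>F k. frame_family \<eta> F \<Longrightarrow> card (steps R k F) \<le> C * (k + 1)"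
    using card_steps[OF assms(1) R] by blast
  \<comment> \<open>This fixes \<open>k\<close> before \<open>i\<close> varies. The square counts
    future and past words, and the linear bound on letters loses against
    \<open>exp (- (s * k))\<close>.\<close>
  have "((\<lambda>k. (real k + 1)\<^sup>2 * exp (- (s * real k))) \<longlongrightarrow> 0) at_top"
    using assms(2) by real_asymp
  then have "((\<lambda>k. (real C)\<^sup>2 * ((real k + 1)\<^sup>2 * exp (- (s * real k)))) \<longlongrightarrow> 0) at_top"
    by (rule tendsto_mult_right_zero)
  then have "((\<lambda>k. (real C * (real k + 1))\<^sup>2 * exp (- (s * real k))) \<longlongrightarrow> 0) at_top"
    by (simp add: power_mult_distrib mult.assoc)
  then have "eventually (\<lambda>k. (real C * (real k + 1))\<^sup>2 * exp (- (s * real k)) < 1 \<and> k > 0) at_top"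
    by (intro eventually_conj order_tendstoD(2) eventually_gt_at_top) auto
  then obtain k where k: "(real C * (real k + 1))\<^sup>2 * exp (- (s * real k)) < 1" "k > 0"
    using eventually_happens trivial_limit_sequentially by (metis (no_types, lifting))
  define P where "P = C * (k + 1)"
  \<comment> \<open>All candidates for the step set of a geodesic. Their number is the constant
    \<open>c\<close> of the statement and is independent of \<open>i\<close>.\<close>
  define \<S> where "\<S> = Pow {m \<in> G. opnorm m \<le> R * exp (real k / 2) * R}"
  have fin\<S>: "finite \<S>" unfolding \<S>_def using finite_G by blast
  show ?thesis
  proof
    show "k > 0" by fact
    show "(real P)\<^sup>2 * exp (- (s * real k)) < 1" using k(1) by (simp add: P_def algebra_simps)
    fix i
    define n where "n = real (i * k)"
    define U where "U a b = {M. opnorm M \<le> R \<and> (\<exists>F. frame_family \<eta> F \<and> M \<in> F) \<and>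
      (\<exists>B. opnorm B \<le> R \<and> M * flow n = a * B) \<and> (\<exists>B. opnorm B \<le> R \<and> M * flow (- n) = b * B)}" for a b
    define I where "I = (SIGMA S:{S\<in>\<S>. card S \<le> P}. words S i \<times> words (inverse ` S) i)"
    define \<U> where "\<U> = (\<lambda>(S, a, b). U a b) ` I"
    have fin: "finite S" if "S \<in> \<S>" for S using that finite_G by (auto simp: \<S>_def intro: finite_subset)
    have finI: "finite I" unfolding I_def
    using fin fin\<S> by (intro finite_SigmaI finite_cartesian_product finite_words finite_imageI) auto
    have "card I = (\<Sum>S\<in>{S\<in>\<S>. card S \<le> P}. card (words S i \<times> words (inverse ` S) i))"
      unfolding I_def using fin\<S> fin by (subst card_SigmaI) (auto intro: finite_words)
    also have "\<dots> \<le> (\<Sum>S\<in>{S\<in>\<S>. card S \<le> P}. P ^ (2 * i))"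
    proof (rule sum_mono)
      fix S assume S: "S \<in> {S\<in>\<S>. card S \<le> P}"
      then have fS: "finite S" using fin by simp
      have "card (words S i) \<le> P ^ i"
        using card_words[OF fS, of i] S by (auto intro: order_trans power_mono)
      moreover have "card (words (inverse ` S) i) \<le> P ^ i"
        using card_words[of "inverse ` S" i] card_image_le[OF fS, of inverse] S fS
        by (auto intro!: order_trans[OF card_words] power_mono)
      ultimately show "card (words S i \<times> words (inverse ` S) i) \<le> P ^ (2 * i)"
        unfolding card_cartesian_product power_mult mult_2 power_add by (rule mult_le_mono)
    qed
    also have "\<dots> \<le> card \<S> * P ^ (2 * i)"
      using card_mono[OF fin\<S>, of "{S\<in>\<S>. card S \<le> P}"] by auto
    finally have "card \<U> \<le> card \<S> * P ^ (2 * i)"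
      unfolding \<U>_def using card_image_le[OF finI] by (metis order_trans)
    moreover have "finite \<U>" unfolding \<U>_def using finI by simp
    moreover have "sparse_frames \<eta> R \<subseteq> \<Union>\<U>"
    proof
      fix M assume "M \<in> sparse_frames \<eta> R"
      then obtain F where F: "opnorm M \<le> R" "frame_family \<eta> F" "M \<in> F" by (auto simp: sparse_frames_def)
      define S where "S = steps R k F"
      obtain a B where a: "a \<in> words S i" "opnorm B \<le> R" "M * flow n = a * B"
        using words_coding[OF forward_step[OF F(2) R(2), where k = k] F(3,1), of i]
        unfolding S_def n_def by (metis of_nat_mult)
      obtain b B' where b: "b \<in> words (inverse ` S) i" "opnorm B' \<le> R" "M * flow (- n) = b * B'"
        using words_coding[OF backward_step[OF F(2) R(2), where k = k] F(3,1), of i]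
        unfolding S_def n_def by (metis of_nat_mult mult_minus_right)
      have "S \<in> \<S>" "card S \<le> P" using steps_bounded C[OF F(2), of k] by (auto simp: S_def \<S>_def P_def)
      then have "(S, a, b) \<in> I" using a b by (simp add: I_def)
      moreover have "M \<in> U a b" using F a b by (auto simp: U_def)
      ultimately show "M \<in> \<Union>\<U>" unfolding \<U>_def by blast
    qed
    moreover have bnd: "\<bar>e21 (rel M N)\<bar> \<le> R\<^sup>2 * exp (- n) \<and> \<bar>e12 (rel M N)\<bar> \<le> R\<^sup>2 * exp (- n)"
      if MN: "M \<in> U a b" "N \<in> U a b" for M N a b
    proof -
      obtain B B' where B: "opnorm B \<le> R" "opnorm B' \<le> R" "M * flow n = a * B" "N * flow n = a * B'"
        using MN by (auto simp: U_def)
      obtain E E' where E: "opnorm E \<le> R" "opnorm E' \<le> R" "M * flow (- n) = b * E" "N * flow (- n) = b * E'"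
        using MN by (auto simp: U_def)
      have "rel (M * flow n) (N * flow n) = rel B B'" "rel (M * flow (- n)) (N * flow (- n)) = rel E E'"
        unfolding B E by simp_all
      then have "exp n * e21 (rel M N) = e21 (rel B B')" "exp n * e12 (rel M N) = e12 (rel E E')"
        using rel_flow_entries(3)[of M n N] rel_flow_entries(2)[of M "- n" N] by simp_all
      moreover have "\<bar>e21 (rel B B')\<bar> \<le> R\<^sup>2" "\<bar>e12 (rel E E')\<bar> \<le> R\<^sup>2"
        using order_trans[OF entry_le_opnorm(3) opnorm_rel[OF B(1,2)]]
          order_trans[OF entry_le_opnorm(2) opnorm_rel[OF E(1,2)]] by (simp_all add: power2_eq_square)
      ultimately have "exp n * \<bar>e21 (rel M N)\<bar> \<le> R\<^sup>2" "exp n * \<bar>e12 (rel M N)\<bar> \<le> R\<^sup>2"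
        by (metis abs_mult abs_exp_cancel)+
      then show ?thesis by (simp add: exp_minus field_simps)
    qed
    have sub: "U a b \<subseteq> sparse_frames \<eta> R" for a b by (auto simp: U_def sparse_frames_def)
    have "V \<subseteq> sparse_frames \<eta> R \<and> close_frames (R\<^sup>2 * exp (- n)) V" if "V \<in> \<U>" for V
    proof -
      obtain a b where "V = U a b" using \<open>V \<in> \<U>\<close> by (auto simp: \<U>_def)
      then show ?thesis using bnd sub unfolding close_frames_def by blast
    qed
    ultimately show "\<exists>\<U>. finite \<U> \<and> card \<U> \<le> card \<S> * P ^ (2 * i) \<and> sparse_frames \<eta> R \<subseteq> \<Union>\<U> \<and>
       (\<forall>U\<in>\<U>. U \<subseteq> sparse_frames \<eta> R \<and> close_frames (R\<^sup>2 * exp (- real (i * k))) U)"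
      unfolding n_def[symmetric] by blast
  qed
qed

end

section \<open>Hausdorff measure zero\<close>

lemma ediam_le: "(\<And>x y. x \<in> U \<Longrightarrow> y \<in> U \<Longrightarrow> d x y \<le> D) \<Longrightarrow> ediam d U \<le> ennreal D"
  unfolding ediam_def by (intro SUP_least ennreal_leI) auto

lemma hausdorff_measure_0_iff:
  "hausdorff_measure M d s A = 0 \<longleftrightarrow>
     (\<forall>\<epsilon>>0. \<forall>e>0. \<exists>U :: nat \<Rightarrow> 'a set. (\<forall>i. U i \<subseteq> M \<and> ediam d (U i) \<le> ennreal \<epsilon>) \<and> A \<subseteq> (\<Union>i. U i) \<and>
        (\<Sum>i. ennreal (enn2real (ediam d (U i)) powr s)) < ennreal e)"
proof -
  have z: "x = 0 \<longleftrightarrow> (\<forall>e>0. x < ennreal e)" for x :: ennreal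
  proof
    assume *: "\<forall>e>0. x < ennreal e"
    show "x = 0"
    proof (rule ccontr)
      assume "x \<noteq> 0"
      show False
      proof (cases x)
        case (real r)
        then have "r > 0" using \<open>x \<noteq> 0\<close> by (cases "r = 0") auto
        then show False using * real by (metis less_irrefl)
      qed (use * in \<open>auto dest: spec[of _ 1]\<close>)
    qed
  qed auto
  have "hausdorff_measure M d s A = 0 \<longleftrightarrow> (\<forall>\<epsilon>>0. hausdorff_premeasure M d s \<epsilon> A = 0)"
    unfolding hausdorff_measure_def bot_ennreal[symmetric] SUP_bot_conv by auto
  also have "\<dots> \<longleftrightarrow> (\<forall>\<epsilon>>0. \<forall>e>0. hausdorff_premeasure M d s \<epsilon> A < ennreal e)"
    by (subst z) auto
  finally show ?thesis
    unfolding hausdorff_premeasure_def INF_less_iff by (simp add: Bex_def conj_assoc)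
qed

lemma hausdorff_measure_0_mono:
  assumes "hausdorff_measure M d s B = 0" "A \<subseteq> B"
  shows "hausdorff_measure M d s A = 0"
  using assms unfolding hausdorff_measure_0_iff by (meson order_trans)

lemma hausdorff_measure_0_UN:
  assumes "\<And>n :: nat. hausdorff_measure M d s (A n) = 0"
  shows "hausdorff_measure M d s (\<Union>n. A n) = 0"
  unfolding hausdorff_measure_0_iff
proof (intro allI impI)
  fix \<epsilon> e :: real assume e: "\<epsilon> > 0" "e > 0"
  \<comment> \<open>The weights sum to \<open>e / 2\<close>, which leaves room for the strict
    inequality after passing to \<open>\<le>\<close> termwise.\<close>
  define w where "w n = e / 2 * (1 / 2) ^ Suc n" for n
  have w: "w n > 0" for n using e by (simp add: w_def)
  have "\<forall>n. \<exists>U :: nat \<Rightarrow> 'a set. (\<forall>i. U i \<subseteq> M \<and> ediam d (U i) \<le> ennreal \<epsilon>) \<and> A n \<subseteq> (\<Union>i. U i) \<and>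
        (\<Sum>i. ennreal (enn2real (ediam d (U i)) powr s)) < ennreal (w n)"
    using assms e(1) w unfolding hausdorff_measure_0_iff by blast
  then obtain U :: "nat \<Rightarrow> nat \<Rightarrow> 'a set" where U: "\<And>n i. U n i \<subseteq> M" "\<And>n i. ediam d (U n i) \<le> ennreal \<epsilon>"
    "\<And>n. A n \<subseteq> (\<Union>i. U n i)" "\<And>n. (\<Sum>i. ennreal (enn2real (ediam d (U n i)) powr s)) < ennreal (w n)"
    unfolding choice_iff by blast
  define f where "f p = ennreal (enn2real (ediam d (U (fst p) (snd p))) powr s)" for p
  define V where "V i = (case prod_decode i of (n, j) \<Rightarrow> U n j)" for i
  have "(\<Sum>i. f (prod_decode i)) = (\<Sum>n. \<Sum>j. f (n, j))"
    by (rule suminf_ennreal_2dimen) (rule refl)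
  also have "\<dots> \<le> (\<Sum>n. ennreal (w n))"
    using U(4) by (intro suminf_le) (auto simp: f_def less_imp_le)
  also have "\<dots> = ennreal (e / 2)"
  proof -
    have "w sums (e / 2 * 1)" unfolding w_def by (intro sums_mult power_half_series)
    then show ?thesis using w e by (intro suminf_ennreal_eq) (auto simp: less_imp_le)
  qed
  also have "\<dots> < ennreal e" using e by (simp add: ennreal_lessI)
  finally have "(\<Sum>i. ennreal (enn2real (ediam d (V i)) powr s)) < ennreal e"
    by (simp add: f_def V_def case_prod_beta)
  moreover have "(\<Union>n. A n) \<subseteq> (\<Union>i. V i)"
  proof
    fix x assume "x \<in> (\<Union>n. A n)"
    then obtain n j where "x \<in> U n j" using U(3) by blast
    then have "x \<in> V (prod_encode (n, j))" by (simp add: V_def)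
    then show "x \<in> (\<Union>i. V i)" by blast
  qed
  moreover have "V i \<subseteq> M \<and> ediam d (V i) \<le> ennreal \<epsilon>" for i
    using U(1,2) by (simp add: V_def case_prod_beta)
  ultimately show "\<exists>U :: nat \<Rightarrow> 'a set. (\<forall>i. U i \<subseteq> M \<and> ediam d (U i) \<le> ennreal \<epsilon>) \<and> (\<Union>n. A n) \<subseteq> (\<Union>i. U i) \<and>
        (\<Sum>i. ennreal (enn2real (ediam d (U i)) powr s)) < ennreal e" by blast
qed

lemma hausdorff_measure_0_finite_cover:
  assumes "s > 0"
    and "\<And>e. e > 0 \<Longrightarrow> \<exists>\<U> D. finite \<U> \<and> (\<forall>U\<in>\<U>. U \<subseteq> M \<and> (\<forall>x\<in>U. \<forall>y\<in>U. d x y \<le> D)) \<and>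
       A \<subseteq> \<Union>\<U> \<and> 0 \<le> D \<and> D \<le> e \<and> real (card \<U>) * D powr s < e"
  shows "hausdorff_measure M d s A = 0"
  unfolding hausdorff_measure_0_iff
proof (intro allI impI)
  fix \<epsilon> e :: real assume e: "\<epsilon> > 0" "e > 0"
  then have "min \<epsilon> e > 0" by simp
  from assms(2)[OF this] obtain \<U> D where *: "finite \<U>" "A \<subseteq> \<Union>\<U>" "0 \<le> D" "D \<le> min \<epsilon> e"
      "real (card \<U>) * D powr s < min \<epsilon> e"
      and **: "\<forall>U\<in>\<U>. U \<subseteq> M \<and> (\<forall>x\<in>U. \<forall>y\<in>U. d x y \<le> D)"
    by (elim exE conjE)
  have \<U>: "finite \<U>" "\<And>U. U \<in> \<U> \<Longrightarrow> U \<subseteq> M"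
      "\<And>U x y. U \<in> \<U> \<Longrightarrow> x \<in> U \<Longrightarrow> y \<in> U \<Longrightarrow> d x y \<le> D" "A \<subseteq> \<Union>\<U>" "0 \<le> D" "D \<le> min \<epsilon> e"
      "real (card \<U>) * D powr s < min \<epsilon> e"
    using * ** by blast+
  obtain h where h: "bij_betw h {..<card \<U>} \<U>"
    using ex_bij_betw_nat_finite[OF \<U>(1)] by (auto simp: atLeast0LessThan)
  \<comment> \<open>Padding with empty sets is free: the supremum over the empty set is
    \<open>0\<close>, and \<open>0 powr s = 0\<close>.\<close>
  define V where "V i = (if i < card \<U> then h i else {})" for i
  have V: "V i \<in> \<U>" if "i < card \<U>" for i using h that by (auto simp: V_def bij_betw_def)
  have V0: "V i = {}" if "\<not> i < card \<U>" for i using that by (simp add: V_def)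
  have diam: "ediam d (V i) \<le> ennreal D" for i
    using \<U>(3)[OF V] V0 by (cases "i < card \<U>") (auto intro!: ediam_le)
  have "(\<Sum>i. ennreal (enn2real (ediam d (V i)) powr s)) = (\<Sum>i<card \<U>. ennreal (enn2real (ediam d (V i)) powr s))"
    using V0 by (intro suminf_finite) (auto simp: ediam_def bot_ennreal)
  also have "\<dots> \<le> (\<Sum>i<card \<U>. ennreal (D powr s))"
  proof (intro sum_mono ennreal_leI powr_mono2)
    show "enn2real (ediam d (V i)) \<le> D" for i
      using enn2real_mono[OF diam] \<U>(5) by simp
  qed (use assms(1) in auto)
  also have "\<dots> = ennreal (real (card \<U>) * D powr s)"
    by (simp add: ennreal_of_nat_eq_real_of_nat ennreal_mult)
  also have "\<dots> < ennreal e" using \<U>(7) e by (intro ennreal_lessI) auto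
  finally have "(\<Sum>i. ennreal (enn2real (ediam d (V i)) powr s)) < ennreal e" .
  moreover have "A \<subseteq> (\<Union>i. V i)"
  proof
    fix x assume "x \<in> A"
    then obtain U where "U \<in> \<U>" "x \<in> U" using \<U>(4) by blast
    then have "U \<in> h ` {..<card \<U>}" using h by (simp add: bij_betw_def)
    then obtain i where "i < card \<U>" "h i = U" by auto
    then show "x \<in> (\<Union>i. V i)" using \<open>x \<in> U\<close> by (auto simp: V_def)
  qed
  moreover have "V i \<subseteq> M \<and> ediam d (V i) \<le> ennreal \<epsilon>" for i
  proof
    show "V i \<subseteq> M" using \<U>(2)[OF V] V0[of i] by (cases "i < card \<U>") auto
    have "D \<le> \<epsilon>" using \<U>(6) by simp
    then show "ediam d (V i) \<le> ennreal \<epsilon>" by (rule order_trans[OF diam ennreal_leI])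
  qed
  ultimately show "\<exists>U :: nat \<Rightarrow> 'a set. (\<forall>i. U i \<subseteq> M \<and> ediam d (U i) \<le> ennreal \<epsilon>) \<and> A \<subseteq> (\<Union>i. U i) \<and>
        (\<Sum>i. ennreal (enn2real (ediam d (U i)) powr s)) < ennreal e" by blast
qed

text \<open>The cover at stage \<open>i\<close> contributes at most
  \<open>c * K powr s * (q * exp (- (s * k))) ^ i\<close>, a geometric sequence of ratio below
  \<open>1\<close>.\<close>

lemma hausdorff_measure_0_exponential_cover:
  fixes q c K k s :: real
  assumes "s > 0" "k > 0" "K > 0" "c \<ge> 0" "q \<ge> 0" "q * exp (- (s * k)) < 1"
    and "\<And>i :: nat. \<exists>\<U>. finite \<U> \<and> real (card \<U>) \<le> c * q ^ i \<and> A \<subseteq> \<Union>\<U> \<and>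
      (\<forall>U\<in>\<U>. U \<subseteq> M \<and> (\<forall>x\<in>U. \<forall>y\<in>U. d x y \<le> K * exp (- (real i * k))))"
  shows "hausdorff_measure M d s A = 0"
proof (rule hausdorff_measure_0_finite_cover[OF assms(1)])
  fix e :: real assume e: "e > 0"
  have "(\<lambda>i. (q * exp (- (s * k))) ^ i) \<longlonglongrightarrow> 0"
    using assms by (intro LIMSEQ_realpow_zero) auto
  then have "(\<lambda>i. c * K powr s * (q * exp (- (s * k))) ^ i) \<longlonglongrightarrow> 0"
    by (rule tendsto_mult_right_zero)
  moreover have "(\<lambda>i. exp (- k) ^ i) \<longlonglongrightarrow> 0"
    using assms by (intro LIMSEQ_realpow_zero) auto
  then have "(\<lambda>i. K * exp (- k) ^ i) \<longlonglongrightarrow> 0"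
    by (rule tendsto_mult_right_zero)
  ultimately have "\<forall>\<^sub>F i in sequentially. c * K powr s * (q * exp (- (s * k))) ^ i < e \<and> K * exp (- k) ^ i < e"
    using e by (intro eventually_conj order_tendstoD(2)) auto
  then obtain i where i: "c * K powr s * (q * exp (- (s * k))) ^ i < e" "K * exp (- k) ^ i < e"
    using eventually_happens trivial_limit_sequentially by (metis (no_types, lifting))
  define D where "D = K * exp (- (real i * k))"
  have De: "D = K * exp (- k) ^ i" by (simp add: D_def exp_of_nat_mult[symmetric])
  obtain \<U> where \<U>: "finite \<U>" "real (card \<U>) \<le> c * q ^ i" "A \<subseteq> \<Union>\<U>"
      "\<forall>U\<in>\<U>. U \<subseteq> M \<and> (\<forall>x\<in>U. \<forall>y\<in>U. d x y \<le> D)"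
    using assms(7)[of i] by (auto simp: D_def)
  have "D powr s = K powr s * exp (- (s * k)) ^ i"
    using assms(3) by (simp add: D_def powr_mult exp_powr_real exp_of_nat_mult[symmetric] mult_ac)
  then have "real (card \<U>) * D powr s \<le> c * q ^ i * (K powr s * exp (- (s * k)) ^ i)"
    using \<U>(2) by (simp add: mult_right_mono)
  also have "\<dots> < e" using i(1) by (simp add: power_mult_distrib mult_ac)
  finally have "real (card \<U>) * D powr s < e" .
  moreover have "0 \<le> D" "D \<le> e" using i(2) assms(3) De by (auto simp: D_def)
  ultimately show "\<exists>\<U> D. finite \<U> \<and> (\<forall>U\<in>\<U>. U \<subseteq> M \<and> (\<forall>x\<in>U. \<forall>y\<in>U. d x y \<le> D)) \<and>
       A \<subseteq> \<Union>\<U> \<and> 0 \<le> D \<and> D \<le> e \<and> real (card \<U>) * D powr s < e"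
    using \<U> by blast
qed

lemma hausdorff_dim_le:
  assumes "c \<ge> 0" "\<And>s. s > c \<Longrightarrow> hausdorff_measure M d s A = 0"
  shows "hausdorff_dim M d A \<le> ereal c"
proof (rule ereal_le_epsilon2)
  fix e :: real assume "e > 0"
  then have "hausdorff_dim M d A \<le> ereal (c + e)"
    unfolding hausdorff_dim_def using assms by (intro INF_lower) auto
  then show "hausdorff_dim M d A \<le> ereal c + ereal e" by simp
qed

lemma hausdorff_dim_nonneg: "hausdorff_dim M d A \<ge> 0"
  unfolding hausdorff_dim_def by (intro INF_greatest) auto

lemma hausdorff_dim_eq_0:
  assumes "\<And>s. s > 0 \<Longrightarrow> hausdorff_measure M d s A = 0"
  shows "hausdorff_dim M d A = 0"
  using hausdorff_dim_le[of 0 M d A] hausdorff_dim_nonneg[of M d A] assms by (simp add: zero_ereal_def)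

text \<open>The points \<open>v / cnj v\<close> and \<open>w / cnj w\<close> are at distance
  \<open>2 * \<bar>Im (v * cnj w)\<bar> / (cmod v * cmod w)\<close>. The imaginary part is a
  determinant of columns, up to sign an entry of \<open>rel\<close>, and columns have length at
  least \<open>1 / opnorm\<close>.\<close>

lemma boundary_chord:
  "cmod (act M 1 - act N 1) \<le> 2 * (opnorm M * opnorm N) * \<bar>e21 (rel M N)\<bar>"
  "cmod (act M (-1) - act N (-1)) \<le> 2 * (opnorm M * opnorm N) * \<bar>e12 (rel M N)\<bar>"
proof -
  have chord: "cmod (v / cnj v - w / cnj w) \<le> 2 * (a * b) * \<bar>Im (v * cnj w)\<bar>"
    if v: "1 / a \<le> cmod v" "a > 0" and w: "1 / b \<le> cmod w" "b > 0" for v w a b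
  proof -
    have nz: "v \<noteq> 0" "w \<noteq> 0" using v w by (auto simp: divide_le_0_iff)
    define t where "t = Im (v * cnj w)"
    have "v * cnj w - cnj (v * cnj w) = 2 * \<i> * of_real t" by (simp add: complex_eq_iff t_def)
    moreover have "v / cnj v - w / cnj w = (v * cnj w - cnj (v * cnj w)) / (cnj v * cnj w)"
      using nz by (simp add: field_simps)
    ultimately have eq: "cmod (v / cnj v - w / cnj w) = 2 * \<bar>t\<bar> * (1 / (cmod v * cmod w))"
      by (simp add: norm_mult norm_divide)
    have "1 / (cmod v * cmod w) \<le> a * b"
    proof -
      have "1 / cmod v \<le> a" "1 / cmod w \<le> b"
        using v w nz by (simp_all add: field_simps)
      then have "1 / cmod v * (1 / cmod w) \<le> a * b" using v by (intro mult_mono) auto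
      then show ?thesis by simp
    qed
    then have le: "2 * \<bar>t\<bar> * (1 / (cmod v * cmod w)) \<le> 2 * \<bar>t\<bar> * (a * b)" by (intro mult_left_mono) auto
    show ?thesis using eq le by (simp add: t_def mult_ac)
  qed
  have "\<bar>Im (Complex (e11 M) (e21 M) * cnj (Complex (e11 N) (e21 N)))\<bar> = \<bar>e21 (rel M N)\<bar>"
    "\<bar>Im (Complex (e22 M) (- e12 M) * cnj (Complex (e22 N) (- e12 N)))\<bar> = \<bar>e12 (rel M N)\<bar>"
    by (simp_all add: rel_def abs_minus_commute algebra_simps)
  then show "cmod (act M 1 - act N 1) \<le> 2 * (opnorm M * opnorm N) * \<bar>e21 (rel M N)\<bar>"
    "cmod (act M (-1) - act N (-1)) \<le> 2 * (opnorm M * opnorm N) * \<bar>e12 (rel M N)\<bar>"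
    using chord[OF col_ge_opnorm(1)[of M] _ col_ge_opnorm(1)[of N]]
      chord[OF col_ge_opnorm(2)[of M] _ col_ge_opnorm(2)[of N]]
    unfolding act_1 act_m1 by (simp_all add: norm_minus_commute)
qed

lemma opnorm_nonneg [simp]: "0 \<le> opnorm M"
  by (rule less_imp_le[OF opnorm_pos])

lemma geodesics_dist_frames:
  assumes "opnorm M \<le> R" "opnorm N \<le> R" "\<bar>e21 (rel M N)\<bar> \<le> e" "\<bar>e12 (rel M N)\<bar> \<le> e"
  shows "geodesics_dist (ends M) (ends N) \<le> 4 * R\<^sup>2 * e"
proof -
  have R: "opnorm M * opnorm N \<le> R\<^sup>2" unfolding power2_eq_square
    using assms(1,2) order_trans[OF opnorm_nonneg assms(1)] by (intro mult_mono) auto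
  have le: "2 * (opnorm M * opnorm N) * \<bar>x\<bar> \<le> 2 * R\<^sup>2 * e" if "\<bar>x\<bar> \<le> e" for x
    using R that by (intro mult_mono) auto
  show ?thesis
    using order_trans[OF boundary_chord(1) le[OF assms(3)]] order_trans[OF boundary_chord(2) le[OF assms(4)]]
    by (simp add: geodesics_dist_def ends_def dist_norm)
qed

lemma hdist_le_entries:
  "hdist (act M 0) (act N 0) \<le> 2 * (\<bar>e11 (rel M N) - e22 (rel M N)\<bar> + \<bar>e21 (rel M N)\<bar> + \<bar>e12 (rel M N)\<bar>)"
proof -
  define Q where "Q = rel M N"
  have "(1 + cmod (cb Q))\<^sup>2 = 1 + 2 * cmod (cb Q) + (cmod (cb Q))\<^sup>2" by (simp add: power2_sum)
  then have "(cmod (ca Q))\<^sup>2 \<le> (1 + cmod (cb Q))\<^sup>2"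
    using ca_cb_norm[of Q] norm_ge_zero[of "cb Q"] by linarith
  then have "cmod (ca Q) \<le> 1 + cmod (cb Q)" by (rule power2_le_imp_le) simp
  then have "opnorm Q \<le> 1 + 2 * cmod (cb Q)" by (simp add: opnorm_def)
  moreover have "ln (opnorm Q) \<le> opnorm Q - 1" by (rule ln_le_minus_one) simp
  moreover have "cmod (cb Q) \<le> \<bar>(e11 Q - e22 Q) / 2\<bar> + \<bar>(e21 Q + e12 Q) / 2\<bar>"
    using cmod_le[of "cb Q"] by (simp add: cb_def)
  moreover have "\<bar>e21 Q + e12 Q\<bar> \<le> \<bar>e21 Q\<bar> + \<bar>e12 Q\<bar>" by (rule abs_triangle_ineq)
  ultimately have "2 * ln (opnorm Q) \<le> 2 * (\<bar>e11 Q - e22 Q\<bar> + \<bar>e21 Q\<bar> + \<bar>e12 Q\<bar>)" by simp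
  then show ?thesis by (simp add: hdist_frames Q_def rel_def)
qed

section \<open>Geodesics with self-intersection angles bounded below\<close>

lemma ends_mult_cong:
  "ends M = ends N \<Longrightarrow> ends (g * M) = ends (g * N)"
  by (simp add: ends_def act_mult)

context surface_group
begin

text \<open>Only the ends are prescribed, so every point along each lift and both signs of the
  matrix are included.\<close>

definition lift_frames :: "sl2 \<Rightarrow> sl2 set" where
  "lift_frames M = {N. \<exists>g\<in>G. ends N = ends (g * M)}"

lemma self_in_lift_frames: "ends N = ends M \<Longrightarrow> N \<in> lift_frames M"
  by (auto simp: lift_frames_def intro!: bexI[of _ 1])

lemma lift_frames_mult: "g \<in> G \<Longrightarrow> N \<in> lift_frames M \<Longrightarrow> g * N \<in> lift_frames M"
proof -
  assume "g \<in> G" "N \<in> lift_frames M"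
  then obtain h where "h \<in> G" "ends N = ends (h * M)" by (auto simp: lift_frames_def)
  then have "g * h \<in> G" "ends (g * N) = ends (g * h * M)"
    using \<open>g \<in> G\<close> ends_mult_cong[of N "h * M" g] by (simp_all add: mult.assoc)
  then show ?thesis by (auto simp: lift_frames_def)
qed

lemma self_intersection_angle_le:
  assumes "h \<in> G" "ends (h * M) = \<beta>" "geodesic_line \<beta> \<noteq> geodesic_line (ends M)"
    "p \<in> geodesic_line (ends M) \<inter> geodesic_line \<beta>"
  shows "self_intersection_angle \<Gamma> (ends M) \<le> ereal (geodesic_angle p (ends M) \<beta>)"
  unfolding self_intersection_angle_def
  using assms by (intro Inf_lower CollectI exI[of _ "restrict (act h) hdisk"] exI[of _ p])
    (auto simp: geodesic_act_frame G_def)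

text \<open>\<open>(1 - cos \<delta>') / 2\<close> is \<open>sin\<^sup>2 (\<delta>' / 2)\<close>, so
  a value of \<open>crossing\<close> in the forbidden interval would give a self-intersection at an
  angle below \<open>\<delta>'\<close>. The number \<open>\<delta>\<close> itself may exceed
  \<open>pi / 2\<close>; the cap by \<open>1\<close> ensures
  \<open>arccos (cos \<delta>') = \<delta>'\<close>.\<close>

lemma lift_frames_family:
  assumes "ends M \<in> geodesics_angle_ge \<Gamma> \<delta>" "0 < \<delta>'" "\<delta>' \<le> \<delta>" "\<delta>' \<le> 1"
  shows "frame_family ((1 - cos \<delta>') / 2) (lift_frames M)"
proof -
  define \<eta> where "\<eta> = (1 - cos \<delta>') / 2"
  have "cos \<delta>' > 0" using assms(2,4) pi_gt3 by (intro cos_gt_zero_pi) auto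
  then have \<eta>: "\<eta> < 1" by (simp add: \<eta>_def)
  have "\<not> (0 < crossing N N' \<and> crossing N N' < \<eta>)" if NN: "N \<in> lift_frames M" "N' \<in> lift_frames M" for N N'
  proof
    assume X: "0 < crossing N N' \<and> crossing N N' < \<eta>"
    obtain g g' where g: "g \<in> G" "g' \<in> G" "ends N = ends (g * M)"
      "ends N' = ends (g' * M)" using NN by (auto simp: lift_frames_def)
    define h where "h = inverse g * g'"
    define L L' where "L = inverse g * N" and "L' = inverse g * N'"
    have L: "ends L = ends M" "ends L' = ends (h * M)"
      using ends_mult_cong[OF g(3), of "inverse g"] ends_mult_cong[OF g(4), of "inverse g"]
      by (simp_all add: L_def L'_def h_def mult.assoc)
    have cr: "crossing L L' = crossing N N'" by (simp add: L_def L'_def)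
    have "0 < crossing L L'" "crossing L L' < 1" using X \<eta> by (simp_all add: cr)
    then obtain p where p: "p \<in> geodesic_line (ends L) \<inter> geodesic_line (ends L')"
      "geodesic_line (ends L') \<noteq> geodesic_line (ends L)"
      "geodesic_angle p (ends L) (ends L') = arccos \<bar>1 - 2 * crossing L L'\<bar>"
      by (rule angle_of_crossing)
    have "h \<in> G" using g by (simp add: h_def)
    then have "self_intersection_angle \<Gamma> (ends M) \<le> ereal (arccos \<bar>1 - 2 * crossing L L'\<bar>)"
      using self_intersection_angle_le[OF _ _ p(2)[unfolded L] p(1)[unfolded L]] p(3) by (simp add: L)
    moreover have "arccos \<bar>1 - 2 * crossing L L'\<bar> < arccos (cos \<delta>')"
    proof (rule arccos_less_arccos)
      show "\<bar>1 - 2 * crossing L L'\<bar> \<le> 1" "cos \<delta>' < \<bar>1 - 2 * crossing L L'\<bar>"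
        using X \<eta> by (auto simp: cr \<eta>_def)
    qed simp
    moreover have "arccos (cos \<delta>') = \<delta>'" using assms(2,4) pi_gt3 by (intro arccos_cos) auto
    ultimately have "self_intersection_angle \<Gamma> (ends M) < ereal \<delta>"
      using assms(3) by (auto intro: le_less_trans)
    then show False using assms(1) by (simp add: geodesics_angle_ge_def flip: not_le)
  qed
  moreover have "N * flow t \<in> lift_frames M" if "N \<in> lift_frames M" for N t
    using that by (simp add: lift_frames_def)
  ultimately show ?thesis
    unfolding frame_family_def \<eta>_def using lift_frames_mult by blast
qed

lemma surface_proj_eq: "w \<in> hdisk \<Longrightarrow> surface_proj \<Gamma> w = {act g w | g. g \<in> G}"
  unfolding surface_proj_def by (subst Gamma_eq) (simp add: image_image setcompr_eq_image)

lemma surface_proj_act: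
  assumes "m \<in> G" "z \<in> hdisk"
  shows "surface_proj \<Gamma> (act m z) = surface_proj \<Gamma> z"
proof -
  have "\<exists>g'. act g (act m z) = act g' z \<and> g' \<in> G" if "g \<in> G" for g
    using assms that by (intro exI[of _ "g * m"]) (simp add: act_mult hdisk_cball)
  moreover have "\<exists>g'. act g z = act g' (act m z) \<and> g' \<in> G" if "g \<in> G" for g
    using assms that by (intro exI[of _ "g * inverse m"]) (simp add: act_mult hdisk_cball act_cball)
  ultimately show ?thesis using assms by (auto simp: surface_proj_eq)
qed

lemma hdist_nonneg: "z \<in> hdisk \<Longrightarrow> w \<in> hdisk \<Longrightarrow> hdist z w \<ge> 0"
  by (metis frame_at hdist_frames ln_ge_zero opnorm_ge_1 zero_le_mult_iff zero_le_numeral)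

lemma surface_dist_le:
  assumes "z \<in> hdisk" "w \<in> hdisk"
  shows "surface_dist \<Gamma> (surface_proj \<Gamma> z) (surface_proj \<Gamma> w) \<le> hdist z w"
proof -
  have "bdd_below ((\<lambda>(z, w). hdist z w) ` (surface_proj \<Gamma> z \<times> surface_proj \<Gamma> w))"
    using assms by (intro bdd_belowI2[of _ 0]) (auto simp: surface_proj_eq intro!: hdist_nonneg)
  moreover have "(z, w) \<in> surface_proj \<Gamma> z \<times> surface_proj \<Gamma> w"
    using assms by (auto simp: surface_proj_eq intro!: exI[of _ 1])
  ultimately have "(INF (z, w)\<in>surface_proj \<Gamma> z \<times> surface_proj \<Gamma> w. hdist z w) \<le> (\<lambda>(z, w). hdist z w) (z, w)"
    by (rule cINF_lower)
  then show ?thesis by (simp add: surface_dist_def)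
qed

lemma sparse_lift_frames:
  assumes "\<delta> > 0"
  obtains \<eta> where "\<eta> > 0" "\<forall>M N R. ends M \<in> geodesics_angle_ge \<Gamma> \<delta> \<longrightarrow> N \<in> lift_frames M \<longrightarrow>
     opnorm N \<le> R \<longrightarrow> N \<in> sparse_frames \<eta> R"
proof
  define \<delta>' where "\<delta>' = min \<delta> 1"
  have \<delta>': "0 < \<delta>'" "\<delta>' \<le> \<delta>" "\<delta>' \<le> 1" using assms by (auto simp: \<delta>'_def)
  have "cos \<delta>' < cos 0" using \<delta>' pi_gt3 by (intro cos_monotone_0_pi) auto
  then show "(1 - cos \<delta>') / 2 > 0" by simp
  show "\<forall>M N R. ends M \<in> geodesics_angle_ge \<Gamma> \<delta> \<longrightarrow> N \<in> lift_frames M \<longrightarrow>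
     opnorm N \<le> R \<longrightarrow> N \<in> sparse_frames ((1 - cos \<delta>') / 2) R"
    using lift_frames_family[OF _ \<delta>'] unfolding sparse_frames_def by blast
qed

lemma geodesics_angle_ge_null:
  assumes "\<delta> > 0" "s > 0"
  shows "hausdorff_measure geodesics geodesics_dist s (geodesics_angle_ge \<Gamma> \<delta>) = 0"
proof -
  obtain \<eta> where \<eta>: "\<eta> > 0" and sparse: "\<forall>M N R. ends M \<in> geodesics_angle_ge \<Gamma> \<delta> \<longrightarrow>
      N \<in> lift_frames M \<longrightarrow> opnorm N \<le> R \<longrightarrow> N \<in> sparse_frames \<eta> R"
    using sparse_lift_frames[OF assms(1)] .
  obtain \<rho> where \<rho>: "\<rho> \<ge> 1" "\<And>M. \<exists>m\<in>G. opnorm (inverse m * M) \<le> \<rho>" using cocompact_G by blast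
  have null: "hausdorff_measure geodesics geodesics_dist s (ends ` sparse_frames \<eta> R) = 0"
    if "R \<ge> \<rho>" for R
  proof -
    have R: "R \<ge> 1" using \<rho>(1) that by simp
    have R2: "\<exists>m\<in>G. opnorm (inverse m * M) \<le> R" for M using \<rho>(2)[of M] that order_trans by blast
    show ?thesis
    proof (rule sparse_frames_cover[OF \<eta> assms(2) R R2])
      fix k c P :: nat
      assume k: "k > 0" "(real P)\<^sup>2 * exp (- (s * real k)) < 1" and
      cover: "\<And>i. \<exists>\<U>. finite \<U> \<and> card \<U> \<le> c * P ^ (2 * i) \<and> sparse_frames \<eta> R \<subseteq> \<Union>\<U> \<and>
       (\<forall>U\<in>\<U>. U \<subseteq> sparse_frames \<eta> R \<and> close_frames (R\<^sup>2 * exp (- real (i * k))) U)"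
    show ?thesis
    proof (rule hausdorff_measure_0_exponential_cover[where K = "4 * R ^ 4" and k = "real k" and q = "(real P)\<^sup>2" and c = "real c"])
      show "0 < 4 * R ^ 4" using R by simp
      fix i
      obtain \<U> where \<U>: "finite \<U>" "card \<U> \<le> c * P ^ (2 * i)" "sparse_frames \<eta> R \<subseteq> \<Union>\<U>"
        and all: "\<forall>U\<in>\<U>. U \<subseteq> sparse_frames \<eta> R \<and> close_frames (R\<^sup>2 * exp (- real (i * k))) U"
        using cover[of i] by (elim exE conjE)
      have small: "U \<subseteq> sparse_frames \<eta> R" "\<And>M N. M \<in> U \<Longrightarrow> N \<in> U \<Longrightarrow>
          \<bar>e21 (rel M N)\<bar> \<le> R\<^sup>2 * exp (- real (i * k)) \<and> \<bar>e12 (rel M N)\<bar> \<le> R\<^sup>2 * exp (- real (i * k))"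
        if "U \<in> \<U>" for U using bspec[OF all that] by (simp_all add: close_frames_def)
      define \<V> where "\<V> = (`) ends ` \<U>"
      have "card \<V> \<le> card \<U>" unfolding \<V>_def by (rule card_image_le[OF \<U>(1)])
      then have "card \<V> \<le> c * P ^ (2 * i)" using \<U>(2) by simp
      then have "real (card \<V>) \<le> real (c * P ^ (2 * i))" by (rule of_nat_mono)
      then have "real (card \<V>) \<le> real c * (real P)\<^sup>2 ^ i" by (simp add: power_mult)
      moreover have "finite \<V>" "ends ` sparse_frames \<eta> R \<subseteq> \<Union>\<V>"
        unfolding \<V>_def using \<U>(1,3) by auto
      moreover have "V \<subseteq> geodesics \<and> (\<forall>x\<in>V. \<forall>y\<in>V. geodesics_dist x y \<le> 4 * R ^ 4 * exp (- (real i * real k)))"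
        if "V \<in> \<V>" for V
      proof -
        obtain U where U: "U \<in> \<U>" "V = ends ` U" using \<open>V \<in> \<V>\<close> by (auto simp: \<V>_def)
        have "geodesics_dist (ends M) (ends N) \<le> 4 * R ^ 4 * exp (- (real i * real k))"
          if MN: "M \<in> U" "N \<in> U" for M N
        proof -
          have "opnorm M \<le> R" "opnorm N \<le> R" using MN small(1)[OF U(1)] by (auto simp: sparse_frames_def)
          then have "geodesics_dist (ends M) (ends N) \<le> 4 * R\<^sup>2 * (R\<^sup>2 * exp (- real (i * k)))"
            using small(2)[OF U(1) MN] by (intro geodesics_dist_frames) auto
          then show ?thesis by (simp add: power2_eq_square power4_eq_xxxx mult.assoc)
        qed
        then show ?thesis using U(2) ends_geodesic by auto
      qed
      ultimately show "\<exists>\<U>. finite \<U> \<and> real (card \<U>) \<le> real c * (real P)\<^sup>2 ^ i \<and>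
          ends ` sparse_frames \<eta> R \<subseteq> \<Union>\<U> \<and> (\<forall>U\<in>\<U>. U \<subseteq> geodesics \<and>
           (\<forall>x\<in>U. \<forall>y\<in>U. geodesics_dist x y \<le> 4 * R ^ 4 * exp (- (real i * real k))))"
        by blast
    qed (use k assms in auto)
    qed
  qed
  \<comment> \<open>The space of geodesics is not compact: it is exhausted by frames of growing
    norm, each norm ball being treated separately.\<close>
  have "geodesics_angle_ge \<Gamma> \<delta> \<subseteq> (\<Union>n. ends ` sparse_frames \<eta> (\<rho> + real n))"
  proof
    fix \<alpha> assume \<alpha>: "\<alpha> \<in> geodesics_angle_ge \<Gamma> \<delta>"
    then obtain M where M: "ends M = \<alpha>" using frame_exists[of \<alpha>] by (auto simp: geodesics_angle_ge_def)
    obtain n where "opnorm M \<le> real n" using real_arch_simple by blast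
    then have "M \<in> sparse_frames \<eta> (\<rho> + real n)"
      using \<alpha> M \<rho>(1) by (intro sparse[rule_format, of M] self_in_lift_frames) auto
    then show "\<alpha> \<in> (\<Union>n. ends ` sparse_frames \<eta> (\<rho> + real n))" using M by blast
  qed
  then show ?thesis
    by (rule hausdorff_measure_0_mono[rotated]) (intro hausdorff_measure_0_UN null, simp)
qed

end

text \<open>When the ends of \<open>N\<close> and \<open>N'\<close> are close to those of
  \<open>L\<close>, the remaining coordinate along the geodesic is \<open>e11\<close>. The two
  determinants express \<open>e11 - e22\<close> of \<open>rel N N'\<close> through the difference of
  this coordinate and through products of two small entries.\<close>

lemma hdist_subcell:
  assumes "opnorm L \<le> R" "opnorm N \<le> R" "opnorm N' \<le> R" "0 < z" "z \<le> 1"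
    and p: "\<bar>e11 (rel L N) - e11 (rel L N')\<bar> \<le> z"
    and L: "\<bar>e12 (rel L N)\<bar> \<le> R\<^sup>2 * z" "\<bar>e21 (rel L N)\<bar> \<le> R\<^sup>2 * z"
      "\<bar>e12 (rel L N')\<bar> \<le> R\<^sup>2 * z" "\<bar>e21 (rel L N')\<bar> \<le> R\<^sup>2 * z"
    and N: "\<bar>e12 (rel N N')\<bar> \<le> R\<^sup>2 * z" "\<bar>e21 (rel N N')\<bar> \<le> R\<^sup>2 * z"
  shows "hdist (act N 0) (act N' 0) \<le> (8 * R\<^sup>2 + 8 * R ^ 4) * z"
proof -
  define p q r s p' q' r' s' where "p = e11 (rel L N)" and "q = e12 (rel L N)"
    and "r = e21 (rel L N)" and "s = e22 (rel L N)" and "p' = e11 (rel L N')" and "q' = e12 (rel L N')"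
    and "r' = e21 (rel L N')" and "s' = e22 (rel L N')"
  note defs = p_def q_def r_def s_def p'_def q'_def r'_def s'_def
  have det: "p * s - q * r = 1" "p' * s' - q' * r' = 1" unfolding defs by (rule sl2_det)+
  have "e11 (rel N N') - e22 (rel N N') = s * p' - q * r' + r * q' - p * s'"
    unfolding rel_mult[of N N' L] sl2_entries_mult sl2_entries_inverse defs by simp
  also have "\<dots> = (p' - p) * (s + s') + ((p * s - 1) - (p' * s' - 1) - q * r' + r * q')"
    by (simp add: algebra_simps)
  also have "\<dots> = (p' - p) * (s + s') + (q * r - q' * r' - q * r' + r * q')"
    using det by simp
  finally have eq: "e11 (rel N N') - e22 (rel N N') = (p' - p) * (s + s') + (q * r - q' * r' - q * r' + r * q')" .
  have ss: "\<bar>s\<bar> \<le> R\<^sup>2" "\<bar>s'\<bar> \<le> R\<^sup>2"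
    using order_trans[OF entry_le_opnorm(4) opnorm_rel[OF assms(1,2)]]
      order_trans[OF entry_le_opnorm(4) opnorm_rel[OF assms(1,3)]] by (simp_all add: defs power2_eq_square)
  have "\<bar>(p' - p) * (s + s')\<bar> \<le> z * (2 * R\<^sup>2)"
    unfolding abs_mult using p ss by (intro mult_mono) (auto simp: defs)
  moreover have prod: "\<bar>x * y\<bar> \<le> R ^ 4 * z" if "\<bar>x\<bar> \<le> R\<^sup>2 * z" "\<bar>y\<bar> \<le> R\<^sup>2 * z" for x y
  proof -
    have "\<bar>x * y\<bar> \<le> (R\<^sup>2 * z) * (R\<^sup>2 * z)"
      unfolding abs_mult using that by (intro mult_mono) auto
    also have "\<dots> = R ^ 4 * z * z" by (simp add: power2_eq_square power4_eq_xxxx)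
    also have "\<dots> \<le> R ^ 4 * z * 1" using assms(4,5) by (intro mult_left_mono) auto
    finally show ?thesis by simp
  qed
  have "\<bar>q * r\<bar> \<le> R ^ 4 * z" "\<bar>q' * r'\<bar> \<le> R ^ 4 * z" "\<bar>q * r'\<bar> \<le> R ^ 4 * z" "\<bar>r * q'\<bar> \<le> R ^ 4 * z"
    using L by (auto intro!: prod simp: defs)
  ultimately have "\<bar>e11 (rel N N') - e22 (rel N N')\<bar> \<le> z * (2 * R\<^sup>2) + 4 * (R ^ 4 * z)"
    unfolding eq by linarith
  then have "hdist (act N 0) (act N' 0) \<le> 2 * (z * (2 * R\<^sup>2) + 4 * (R ^ 4 * z) + R\<^sup>2 * z + R\<^sup>2 * z)"
    by (intro order_trans[OF hdist_le_entries] mult_left_mono add_mono N) auto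
  then show ?thesis by (simp add: algebra_simps)
qed

context surface_group
begin

text \<open>Each set of the cover is cut along the geodesic into about \<open>exp (i * k)\<close>
  pieces. This additional factor \<open>exp k\<close> per step is the reason to take the cover for
  the exponent \<open>s - 1\<close>. A single norm ball suffices, since every point of the surface
  has lifts in it.\<close>

lemma surface_image_null:
  assumes "\<delta> > 0" "s > 1"
  shows "hausdorff_measure (surface \<Gamma>) (surface_dist \<Gamma>) s (surface_image \<Gamma> (geodesics_angle_ge \<Gamma> \<delta>)) = 0"
proof -
  obtain \<eta> where \<eta>: "\<eta> > 0" and sparse: "\<forall>M N R. ends M \<in> geodesics_angle_ge \<Gamma> \<delta> \<longrightarrow>
      N \<in> lift_frames M \<longrightarrow> opnorm N \<le> R \<longrightarrow> N \<in> sparse_frames \<eta> R"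
    using sparse_lift_frames[OF assms(1)] .
  obtain R where R: "R \<ge> 1" "\<And>M. \<exists>m\<in>G. opnorm (inverse m * M) \<le> R" using cocompact_G by blast
  define pr where "pr N = surface_proj \<Gamma> (act N 0)" for N
  have "hausdorff_measure (surface \<Gamma>) (surface_dist \<Gamma>) s (pr ` sparse_frames \<eta> R) = 0"
  proof (rule sparse_frames_cover[OF \<eta> _ R, of "s - 1"])
    show "s - 1 > 0" using assms by simp
    fix k c P :: nat
    assume k: "k > 0" "(real P)\<^sup>2 * exp (- ((s - 1) * real k)) < 1" and
      cover: "\<And>i. \<exists>\<U>. finite \<U> \<and> card \<U> \<le> c * P ^ (2 * i) \<and> sparse_frames \<eta> R \<subseteq> \<Union>\<U> \<and>
       (\<forall>U\<in>\<U>. U \<subseteq> sparse_frames \<eta> R \<and> close_frames (R\<^sup>2 * exp (- real (i * k))) U)"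
    show ?thesis
    proof (rule hausdorff_measure_0_exponential_cover[where K = "8 * R\<^sup>2 + 8 * R ^ 4" and k = "real k"
        and q = "(real P)\<^sup>2 * exp (real k)" and c = "real c * (2 * R\<^sup>2 + 3)"])
      show "0 < 8 * R\<^sup>2 + 8 * R ^ 4" using R(1) by (intro add_pos_pos mult_pos_pos) auto
      show "(real P)\<^sup>2 * exp (real k) * exp (- (s * real k)) < 1"
      proof -
        have "real k + - (s * real k) = - ((s - 1) * real k)" by (simp add: algebra_simps)
        then show ?thesis using k(2) by (simp only: mult.assoc exp_add[symmetric])
      qed
      fix i
      define z where "z = exp (- real (i * k))"
      have z: "0 < z" "z \<le> 1" by (simp_all add: z_def)
      obtain \<U> where \<U>: "finite \<U>" "card \<U> \<le> c * P ^ (2 * i)" "sparse_frames \<eta> R \<subseteq> \<Union>\<U>"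
        and all: "\<forall>U\<in>\<U>. U \<subseteq> sparse_frames \<eta> R \<and> close_frames (R\<^sup>2 * z) U"
        using cover[of i] unfolding z_def by (elim exE conjE)
      have small: "U \<subseteq> sparse_frames \<eta> R" "\<And>M N. M \<in> U \<Longrightarrow> N \<in> U \<Longrightarrow>
          \<bar>e21 (rel M N)\<bar> \<le> R\<^sup>2 * z \<and> \<bar>e12 (rel M N)\<bar> \<le> R\<^sup>2 * z"
        if "U \<in> \<U>" for U using bspec[OF all that] by (simp_all add: close_frames_def)
      define w where "w = R\<^sup>2 / z"
      define J where "J = {- \<lceil>w\<rceil> .. \<lceil>w\<rceil>}"
      define L where "L U = (SOME N. N \<in> U)" for U :: "sl2 set"
      define V where "V U j = {N \<in> U. \<lfloor>e11 (rel (L U) N) / z\<rfloor> = j}" for U j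
      define \<V> where "\<V> = (\<lambda>(U, j). pr ` V U j) ` (\<U> \<times> J)"
      have L: "L U \<in> U" if "N \<in> U" for U N unfolding L_def using that by (rule someI)
      have op: "opnorm N \<le> R" if "N \<in> U" "U \<in> \<U>" for N U
        using small(1)[OF that(2)] that(1) by (auto simp: sparse_frames_def)
      have fin: "finite (\<U> \<times> J)" using \<U>(1) by (simp add: J_def)
      have w0: "w \<ge> 0" using z by (simp add: w_def)
      have cJ: "real (card J) \<le> (2 * R\<^sup>2 + 3) * exp (real k) ^ i"
      proof -
        have "real (card J) \<le> 2 * w + 3" using w0 unfolding J_def card_atLeastAtMost_int by linarith
        also have "\<dots> \<le> 2 * w + 3 / z" using z by (simp add: field_simps)
        also have "\<dots> = (2 * R\<^sup>2 + 3) * (1 / z)" by (simp add: w_def add_divide_distrib)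
        also have "1 / z = exp (real k) ^ i" by (simp add: z_def exp_minus exp_of_nat_mult[symmetric] divide_simps)
        finally show ?thesis .
      qed
      have "card \<V> \<le> card \<U> * card J"
        unfolding \<V>_def using card_image_le[OF fin] by (simp add: card_cartesian_product)
      also have "\<dots> \<le> c * P ^ (2 * i) * card J" using \<U>(2) by (rule mult_le_mono1)
      finally have "real (card \<V>) \<le> real (c * P ^ (2 * i) * card J)" by (rule of_nat_mono)
      also have "\<dots> = real c * (real P)\<^sup>2 ^ i * real (card J)" by (simp add: power_mult)
      also have "\<dots> \<le> real c * (real P)\<^sup>2 ^ i * ((2 * R\<^sup>2 + 3) * exp (real k) ^ i)"
        using cJ by (intro mult_left_mono) auto
      finally have f1: "real (card \<V>) \<le> real c * (2 * R\<^sup>2 + 3) * ((real P)\<^sup>2 * exp (real k)) ^ i"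
        by (simp add: power_mult_distrib mult_ac)
      have f2: "finite \<V>" unfolding \<V>_def using fin by (rule finite_imageI)
      have f3: "pr ` sparse_frames \<eta> R \<subseteq> \<Union>\<V>"
      proof
        fix x assume "x \<in> pr ` sparse_frames \<eta> R"
        then obtain N U where N: "x = pr N" "N \<in> U" "U \<in> \<U>" using \<U>(3) by blast
        have "\<bar>e11 (rel (L U) N)\<bar> \<le> R\<^sup>2"
          using order_trans[OF entry_le_opnorm(1) opnorm_rel[OF op[OF L[OF N(2)] N(3)] op[OF N(2,3)]]]
          by (simp add: power2_eq_square)
        then have "\<bar>e11 (rel (L U) N)\<bar> / z \<le> R\<^sup>2 / z" using z by (simp add: divide_right_mono)
        then have "\<bar>e11 (rel (L U) N) / z\<bar> \<le> w" using z by (simp add: abs_divide w_def)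
        moreover have "\<lfloor>y\<rfloor> \<in> J" if "\<bar>y\<bar> \<le> w" for y
          using that unfolding J_def atLeastAtMost_iff by linarith
        ultimately have "\<lfloor>e11 (rel (L U) N) / z\<rfloor> \<in> J" by blast
        moreover have "N \<in> V U \<lfloor>e11 (rel (L U) N) / z\<rfloor>" using N by (simp add: V_def)
        ultimately show "x \<in> \<Union>\<V>" using N unfolding \<V>_def by blast
      qed
      have f4: "X \<subseteq> surface \<Gamma> \<and> (\<forall>x\<in>X. \<forall>y\<in>X. surface_dist \<Gamma> x y \<le> (8 * R\<^sup>2 + 8 * R ^ 4) * exp (- (real i * real k)))"
        if "X \<in> \<V>" for X
      proof -
        obtain U j where U: "U \<in> \<U>" "X = pr ` V U j" using \<open>X \<in> \<V>\<close> by (auto simp: \<V>_def)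
        have "surface_dist \<Gamma> (pr N) (pr N') \<le> (8 * R\<^sup>2 + 8 * R ^ 4) * exp (- (real i * real k))"
          if "N \<in> V U j" "N' \<in> V U j" for N N'
        proof -
          have NU: "N \<in> U" "N' \<in> U" "\<lfloor>e11 (rel (L U) N) / z\<rfloor> = \<lfloor>e11 (rel (L U) N') / z\<rfloor>"
            using that by (simp_all add: V_def)
          note LU = L[OF NU(1)]
          have "surface_dist \<Gamma> (pr N) (pr N') \<le> hdist (act N 0) (act N' 0)"
            unfolding pr_def by (rule surface_dist_le) auto
          also have "\<dots> \<le> (8 * R\<^sup>2 + 8 * R ^ 4) * z"
            using small(2)[OF U(1) LU NU(1)] small(2)[OF U(1) LU NU(2)] small(2)[OF U(1) NU(1,2)]
              floor_eq_close[OF z(1) NU(3)]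
            by (intro hdist_subcell[OF op[OF LU U(1)] op[OF NU(1) U(1)] op[OF NU(2) U(1)] z]) auto
          finally show ?thesis by (simp add: z_def)
        qed
        then show ?thesis unfolding U(2) by (auto simp: pr_def surface_def)
      qed
      show "\<exists>\<U>. finite \<U> \<and> real (card \<U>) \<le> real c * (2 * R\<^sup>2 + 3) * ((real P)\<^sup>2 * exp (real k)) ^ i \<and>
          pr ` sparse_frames \<eta> R \<subseteq> \<Union>\<U> \<and> (\<forall>U\<in>\<U>. U \<subseteq> surface \<Gamma> \<and>
           (\<forall>x\<in>U. \<forall>y\<in>U. surface_dist \<Gamma> x y \<le> (8 * R\<^sup>2 + 8 * R ^ 4) * exp (- (real i * real k))))"
        by (rule exI[of _ \<V>], intro conjI f1 f2 f3, rule ballI, rule f4)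
    qed (use k assms R in auto)
  qed
  moreover have "surface_image \<Gamma> (geodesics_angle_ge \<Gamma> \<delta>) \<subseteq> pr ` sparse_frames \<eta> R"
  proof
    fix x assume "x \<in> surface_image \<Gamma> (geodesics_angle_ge \<Gamma> \<delta>)"
    then obtain \<alpha> p where p: "\<alpha> \<in> geodesics_angle_ge \<Gamma> \<delta>" "p \<in> geodesic_line \<alpha>" "x = surface_proj \<Gamma> p"
      unfolding surface_image_def by blast
    from p(2) obtain M where "ends M = \<alpha>" "p = act M 0" unfolding geodesic_line_eq by blast
    with p have \<alpha>: "\<alpha> \<in> geodesics_angle_ge \<Gamma> \<delta>" "ends M = \<alpha>" "x = pr M"
      by (simp_all add: pr_def)
    obtain m where m: "m \<in> G" "opnorm (inverse m * M) \<le> R" using R(2) by blast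
    have "inverse m * M \<in> lift_frames M"
      using m(1) self_in_lift_frames[of M M] by (intro lift_frames_mult) auto
    then have "inverse m * M \<in> sparse_frames \<eta> R" using \<alpha> m(2) by (intro sparse[rule_format, of M]) auto
    moreover have "pr M = pr (inverse m * M)"
      using surface_proj_act[OF m(1), of "act (inverse m * M) 0"] by (simp add: pr_def act_mult act_cball)
    ultimately show "x \<in> pr ` sparse_frames \<eta> R" using \<alpha>(3) by blast
  qed
  ultimately show ?thesis by (rule hausdorff_measure_0_mono)
qed

end

section \<open>Invariance of the self-intersection angle\<close>

lemma geodesic_line_mult:
  "geodesic_line (ends (m * M)) = act m ` geodesic_line (ends M)"
proof -
  have sub: "act m ` geodesic_line (ends M) \<subseteq> geodesic_line (ends (m * M))" for m M
  proof
    fix p assume "p \<in> act m ` geodesic_line (ends M)"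
    then obtain L where L: "ends L = ends M" "p = act m (act L 0)"
      unfolding geodesic_line_eq by blast
    have "ends (m * L) = ends (m * M)" by (rule ends_mult_cong[OF L(1)])
    moreover have "p = act (m * L) 0" by (simp add: L act_mult)
    ultimately show "p \<in> geodesic_line (ends (m * M))" unfolding geodesic_line_eq by blast
  qed
  show ?thesis
  proof (rule equalityI[OF _ sub], rule subsetI)
    fix p assume p: "p \<in> geodesic_line (ends (m * M))"
    then have "act (inverse m) p \<in> geodesic_line (ends M)"
      using sub[of "inverse m" "m * M"] by auto
    moreover have "p = act m (act (inverse m) p)"
      using p unfolding geodesic_line_eq by (auto simp: act_cball)
    ultimately show "p \<in> act m ` geodesic_line (ends M)" by blast
  qed
qed

lemma geodesic_line_hdisk: "geodesic_line \<alpha> \<subseteq> hdisk"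
  unfolding geodesic_line_eq by auto

lemma geodesic_line_frames:
  assumes "p \<in> geodesic_line (ends M)"
  obtains L where "ends L = ends M" "act L 0 = p"
  using assms unfolding geodesic_line_eq by blast

lemma geodesic_angle_frames':
  assumes "p \<in> geodesic_line (ends M) \<inter> geodesic_line (ends M')"
  obtains L L' where "ends L = ends M" "ends L' = ends M'"
    "act L 0 = p" "act L' 0 = p"
    "geodesic_angle p (ends M) (ends M') = arccos \<bar>Re ((ca (rel L L'))\<^sup>2)\<bar>"
proof -
  obtain L L' where L: "ends L = ends M" "act L 0 = p"
    "ends L' = ends M'" "act L' 0 = p"
    using geodesic_line_frames assms by (metis IntE)
  have "geodesic_angle p (ends M) (ends M') = arccos \<bar>Re ((ca (rel L L'))\<^sup>2)\<bar>"
    using geodesic_angle_frames[of L L'] by (simp add: L rel_def)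
  then show ?thesis using L that by blast
qed

lemma geodesic_angle_nonneg:
  assumes "p \<in> geodesic_line (ends M) \<inter> geodesic_line (ends M')"
  shows "geodesic_angle p (ends M) (ends M') \<ge> 0"
proof -
  obtain L L' where L: "act L 0 = p" "act L' 0 = p"
    "geodesic_angle p (ends M) (ends M') = arccos \<bar>Re ((ca (rel L L'))\<^sup>2)\<bar>"
    using geodesic_angle_frames'[OF assms] by metis
  have "cb (rel L L') = 0"
    using L(1,2) unfolding cb_eq_0_iff rel_def by (simp add: inverse_act_eq_iff)
  then have "(cmod (ca (rel L L')))\<^sup>2 = 1" using ca_cb_norm[of "rel L L'"] by simp
  then have "\<bar>Re ((ca (rel L L'))\<^sup>2)\<bar> \<le> 1"
    using abs_Re_le_cmod[of "(ca (rel L L'))\<^sup>2"] by (simp add: norm_power)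
  then show ?thesis unfolding L(3) by (intro arccos_lbound) auto
qed

lemma geodesic_angle_mult:
  assumes "p \<in> geodesic_line (ends M) \<inter> geodesic_line (ends M')"
  shows "geodesic_angle (act m p) (ends (m * M)) (ends (m * M'))
    = geodesic_angle p (ends M) (ends M')"
proof -
  obtain L L' where L: "ends L = ends M" "ends L' = ends M'"
    "act L 0 = p" "act L' 0 = p"
    "geodesic_angle p (ends M) (ends M') = arccos \<bar>Re ((ca (rel L L'))\<^sup>2)\<bar>"
    using geodesic_angle_frames'[OF assms] by metis
  have "act (m * L) 0 = act m p" "act (m * L') 0 = act m p" using L by (simp_all add: act_mult)
  moreover have "ends (m * L) = ends (m * M)" "ends (m * L') = ends (m * M')"
    by (rule ends_mult_cong[OF L(1)], rule ends_mult_cong[OF L(2)])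
  moreover have "inverse (m * L) * (m * L') = rel L L'" by (simp add: rel_def mult.assoc)
  ultimately show ?thesis
    using geodesic_angle_frames[of "m * L" "m * L'"] L(5) by metis
qed

context surface_group
begin

text \<open>Conjugation by \<open>m\<close> carries the self-intersections of \<open>ends M\<close>
  to self-intersections of \<open>ends (m * M)\<close> with the same angles. Applied to
  \<open>inverse m\<close>, this also gives the reverse inequality.\<close>

lemma self_intersection_angle_mono_mult:
  assumes "m \<in> G"
  shows "self_intersection_angle \<Gamma> (ends (m * M)) \<le> self_intersection_angle \<Gamma> (ends M)"
proof -
  let ?a = "ends M" and ?b = "ends (m * M)"
  have "self_intersection_angle \<Gamma> ?b \<le> ereal (geodesic_angle p ?a (geodesic_act g ?a))"
    if g: "g \<in> \<Gamma>" and ne: "geodesic_line (geodesic_act g ?a) \<noteq> geodesic_line ?a"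
      and p: "p \<in> geodesic_line ?a \<inter> geodesic_line (geodesic_act g ?a)" for g p
  proof -
    obtain h where h: "h \<in> G" "g = restrict (act h) hdisk" using Gamma_eq g by blast
    have ga: "geodesic_act g ?a = ends (h * M)" unfolding h(2) by (rule geodesic_act_frame)
    define h' where "h' = m * h * inverse m"
    have h': "h' \<in> G" "h' * (m * M) = m * (h * M)" using assms h(1) by (simp_all add: h'_def mult.assoc)
    have lines: "geodesic_line (ends (m * N)) = act m ` geodesic_line (ends N)" for N
      by (rule geodesic_line_mult)
    have inj: "inj_on (act m) hdisk"
      by (rule inj_on_inverseI[of _ "act (inverse m)"]) (simp add: hdisk_cball)
    have "geodesic_line (ends (m * (h * M))) \<noteq> geodesic_line ?b"
      using ne unfolding lines ga by (simp add: inj_on_image_eq_iff[OF inj] geodesic_line_hdisk)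
    moreover have "act m p \<in> geodesic_line ?b \<inter> geodesic_line (ends (m * (h * M)))"
      using p unfolding lines ga by blast
    ultimately have "self_intersection_angle \<Gamma> ?b \<le> ereal (geodesic_angle (act m p) ?b (ends (m * (h * M))))"
      using self_intersection_angle_le[OF h'(1), of "m * M"] h'(2) by metis
    then show ?thesis using geodesic_angle_mult[OF p[unfolded ga]] by (simp add: ga)
  qed
  then show ?thesis
    unfolding self_intersection_angle_def[of \<Gamma> ?a] by (intro Inf_greatest) blast
qed

lemma self_intersection_angle_mult:
  assumes "m \<in> G"
  shows "self_intersection_angle \<Gamma> (ends (m * M)) = self_intersection_angle \<Gamma> (ends M)"
  using self_intersection_angle_mono_mult[OF assms, of M]
    self_intersection_angle_mono_mult[OF inverse_G[OF assms], of "m * M"] by simp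

lemma self_intersection_angle_nonneg: "self_intersection_angle \<Gamma> (ends M) \<ge> 0"
  unfolding self_intersection_angle_def
proof (intro Inf_greatest, clarify)
  fix g p
  assume g: "g \<in> \<Gamma>" and p: "p \<in> geodesic_line (ends M)" "p \<in> geodesic_line (geodesic_act g (ends M))"
  obtain h where h: "g = restrict (act h) hdisk" using Gamma_eq g by blast
  show "0 \<le> ereal (geodesic_angle p (ends M) (geodesic_act g (ends M)))"
    using p geodesic_angle_nonneg[of p M "h * M"] unfolding h geodesic_act_frame by simp
qed

lemma typical_zero_angle: "typical \<Gamma> {\<alpha> \<in> geodesics. self_intersection_angle \<Gamma> \<alpha> = 0}"
  (is "typical \<Gamma> ?A")
proof -
  have mem: "ends (m * M) \<in> ?A \<longleftrightarrow> ends M \<in> ?A" if "m \<in> G" for m M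
    using self_intersection_angle_mult[OF that, of M] ends_geodesic by simp
  have "geodesic_act g ` ?A = ?A" if "g \<in> \<Gamma>" for g
  proof -
    obtain m where m: "m \<in> G" "g = restrict (act m) hdisk" using Gamma_eq \<open>g \<in> \<Gamma>\<close> by blast
    show ?thesis
    proof (intro equalityI subsetI)
      fix \<beta> assume "\<beta> \<in> geodesic_act g ` ?A"
      then obtain \<alpha> where \<alpha>: "\<alpha> \<in> ?A" "\<beta> = geodesic_act g \<alpha>" by blast
      then have "\<alpha> \<in> geodesics" by simp
      then obtain M where M: "ends M = \<alpha>" by (rule frame_exists)
      then have "\<beta> = ends (m * M)" using \<alpha>(2) m(2) geodesic_act_frame[of m M] by simp
      then show "\<beta> \<in> ?A" using mem[OF m(1)] \<alpha>(1) M by simp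
    next
      fix \<alpha> assume \<alpha>: "\<alpha> \<in> ?A"
      then have "\<alpha> \<in> geodesics" by simp
      then obtain M where M: "ends M = \<alpha>" by (rule frame_exists)
      have "ends (inverse m * M) \<in> ?A" using mem[OF inverse_G[OF m(1)], of M] \<alpha> M by simp
      moreover have "\<alpha> = geodesic_act g (ends (inverse m * M))"
        using m(2) geodesic_act_frame[of m "inverse m * M"] M by simp
      ultimately show "\<alpha> \<in> geodesic_act g ` ?A" by blast
    qed
  qed
  moreover have "geodesics - ?A \<subseteq> (\<Union>n. geodesics_angle_ge \<Gamma> (1 / real (Suc n)))"
  proof
    fix \<alpha> assume \<alpha>: "\<alpha> \<in> geodesics - ?A"
    then have "\<alpha> \<in> geodesics" by simp
    then obtain M where "ends M = \<alpha>" by (rule frame_exists)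
    then have "0 \<le> self_intersection_angle \<Gamma> \<alpha>"
      using self_intersection_angle_nonneg[of M] by simp
    moreover have "self_intersection_angle \<Gamma> \<alpha> \<noteq> 0" using \<alpha> by blast
    ultimately have "self_intersection_angle \<Gamma> \<alpha> > 0" by simp
    then obtain r where r: "0 < ereal r" "ereal r < self_intersection_angle \<Gamma> \<alpha>"
      using ereal_dense2 by blast
    then obtain n where "1 / real (Suc n) < r"
      using reals_Archimedean[of r] by (auto simp: inverse_eq_divide)
    then have "ereal (1 / real (Suc n)) \<le> self_intersection_angle \<Gamma> \<alpha>"
      using r(2) by (metis ereal_less_eq(3) less_imp_le order_trans)
    then have "\<alpha> \<in> geodesics_angle_ge \<Gamma> (1 / real (Suc n))" using \<alpha> by (simp add: geodesics_angle_ge_def)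
    then show "\<alpha> \<in> (\<Union>n. geodesics_angle_ge \<Gamma> (1 / real (Suc n)))" by blast
  qed
  then have "hausdorff_measure geodesics geodesics_dist s (geodesics - ?A) = 0" if "s > 0" for s
    by (rule hausdorff_measure_0_mono[rotated])
      (rule hausdorff_measure_0_UN, rule geodesics_angle_ge_null, use \<open>s > 0\<close> in simp_all)
  then have "hausdorff_dim geodesics geodesics_dist (geodesics - ?A) = 0"
    by (rule hausdorff_dim_eq_0)
  ultimately show ?thesis by (auto simp: typical_def)
qed

end

section \<open>A simple closed geodesic\<close>

lemma rot_pi_central: "rot pi * m = m * rot pi"
  by (auto intro!: sl2_eqI)

lemma rot_pi_square: "rot pi * rot pi = 1"
  by (auto intro!: sl2_eqI)

lemma act_rot_pi: "cmod z \<le> 1 \<Longrightarrow> act (rot pi) z = z"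
  by (simp add: act_rot)

lemma act_mult_central:
  assumes "R \<in> {1, rot pi}" "cmod z \<le> 1"
  shows "act (R * m) z = act m z" "act (m * R) z = act m z"
  using assms by (auto simp: act_mult act_rot_pi act_cball)

lemma opnorm_1_imp_fixed: "opnorm Q \<le> 1 \<Longrightarrow> act Q 0 = 0"
proof -
  assume *: "opnorm Q \<le> 1"
  have "cmod (ca Q) \<ge> 1"
    using ca_cb_norm[of Q] by (intro power2_le_imp_le[of 1]) (auto, smt (verit) zero_le_power2)
  then have "cmod (cb Q) \<le> 0" using * unfolding opnorm_def by linarith
  then show ?thesis by (simp add: act_0)
qed

context surface_group
begin

text \<open>A frame of norm \<open>2 * \<rho>\<close> has to be moved to come back into the ball of
  radius \<open>\<rho>\<close>, which \<open>1\<close> and \<open>rot pi\<close> fail to do.\<close>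

lemma nontrivial_element:
  obtains g where "g \<in> G" "g \<notin> {1, rot pi}"
proof -
  obtain \<rho> where \<rho>: "\<rho> \<ge> 1" "\<And>M. \<exists>m\<in>G. opnorm (inverse m * M) \<le> \<rho>" using cocompact_G by blast
  define t where "t = 2 * ln (2 * \<rho>)"
  obtain m where m: "m \<in> G" "opnorm (inverse m * flow t) \<le> \<rho>" using \<rho>(2) by blast
  have op: "opnorm (flow t) = 2 * \<rho>" using \<rho>(1) by (simp add: opnorm_flow t_def)
  have "m \<notin> {1, rot pi}"
  proof
    assume "m \<in> {1, rot pi}"
    then have "m * m = 1" "opnorm m = 1" by (auto simp: rot_pi_square)
    then have "opnorm (m * (inverse m * flow t)) \<le> 1 * \<rho>" using m(2) by (intro opnorm_mult_le) auto
    then show False using op \<rho>(1) by simp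
  qed
  then show ?thesis using m(1) that by blast
qed

lemma displacement_continuous: "continuous_on hdisk (\<lambda>z. hdist z (act g z))"
proof -
  have cont: "continuous_on hdisk (act g)"
    by (rule continuous_on_subset[OF act_continuous]) (auto simp: hdisk_def)
  have pos: "1 - (cmod z)\<^sup>2 > 0" "1 - (cmod (act g z))\<^sup>2 > 0" if "z \<in> hdisk" for z
    using hdisk_square[OF that] hdisk_square[OF act_hdisk[OF that]] by simp_all
  show ?thesis unfolding hdist_def
  proof (rule continuous_on_compose2[OF continuous_on_arcosh[OF order.refl]],
      intro continuous_intros cont ballI, rule_tac [2] image_subsetI)
    fix z assume "z \<in> hdisk"
    note p = mult_pos_pos[OF pos[OF this]]
    show "(1 - (cmod z)\<^sup>2) * (1 - (cmod (act g z))\<^sup>2) \<noteq> 0" using p by (metis less_irrefl)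
    show "1 + 2 * (cmod (z - act g z))\<^sup>2 / ((1 - (cmod z)\<^sup>2) * (1 - (cmod (act g z))\<^sup>2)) \<in> {1..}"
      using less_imp_le[OF p] by simp
  qed
qed

text \<open>Conjugation brings every point into a compact disk \<open>K\<close>, and only finitely
  many elements displace some point of \<open>K\<close> by at most the displacement \<open>L\<close>
  of one nontrivial element at \<open>0\<close>. So the minimum is taken over finitely many
  continuous functions on \<open>K\<close>.\<close>

lemma minimal_displacement:
  obtains g z where "g \<in> G" "g \<notin> {1, rot pi}" "z \<in> hdisk"
    "\<And>h w. h \<in> G \<Longrightarrow> h \<notin> {1, rot pi} \<Longrightarrow> w \<in> hdisk \<Longrightarrow> hdist z (act g z) \<le> hdist w (act h w)"
proof -
  obtain \<rho> where \<rho>: "\<rho> \<ge> 1" "\<And>M. \<exists>m\<in>G. opnorm (inverse m * M) \<le> \<rho>" using cocompact_G by blast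
  define r where "r = sqrt (1 - 1 / \<rho>\<^sup>2)"
  have r: "0 \<le> r" "r < 1" using \<rho>(1) by (auto simp: r_def)
  define K where "K = cball (0 :: complex) r"
  have K: "compact K" "K \<subseteq> hdisk" "K \<noteq> {}" "0 \<in> K" using r by (auto simp: K_def hdisk_def)
  have in_K: "act N 0 \<in> K" if "opnorm N \<le> \<rho>" for N
    using act_0_le[OF that] by (simp add: K_def r_def)
  have "sqrt (1 - r\<^sup>2) = 1 / \<rho>" using \<rho>(1) by (simp add: r_def real_sqrt_divide)
  then have K_frame: "opnorm N \<le> 2 * \<rho>" if "act N 0 \<in> K" for N
    using opnorm_le_act_0[of N r] that r(2) by (simp add: K_def)
  obtain g0 where g0: "g0 \<in> G" "g0 \<notin> {1, rot pi}" by (rule nontrivial_element)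
  define L where "L = hdist 0 (act g0 0)"
  define F where "F = {g \<in> G. g \<notin> {1, rot pi} \<and> (\<exists>z\<in>K. hdist z (act g z) \<le> L)}"
  have "F \<subseteq> {g \<in> G. opnorm g \<le> 2 * \<rho> * exp (L / 2) * (2 * \<rho>)}"
  proof
    fix g assume "g \<in> F"
    then obtain z where z: "g \<in> G" "z \<in> K" "hdist z (act g z) \<le> L" by (auto simp: F_def)
    obtain N where N: "act N 0 = z" using frame_at z(2) K(2) by blast
    have "hdist (act N 0) (act (g * N) 0) \<le> L" using z(3) N by (simp add: act_mult)
    then have "ln (opnorm (inverse N * (g * N))) \<le> L / 2" by (simp add: hdist_frames)
    then have "opnorm (inverse N * (g * N)) \<le> exp (L / 2)" by (metis exp_le_cancel_iff exp_ln opnorm_pos)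
    then have "opnorm (N * (inverse N * (g * N)) * inverse N) \<le> 2 * \<rho> * exp (L / 2) * (2 * \<rho>)"
      using K_frame[of N] N z(2) by (intro opnorm_mult_le) auto
    then show "g \<in> {g \<in> G. opnorm g \<le> 2 * \<rho> * exp (L / 2) * (2 * \<rho>)}" using z(1) by (simp add: mult.assoc)
  qed
  then have finF: "finite F" by (rule finite_subset) (rule finite_G)
  have g0F: "g0 \<in> F" using g0 K(4) by (auto simp: F_def L_def)
  have "\<exists>z\<in>K. \<forall>w\<in>K. hdist z (act g z) \<le> hdist w (act g w)" for g
    by (rule continuous_attains_inf[OF K(1,3)]) (rule continuous_on_subset[OF displacement_continuous K(2)])
  then obtain zm where zm: "zm g \<in> K" "\<And>w. w \<in> K \<Longrightarrow> hdist (zm g) (act g (zm g)) \<le> hdist w (act g w)" for g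
    by metis
  define D where "D g = hdist (zm g) (act g (zm g))" for g
  obtain g where g: "g \<in> F" "\<And>h. h \<in> F \<Longrightarrow> D g \<le> D h"
    using arg_min_if_finite(1)[OF finF, of D] arg_min_least[OF finF, of _ D] g0F by blast
  have DL: "D g \<le> L" using g(2)[OF g0F] zm(2)[OF K(4), of g0] by (simp add: D_def L_def)
  show ?thesis
  proof
    show "g \<in> G" "g \<notin> {1, rot pi}" using g(1) by (auto simp: F_def)
    show "zm g \<in> hdisk" using zm(1) K(2) by blast
    fix h w assume h: "h \<in> G" "h \<notin> {1, rot pi}" "w \<in> hdisk"
    obtain N where N: "act N 0 = w" using frame_at h(3) by blast
    obtain m where m: "m \<in> G" "opnorm (inverse m * N) \<le> \<rho>" using \<rho>(2) by blast
    define h' where "h' = inverse m * h * m"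
    define w' where "w' = act (inverse m) w"
    have w': "w' \<in> K" using in_K[OF m(2)] N by (simp add: w'_def act_mult)
    have h': "h' \<in> G" using m h by (simp add: h'_def)
    have "h' \<notin> {1, rot pi}"
    proof
      assume "h' \<in> {1, rot pi}"
      moreover have "h = m * h' * inverse m" by (simp add: h'_def mult.assoc)
      ultimately show False using h(2) rot_pi_central[of "inverse m"] by (auto simp: mult.assoc)
    qed
    have eq: "hdist w (act h w) = hdist w' (act h' w')"
    proof -
      have "act h' w' = act (inverse m) (act h w)"
        using h(3) by (simp add: h'_def w'_def act_mult hdisk_cball act_cball)
      then show ?thesis using hdist_act[of w "act h w" "inverse m"] h(3) by (simp add: w'_def)
    qed
    have "D g \<le> hdist w' (act h' w')"
    proof (cases "h' \<in> F")
      case True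
      then show ?thesis using g(2)[OF True] zm(2)[OF w', of h'] by (simp add: D_def)
    next
      case False
      then have "\<not> hdist w' (act h' w') \<le> L"
        using h' \<open>h' \<notin> {1, rot pi}\<close> w' by (auto simp: F_def)
      then show ?thesis using DL by simp
    qed
    then show "hdist (zm g) (act g (zm g)) \<le> hdist w (act h w)" by (simp add: eq D_def)
  qed
qed

text \<open>For the frame at \<open>z\<close> pointing towards \<open>act g z\<close>, the element
  \<open>g\<close> acts as the flow followed by a rotation \<open>R\<close>. If \<open>R\<close>
  changed the line of direction, the midpoint of the segment would be displaced less: there
  \<open>cb\<close> is \<open>sinh (len / 2) * e11 R\<close> instead of
  \<open>sinh (len / 2)\<close>. Minimality forces \<open>e11 R\<close> to be \<open>1\<close> or
  \<open>-1\<close>.\<close>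

lemma shortest_axis:
  obtains g M len R where "g \<in> G" "len > 0" "R \<in> {1, rot pi}" "g * M = M * flow len * R"
    "\<And>h w. h \<in> G \<Longrightarrow> h \<notin> {1, rot pi} \<Longrightarrow> w \<in> hdisk \<Longrightarrow> len \<le> hdist w (act h w)"
proof -
  obtain g z where g: "g \<in> G" "g \<notin> {1, rot pi}" "z \<in> hdisk" and
    least: "\<And>h w. h \<in> G \<Longrightarrow> h \<notin> {1, rot pi} \<Longrightarrow> w \<in> hdisk \<Longrightarrow> hdist z (act g z) \<le> hdist w (act h w)"
    by (rule minimal_displacement) metis
  define len where "len = hdist z (act g z)"
  obtain M where M: "act M 0 = z" "act M (of_real (tanh (len / 2))) = act g z"
    using two_point_frame[of z "act g z"] g(3) unfolding len_def by auto
  define Q where "Q = inverse M * (g * M)"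
  have gM: "g * M = M * Q" by (simp add: Q_def)
  have lenQ: "len = 2 * ln (opnorm Q)"
    using hdist_frames[of M "g * M"] M(1) by (simp add: len_def Q_def act_mult)
  have len: "len > 0"
  proof (rule ccontr)
    assume "\<not> len > 0"
    then have "ln (opnorm Q) \<le> 0" using lenQ by simp
    then have "opnorm Q \<le> 1" by simp
    then have "act Q 0 = 0" by (rule opnorm_1_imp_fixed)
    then have "act g z = z" using arg_cong[OF gM, of "\<lambda>m. act m 0"] M(1) by (simp add: act_mult)
    then show False using G_fixed_point[OF g(1,3)] g(2) by blast
  qed
  define R where "R = flow (- len) * Q"
  have Q: "Q = flow len * R" by (simp add: R_def flow_add flip: mult.assoc)
  have "act (M * Q) 0 = act M (act (flow len) 0)"
    using M unfolding gM[symmetric] by (simp add: act_mult act_flow_0)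
  then have "act (inverse M) (act M (act Q 0)) = act (inverse M) (act M (act (flow len) 0))"
    by (simp add: act_mult)
  then have "act Q 0 = act (flow len) 0" by (simp add: act_cball)
  then have "act R 0 = 0"
    using inverse_act_eq_iff[of 0 0 "flow len" Q] by (simp add: R_def)
  then have cb0: "cb R = 0" by (simp add: cb_eq_0_iff)
  then have sym: "e22 R = e11 R" "e12 R = - e21 R" by (simp_all add: cb_def complex_eq_iff)
  define h where "h = len / 2"
  define N where "N = M * flow h"
  have "len \<le> hdist (act N 0) (act g (act N 0))"
    unfolding len_def by (rule least[OF g(1,2)]) simp
  also have "\<dots> = 2 * ln (opnorm (flow h * (R * flow h)))"
  proof -
    have "inverse N * (g * N) = flow (- h) * (flow len * (R * flow h))"
      unfolding N_def using gM Q by (simp add: mult.assoc flip: mult.assoc[of g M])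
    also have "\<dots> = flow h * (R * flow h)" by (simp add: flow_add h_def flip: mult.assoc)
    finally show ?thesis using hdist_frames[of N "g * N"] by (simp add: act_mult act_cball)
  qed
  finally have "cosh (2 * ln (opnorm (flow len))) \<le> cosh (2 * ln (opnorm (flow h * (R * flow h))))"
    using len opnorm_ge_1 by (subst cosh_real_nonneg_le_iff) (auto simp: opnorm_flow)
  then have "(cmod (cb (flow len)))\<^sup>2 \<le> (cmod (cb (flow h * (R * flow h))))\<^sup>2"
    unfolding opnorm_cosh by simp
  moreover have "cb (flow len) = of_real (sinh h)" by (simp add: ca_cb_flow h_def)
  moreover have "(exp h * c - exp (- h) * c) / 2 = sinh h * c" for c
    by (simp add: sinh_field_def field_simps)
  then have "cb (flow h * (R * flow h)) = of_real (sinh h * e11 R)"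
    unfolding cb_def flow_conj_entries using sym by (simp add: complex_eq_iff)
  ultimately have "(sinh h)\<^sup>2 \<le> (sinh h)\<^sup>2 * (e11 R)\<^sup>2"
    by (simp add: power_mult_distrib abs_mult del: of_real_mult)
  moreover have "(sinh h)\<^sup>2 > 0" using len by (simp add: h_def)
  ultimately have "1 \<le> (e11 R)\<^sup>2" by simp
  moreover have "(e11 R)\<^sup>2 + (e21 R)\<^sup>2 = 1" using sl2_det[of R] sym by (simp add: power2_eq_square)
  ultimately have "e21 R = 0" "(e11 R)\<^sup>2 = 1" by (smt (verit) zero_le_power2 zero_eq_power2)+
  then have "R = 1 \<or> R = rot pi"
    using sym by (auto intro!: sl2_eqI simp: power2_eq_1_iff)
  then have "R \<in> {1, rot pi}" by simp
  moreover have "g * M = M * flow len * R" by (simp add: gM Q mult.assoc)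
  ultimately show ?thesis
    using that[of g len R M] g(1) len least unfolding len_def[symmetric] by blast
qed


lemma axis_translates:
  assumes g: "g \<in> G" "R \<in> {1, rot pi}" "g * M = M * flow len * R"
  shows "\<exists>h\<in>G. \<exists>R\<in>{1, rot pi}. h * M = M * flow (of_int n * len) * R"
proof -
  have pos: "\<exists>h\<in>G. \<exists>R\<in>{1, rot pi}. h * M = M * flow (real n * len) * R" for n
  proof (induction n)
    case 0
    show ?case by (intro bexI[of _ 1]) auto
  next
    case (Suc n)
    then obtain h R' where h: "h \<in> G" "R' \<in> {1, rot pi}" "h * M = M * flow (real n * len) * R'" by blast
    have "g * h * M = g * M * flow (real n * len) * R'" by (simp add: h(3) mult.assoc)
    also have "\<dots> = M * flow len * (R * flow (real n * len)) * R'" by (simp add: g(3) mult.assoc)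
    also have "R * flow (real n * len) = flow (real n * len) * R" using g(2) rot_pi_central by auto
    also have "M * flow len * (flow (real n * len) * R) * R' = M * flow (real (Suc n) * len) * (R * R')"
      by (simp add: mult.assoc algebra_simps flow_add flip: mult.assoc[of "flow _" "flow _"])
    finally have "g * h * M = M * flow (real (Suc n) * len) * (R * R')" .
    moreover have "R * R' \<in> {1, rot pi}" using g(2) h(2) rot_pi_square by auto
    ultimately show ?case using mult_G[OF g(1) h(1)] by blast
  qed
  show ?thesis
  proof (cases "n \<ge> 0")
    case True
    then show ?thesis using pos[of "nat n"] by simp
  next
    case False
    then obtain h R' where h: "h \<in> G" "R' \<in> {1, rot pi}" "h * M = M * flow (real (nat (- n)) * len) * R'"
      using pos by blast
    have n: "real (nat (- n)) = - of_int n" using False by simp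
    have R: "R' * (flow (of_int n * len) * R') = flow (of_int n * len)"
    proof -
      have "flow (of_int n * len) * R' = R' * flow (of_int n * len)" using h(2) rot_pi_central by auto
      moreover have "R' * R' = 1" using h(2) rot_pi_square by auto
      ultimately show ?thesis by (simp flip: mult.assoc)
    qed
    have "h * (M * flow (of_int n * len) * R') = (h * M) * (flow (of_int n * len) * R')" by (simp add: mult.assoc)
    also have "\<dots> = M * flow (- of_int n * len) * (R' * (flow (of_int n * len) * R'))"
      unfolding h(3) n by (simp add: mult.assoc)
    also have "\<dots> = M" unfolding R by (simp add: mult.assoc flow_add)
    finally have "inverse h * M = M * flow (of_int n * len) * R'" by (metis sl2_inverse(3))
    then show ?thesis using inverse_G[OF h(1)] h(2) by blast
  qed
qed

text \<open>A translate of the shortest axis that met it in a further point could be translated along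
  itself so that some point is moved by at most half the minimal displacement.\<close>

lemma simple_geodesic:
  obtains M len where "len > 0" "self_intersection_angle \<Gamma> (ends M) = \<infinity>"
    "\<And>h w. h \<in> G \<Longrightarrow> h \<notin> {1, rot pi} \<Longrightarrow> w \<in> hdisk \<Longrightarrow> len \<le> hdist w (act h w)"
proof (rule shortest_axis)
  fix g M len R
  assume g: "g \<in> G" and len: "len > 0" and R: "R \<in> {1, rot pi}" and gM: "g * M = M * flow len * R"
    and least: "\<And>h w. h \<in> G \<Longrightarrow> h \<notin> {1, rot pi} \<Longrightarrow> w \<in> hdisk \<Longrightarrow> len \<le> hdist w (act h w)"
  have same: "geodesic_line (ends (k * M)) = geodesic_line (ends M)"
    if k: "k \<in> G" and p: "p \<in> geodesic_line (ends M) \<inter> geodesic_line (ends (k * M))" for k p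
  proof -
    obtain L where L: "ends L = ends M" "act L 0 = p"
      using p by (blast elim: geodesic_line_frames)
    obtain t where t: "p = act (M * flow t) 0" using same_ends[OF L(1)[symmetric]] L(2) by metis
    obtain L' where L': "ends L' = ends (k * M)" "act L' 0 = p"
      using p by (blast elim: geodesic_line_frames)
    obtain t' where t': "p = act (k * M * flow t') 0" using same_ends[OF L'(1)[symmetric]] L'(2) by metis
    \<comment> \<open>\<open>n * len\<close> is the multiple of the translation length nearest to
      \<open>t - t'\<close>. The element \<open>k * h\<close> will carry the point of the axis at
      time \<open>t' + n * len\<close> to the point at time \<open>t\<close>, which is a
      displacement of at most \<open>len / 2\<close>.\<close>
    define n where "n = round ((t - t') / len)"
    obtain h R' where h: "h \<in> G" "R' \<in> {1, rot pi}" "h * M = M * flow (of_int (- n) * len) * R'"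
      using axis_translates[OF g R gM] by blast
    define N where "N = M * flow (t' + of_int n * len)"
    have "k * h * N = (k * M * flow t') * R'"
    proof -
      have "k * h * N = k * (h * M) * flow (t' + of_int n * len)" by (simp add: N_def mult.assoc)
      also have "\<dots> = k * M * (flow (- of_int n * len) * flow (t' + of_int n * len)) * R'"
        unfolding h(3) using h(2) rot_pi_central by (auto simp: mult.assoc)
      also have "flow (- of_int n * len) * flow (t' + of_int n * len) = flow t'" by (simp add: flow_add)
      finally show ?thesis .
    qed
    then have "act (k * h * N) 0 = act (k * M * flow t' * R') 0" by (rule arg_cong)
    then have "act (k * h * N) 0 = p" using h(2) t' act_mult_central(2)[OF h(2), of 0] by simp
    then have "hdist (act N 0) (act (k * h) (act N 0)) = hdist (act N 0) (act (M * flow t) 0)"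
      using t by (simp add: act_mult act_cball)
    also have "\<dots> = \<bar>t - t' - of_int n * len\<bar>"
      by (simp add: hdist_frames N_def mult.assoc flow_add opnorm_flow)
    also have "\<dots> = len * \<bar>of_int n - (t - t') / len\<bar>"
      using len by (simp add: abs_mult_pos' field_simps)
    also have "\<dots> \<le> len * (1 / 2)"
      unfolding n_def using len of_int_round_abs_le by (intro mult_left_mono) auto
    also have "\<dots> < len" using len by simp
    finally have "k * h \<in> {1, rot pi}"
      using least[of "k * h" "act N 0"] mult_G[OF k h(1)] by force
    \<comment> \<open>As \<open>k * h\<close> acts trivially, \<open>k\<close> acts as
      \<open>inverse h\<close>, which preserves the axis.\<close>
    moreover have "k * M = k * h * (inverse h * M)" by (simp add: mult.assoc)
    moreover have "inverse h * (h * M) = inverse h * (M * flow (of_int (- n) * len) * R')" by (simp only: h(3))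
    then have hM: "M = inverse h * M * (flow (of_int (- n) * len) * R')" by (simp add: mult.assoc)
    have fr: "ends (Q * (flow x * R')) = ends Q" for Q x
      using act_mult_central(2)[OF h(2)] by (simp add: ends_def act_mult act_cball)
    have "ends M = ends (inverse h * M)" by (subst hM) (rule fr)
    moreover have "ends (Q * N) = ends N" if "Q \<in> {1, rot pi}" for Q N
      using act_mult_central(1)[OF that] by (simp add: ends_def)
    ultimately show ?thesis by metis
  qed
  have "geodesic_line (geodesic_act k (ends M)) = geodesic_line (ends M)"
    if "k \<in> \<Gamma>" "p \<in> geodesic_line (ends M) \<inter> geodesic_line (geodesic_act k (ends M))" for k p
  proof -
    obtain m where m: "m \<in> G" "k = restrict (act m) hdisk" using Gamma_eq \<open>k \<in> \<Gamma>\<close> by blast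
    show ?thesis using same[OF m(1), of p] that(2) unfolding m(2) geodesic_act_frame by blast
  qed
  then have "{ereal (geodesic_angle p (ends M) (geodesic_act g (ends M))) | g p.
            g \<in> \<Gamma> \<and> geodesic_line (geodesic_act g (ends M)) \<noteq> geodesic_line (ends M) \<and>
            p \<in> geodesic_line (ends M) \<inter> geodesic_line (geodesic_act g (ends M))} = {}"
    by blast
  then have "self_intersection_angle \<Gamma> (ends M) = \<infinity>"
    unfolding self_intersection_angle_def by (simp only: Inf_empty top_ereal_def)
  then show ?thesis using that len least by blast
qed

text \<open>A nontrivial deck transformation displaces \<open>w\<close> by at least
  \<open>len\<close>, so the image of \<open>w\<close> has distance at least
  \<open>len - \<bar>t - t'\<bar> \<ge> len / 2\<close> from \<open>z\<close>. This is why the arc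
  is only half as long as the closed geodesic.\<close>

lemma surface_dist_short_arc:
  assumes len: "len > 0"
    and least: "\<And>h w. h \<in> G \<Longrightarrow> h \<notin> {1, rot pi} \<Longrightarrow> w \<in> hdisk \<Longrightarrow> len \<le> hdist w (act h w)"
    and t: "t \<in> {0..len / 2}" "t' \<in> {0..len / 2}"
  shows "\<bar>t - t'\<bar> \<le> surface_dist \<Gamma> (surface_proj \<Gamma> (act (M * flow t) 0)) (surface_proj \<Gamma> (act (M * flow t') 0))"
proof -
  define z w where "z = act (M * flow t) 0" and "w = act (M * flow t') 0"
  have zw: "z \<in> hdisk" "w \<in> hdisk" by (simp_all add: z_def w_def)
  have zw_dist: "hdist z w = \<bar>t - t'\<bar>"
    by (simp add: z_def w_def hdist_frames mult.assoc flow_add opnorm_flow)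
  have main: "\<bar>t - t'\<bar> \<le> hdist (act g z) (act g' w)" if g: "g \<in> G" "g' \<in> G" for g g'
  proof -
    define h where "h = inverse g * g'"
    have h: "h \<in> G" using g by (simp add: h_def)
    have "hdist (act g z) (act g' w) = hdist z (act h w)"
      using hdist_act[of z "act h w" g] zw by (simp add: h_def act_mult hdisk_cball act_cball)
    moreover have "\<bar>t - t'\<bar> \<le> hdist z (act h w)"
    proof (cases "h \<in> {1, rot pi}")
      case True
      then have "act h w = w" using zw(2) act_rot_pi by (auto simp: hdisk_cball)
      then show ?thesis using zw_dist by simp
    next
      case False
      have "len \<le> hdist w (act h w)" by (rule least[OF h False zw(2)])
      also have "\<dots> \<le> hdist w z + hdist z (act h w)" using zw by (intro hdist_triangle) auto
      finally have "len \<le> \<bar>t - t'\<bar> + hdist z (act h w)" using zw_dist by (simp add: hdist_commute)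
      moreover have "\<bar>t - t'\<bar> \<le> len / 2" using t unfolding atLeastAtMost_iff by linarith
      ultimately show ?thesis by linarith
    qed
    ultimately show ?thesis by simp
  qed
  have "surface_proj \<Gamma> z \<times> surface_proj \<Gamma> w \<noteq> {}" using zw by (auto simp: surface_proj_eq) (use one_G in blast)
  then have "\<bar>t - t'\<bar> \<le> (INF (z, w)\<in>surface_proj \<Gamma> z \<times> surface_proj \<Gamma> w. hdist z w)"
    by (rule cINF_greatest) (use main zw in \<open>auto simp: surface_proj_eq\<close>)
  then show ?thesis by (simp add: surface_dist_def z_def w_def)
qed

end

text \<open>Passing from the arc back to its parameter does not increase distances, so a cover of
  the arc yields a cover of \<open>{0..r}\<close> by intervals of twice the diameters, and Lebesgue
  measure bounds their sum from below. Diameters at most \<open>1\<close> allow the passage from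
  exponent \<open>1\<close> to \<open>s \<le> 1\<close>.\<close>

lemma hausdorff_measure_arc:
  assumes r: "r > 0" and s: "0 < s" "s \<le> 1"
    and expand: "\<And>t t'. t \<in> {0..r} \<Longrightarrow> t' \<in> {0..r} \<Longrightarrow> \<bar>t - t'\<bar> \<le> d (c t) (c t')"
    and sub: "c ` {0..r} \<subseteq> A"
  shows "hausdorff_measure M d s A \<noteq> 0"
proof
  assume "hausdorff_measure M d s A = 0"
  then obtain U :: "nat \<Rightarrow> 'a set" where U: "\<And>i. ediam d (U i) \<le> ennreal 1" "A \<subseteq> (\<Union>i. U i)"
    "(\<Sum>i. ennreal (enn2real (ediam d (U i)) powr s)) < ennreal (r / 2)"
    unfolding hausdorff_measure_0_iff using r by (meson half_gt_zero zero_less_one)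
  define D where "D i = enn2real (ediam d (U i))" for i
  have D: "0 \<le> D i" "D i \<le> 1" for i
    using enn2real_mono[OF U(1)[of i]] by (simp_all add: D_def)
  have Ds: "D i \<le> D i powr s" for i
  proof (cases "D i = 0")
    case False
    then have "D i powr 1 \<le> D i powr s" using D[of i] s by (intro powr_mono') auto
    then show ?thesis using D[of i] by simp
  qed simp
  \<comment> \<open>If no parameter is mapped into \<open>U i\<close>, the centre is arbitrary; the
    interval then has nothing to cover and its length is still counted correctly.\<close>
  define I where "I i = (let a = SOME t. t \<in> {0..r} \<and> c t \<in> U i in {a - D i .. a + D i})" for i
  have meas: "emeasure lborel (I i) = 2 * ennreal (D i)" for i
    using D[of i] by (simp add: I_def Let_def ennreal_mult' flip: mult_2)
  have "{0..r} \<subseteq> (\<Union>i. I i)"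
  proof
    fix t assume t: "t \<in> {0..r}"
    then obtain i where i: "c t \<in> U i" using sub U(2) by blast
    define a where "a = (SOME t. t \<in> {0..r} \<and> c t \<in> U i)"
    have a: "a \<in> {0..r}" "c a \<in> U i"
      using someI[of "\<lambda>t. t \<in> {0..r} \<and> c t \<in> U i" t] t i by (auto simp: a_def)
    have "ennreal (d (c a) (c t)) \<le> ediam d (U i)"
      unfolding ediam_def using a(2) i by (intro SUP_upper2[of "c a"] SUP_upper) auto
    then have "enn2real (ennreal (d (c a) (c t))) \<le> D i"
      unfolding D_def using U(1)[of i] by (intro enn2real_mono) (auto intro: le_less_trans)
    moreover have le: "\<bar>a - t\<bar> \<le> d (c a) (c t)" by (rule expand[OF a(1) t])
    then have "0 \<le> d (c a) (c t)" by linarith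
    ultimately have "\<bar>a - t\<bar> \<le> D i" using le by simp
    moreover have "I i = {a - D i .. a + D i}" by (simp only: I_def Let_def a_def)
    ultimately have "t \<in> I i" by (simp add: abs_le_iff)
    then show "t \<in> (\<Union>i. I i)" by blast
  qed
  then have "emeasure lborel {0..r} \<le> emeasure lborel (\<Union>i. I i)"
    by (intro emeasure_mono) (auto simp: I_def Let_def)
  also have "\<dots> \<le> (\<Sum>i. emeasure lborel (I i))"
    by (intro emeasure_subadditive_countably) (auto simp: I_def Let_def)
  also have "\<dots> = 2 * (\<Sum>i. ennreal (D i))" unfolding meas by (rule ennreal_suminf_cmult)
  also have "\<dots> \<le> 2 * (\<Sum>i. ennreal (D i powr s))"
    by (intro mult_left_mono suminf_le ennreal_leI Ds) auto
  also have "\<dots> < 2 * ennreal (r / 2)"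
    using U(3) unfolding D_def by (intro ennreal_mult_strict_left_mono) auto
  also have "\<dots> = ennreal (2 * (r / 2))" using ennreal_mult[of 2 "r / 2"] r by simp
  finally show False by (simp add: r less_imp_le)
qed

context surface_group
begin

lemma surface_image_dim:
  assumes "\<delta> > 0"
  shows "hausdorff_dim (surface \<Gamma>) (surface_dist \<Gamma>) (surface_image \<Gamma> (geodesics_angle_ge \<Gamma> \<delta>)) = 1"
proof (rule antisym)
  show "hausdorff_dim (surface \<Gamma>) (surface_dist \<Gamma>) (surface_image \<Gamma> (geodesics_angle_ge \<Gamma> \<delta>)) \<le> 1"
    using hausdorff_dim_le[OF _ surface_image_null[OF assms]] by (simp add: one_ereal_def)
  show "1 \<le> hausdorff_dim (surface \<Gamma>) (surface_dist \<Gamma>) (surface_image \<Gamma> (geodesics_angle_ge \<Gamma> \<delta>))"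
  proof (rule simple_geodesic)
    fix M len
    assume len: "len > 0" and M: "self_intersection_angle \<Gamma> (ends M) = \<infinity>"
      and least: "\<And>h w. h \<in> G \<Longrightarrow> h \<notin> {1, rot pi} \<Longrightarrow> w \<in> hdisk \<Longrightarrow> len \<le> hdist w (act h w)"
    have "ends M \<in> geodesics_angle_ge \<Gamma> \<delta>"
      using M ends_geodesic by (simp add: geodesics_angle_ge_def)
    moreover have "act (M * flow t) 0 \<in> geodesic_line (ends M)" for t
      unfolding geodesic_line_eq using ends_flow by blast
    ultimately have "(\<lambda>t. surface_proj \<Gamma> (act (M * flow t) 0)) ` {0..len / 2}
        \<subseteq> surface_image \<Gamma> (geodesics_angle_ge \<Gamma> \<delta>)"
      unfolding surface_image_def by blast
    then have "hausdorff_measure (surface \<Gamma>) (surface_dist \<Gamma>) s (surface_image \<Gamma> (geodesics_angle_ge \<Gamma> \<delta>)) \<noteq> 0"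
      if "0 < s" "s \<le> 1" for s
      using len that surface_dist_short_arc[OF len least] by (intro hausdorff_measure_arc[where r = "len / 2"]) auto
    then show ?thesis
      unfolding hausdorff_dim_def by (intro INF_greatest) (force simp: one_ereal_def not_le[symmetric])
  qed
qed

end

theorem theorem1:
  fixes \<Gamma> :: "(complex \<Rightarrow> complex) set"
  assumes "closed_hyperbolic_surface \<Gamma>"
  shows "(\<forall>\<delta>>0. hausdorff_dim geodesics geodesics_dist (geodesics_angle_ge \<Gamma> \<delta>) = 0) \<and>
         typical \<Gamma> {\<alpha>\<in>geodesics. self_intersection_angle \<Gamma> \<alpha> = 0} \<and>
         (\<forall>\<delta>>0. hausdorff_dim (surface \<Gamma>) (surface_dist \<Gamma>)
                   (surface_image \<Gamma> (geodesics_angle_ge \<Gamma> \<delta>)) = 1)"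
proof -
  interpret surface_group \<Gamma> by unfold_locales (rule assms)
  show ?thesis
    using geodesics_angle_ge_null typical_zero_angle surface_image_dim
    by (blast intro: hausdorff_dim_eq_0)
qed

end
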